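(* Let $N\ge3$, $k\in(0,N-1)$, $p,\lambda>0$ and $\mu\equiv0$, so that a positive solution of (P) is a measurable $u$ satisfying conditions (a), (b) of the context and, for a.e. $x\in\mathbb R^N_+$, $$u(x)=\frac{2\lambda}{(N-2)\sigma_N}\int_{\mathbb R^{N-1}}\int_{\mathbb R^{N-1}}\frac{u(z',0)^p}{|x-(y',0)|^{N-2}|y'-z'|^k}\,dz'\,dy'. \tag{E}$$ Then: (i) If $0<k\le1$, or if $1<k<N-1$ and $0<p<\frac{N-1}{k-1}$, there is no positive solution; if $1<k<N-1$ and $p=\frac{N-1}{k-1}$, there is no positive solution $u$ with $u(\cdot,0)\in L^p(\mathbb R^{N-1})$. (ii) If $1<k<N-1$ and $p>\frac{N-1}{k-1}$, then there is a constant $C=C(N,\lambda,p,k)>0$ such that $$u(x)=C\int_{\mathbb R^{N-1}}\frac{dy'}{|x-(y',0)|^{N-2}\,|y'|^{1+\frac{N-k}{p-1}}}\quad\text{a.e. in }\mathbb R^N_+$$ is a positive solution; moreover this $u$ is regular if and only if $p>2\cdot\frac{N-1}{k-1}-1$. (iii) If $1<k<N-1$ and $0<p<2\cdot\frac{N-1}{k-1}-1$, there is no regular solution. (iv) If $1<k<N-1$ and $p=2\cdot\frac{N-1}{k-1}-1$, then there is a constant $C(N,k,\lambda)>0$ such that all regular solutions are of the form $$u_{\zeta',t}(x)=C(N,k,\lambda)\int_{\mathbb R^{N-1}}\int_{\mathbb R^{N-1}}\frac{\left(\frac{t}{t^2+|z'-\zeta'|^2}\right)^{N-\frac{k+1}{2}}}{|x-(y',0)|^{N-2}|y'-z'|^k}\,dz'\,dy',$$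 with $\zeta'\in\mathbb R^{N-1}$ and $t>0$.
   Context: Notation: $\mathbb R^N_+=\mathbb R^{N-1}\times(0,\infty)$, $x=(x',x_N)$; $\sigma_N$ is the surface area of the unit sphere in $\mathbb R^N$; $H_u(x')=\int_{\mathbb R^{N-1}}\frac{u(y',0)^p}{|x'-y'|^k}dy'$. Conditions: (a) $u>0$ a.e. in $\mathbb R^N_+$ and for a.e. $x'\in\mathbb R^{N-1}$ the limit $\lim_{z\in\mathbb R^N_+,\,z\to(x',0)}u(z)$ exists and is finite, denoted $u(x',0)$; (b) $H_u$ is finite a.e. in $\mathbb R^{N-1}$ and $\int_{\mathbb R^{N-1}}\frac{H_u(y')}{|x-(y',0)|^{N-2}}dy'<\infty$ for a.e. $x\in\mathbb R^N_+$. A solution $u$ of (E) is called regular if $1<k<N-1$ and $u(\cdot,0)\in L^{\frac{2(N-1)}{k-1}}_{loc}(\mathbb R^{N-1})$. *)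

theory Defs
  imports "HOL-Analysis.Analysis"
begin

text \<open>Points of the half space R^N_+ are pairs (x', x_N) with x' in real^'n, where
  CARD('n) = N - 1.  The norm on the product type is the Euclidean norm.\<close>

definition sphere_area :: "nat \<Rightarrow> real" where
  "sphere_area N = 2 * pi powr (real N / 2) / Gamma (real N / 2)"

definition halfspace :: "((real^'n) \<times> real) set" where
  "halfspace = {x. snd x > 0}"

definition btrace :: "((real^'n) \<times> real \<Rightarrow> real) \<Rightarrow> real^'n \<Rightarrow> real" where
  "btrace u y = Lim (at (y, 0) within halfspace) u"

definition Hu :: "real \<Rightarrow> real \<Rightarrow> ((real^'n) \<times> real \<Rightarrow> real) \<Rightarrow> real^'n \<Rightarrow> ennreal" where
  "Hu p k u x = (\<integral>\<^sup>+ y. ennreal (btrace u y powr p / norm (x - y) powr k) \<partial>lebesgue)"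

definition pos_solution :: "real \<Rightarrow> real \<Rightarrow> real \<Rightarrow> ((real^'n) \<times> real \<Rightarrow> real) \<Rightarrow> bool" where
  "pos_solution lam p k u \<longleftrightarrow>
     u \<in> borel_measurable (restrict_space lebesgue (halfspace :: ((real^'n) \<times> real) set)) \<and>
     (AE x in lebesgue. x \<in> halfspace \<longrightarrow> u x > 0) \<and>
     (AE y in lebesgue. \<exists>L. (u \<longlongrightarrow> L) (at (y, 0) within halfspace)) \<and>
     (AE y in lebesgue. Hu p k u y < \<infinity>) \<and>
     (AE x in lebesgue. x \<in> halfspace \<longrightarrow>
        (\<integral>\<^sup>+ y. Hu p k u y * ennreal (1 / norm (x - (y, 0)) powr (real CARD('n) - 1)) \<partial>lebesgue) < \<infinity>) \<and>
     (AE x in lebesgue. x \<in> halfspace \<longrightarrow>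
        ennreal (u x) =
          ennreal (2 * lam / ((real CARD('n) - 1) * sphere_area (CARD('n) + 1))) *
          (\<integral>\<^sup>+ y. \<integral>\<^sup>+ z. ennreal (btrace u z powr p /
               (norm (x - (y, 0)) powr (real CARD('n) - 1) * norm (y - z) powr k)) \<partial>lebesgue \<partial>lebesgue))"

definition in_Lp :: "real \<Rightarrow> ('a::euclidean_space \<Rightarrow> real) \<Rightarrow> bool" where
  "in_Lp q f \<longleftrightarrow> f \<in> borel_measurable lebesgue \<and>
     (\<integral>\<^sup>+ y. ennreal (\<bar>f y\<bar> powr q) \<partial>lebesgue) < \<infinity>"

definition in_Lp_loc :: "real \<Rightarrow> ('a::euclidean_space \<Rightarrow> real) \<Rightarrow> bool" where
  "in_Lp_loc q f \<longleftrightarrow> f \<in> borel_measurable lebesgue \<and>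
     (\<forall>K. compact K \<longrightarrow> (\<integral>\<^sup>+ y\<in>K. ennreal (\<bar>f y\<bar> powr q) \<partial>lebesgue) < \<infinity>)"

definition regular :: "real \<Rightarrow> ((real^'n) \<times> real \<Rightarrow> real) \<Rightarrow> bool" where
  "regular k u \<longleftrightarrow> 1 < k \<and> k < real CARD('n) \<and>
     in_Lp_loc (2 * real CARD('n) / (k - 1)) (btrace u)"

end

theory Submission
  imports Defs
begin

text \<open>The boundary trace \<open>v\<close> of a solution satisfies, with \<open>d = N - 1\<close>, the integral equation
  \<open>v = c I(v\<^sup>p)\<close>, where \<open>I\<close> is the Riesz potential with kernel \<open>|x - z|\<^sup>-\<^sup>g\<close>, \<open>g = k - 1\<close>; composing the
  two kernels in the double integral gives this exponent, and diverges when \<open>k \<le> 1\<close>.  The mass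
  \<open>m(R)\<close> of \<open>v\<^sup>p\<close> on balls of radius \<open>R\<close> satisfies \<open>m(R) \<ge> C R\<^bsup>d - p g\<^esup> m(R)\<^sup>p\<close>, which is impossible for
  \<open>p g < d\<close>; for \<open>p g = d\<close> it makes the total mass finite, against \<open>v(x) \<ge> C |x|\<^sup>-\<^sup>g\<close>.  The explicit solution is the power that the equation reproduces.

  Regular solutions are treated by moving spheres in integral form.  Only the Hardy--Littlewood--Sobolev
  inequality between dual exponents is needed.  Comparison of \<open>v\<close> with its Kelvin transforms in small
  spheres already yields a Harnack inequality, hence continuity.  Enlarging the spheres, either the
  comparison holds for all spheres, which forces \<open>v\<close> to be constant, or there is about every centre a
  sphere in which \<open>v\<close> is symmetric.  The latter requires the critical exponent, and the squared radius of
  the sphere is then a quadratic function of the centre, which makes \<open>v\<close> a bubble.\<close>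

text \<open>The obstacle is that a regular solution has only a locally integrable trace and
  satisfies its equation almost everywhere, so neither continuity nor a maximum principle is
  available at the start. An energy argument takes their place. The excess w of the Kelvin transform
  over v satisfies w \<le> c p I(W w) with a linearised weight W; testing this with W w and using
  the Hardy-Littlewood-Sobolev inequality bounds the integral of W w^2 by a small multiple of
  itself, so w vanishes once that energy is finite. Regularity enters here: inversion carries the
  energy outside a sphere into the integral of v^(p+1) inside it, and the smallness condition into
  that of v^((p-1)d/(d-g)). Both exponents are at most 2d/g = 2(N-1)/(k-1), with equality at the
  critical p. The comparison is concluded for the potential, which is defined at every point, and
  not for v itself. The number 2d - g - pg measures how far the equation is from being invariant
  under inversions: it is positive below the critical exponent, and symmetry in a sphere forces it
  to be zero.\<close>

lemma nn_integral_lborel_affine: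
  fixes f :: "'a::euclidean_space \<Rightarrow> ennreal"
  assumes [measurable]: "f \<in> borel_measurable borel" and c: "c \<noteq> 0"
  shows "(\<integral>\<^sup>+x. f x \<partial>lborel) = ennreal (\<bar>c\<bar> ^ DIM('a)) * (\<integral>\<^sup>+x. f (t + c *\<^sub>R x) \<partial>lborel)"
  by (subst lborel_affine[OF c, of t])
     (simp add: nn_integral_density nn_integral_distr nn_integral_cmult)

lemma nn_integral_lborel_translate:
  fixes f :: "'a::euclidean_space \<Rightarrow> ennreal"
  assumes "f \<in> borel_measurable borel"
  shows "(\<integral>\<^sup>+x. f (t + x) \<partial>lborel) = (\<integral>\<^sup>+x. f x \<partial>lborel)"
  using nn_integral_lborel_affine[OF assms, of 1 t] by simp

lemma nn_integral_lborel_reflect: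
  fixes f :: "'a::euclidean_space \<Rightarrow> ennreal"
  assumes "f \<in> borel_measurable borel"
  shows "(\<integral>\<^sup>+x. f (t - x) \<partial>lborel) = (\<integral>\<^sup>+x. f x \<partial>lborel)"
  using nn_integral_lborel_affine[OF assms, of "-1" t] by simp

section \<open>Integrals of powers of the norm\<close>

definition radial_power :: "real \<Rightarrow> 'a::euclidean_space set \<Rightarrow> ennreal" where
  "radial_power b W = (\<integral>\<^sup>+y. ennreal (norm y powr - b) * indicator W y \<partial>lborel)"

lemma borel_scale_image:
  fixes W :: "'a::euclidean_space set"
  assumes [measurable]: "W \<in> sets borel" and c: "c > 0"
  shows "(*\<^sub>R) c ` W \<in> sets borel"
proof -
  have "(*\<^sub>R) c ` W = (\<lambda>x. (1/c) *\<^sub>R x) -` W \<inter> space borel"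
    using c by (auto simp: image_iff intro!: bexI[of _ "(1/c) *\<^sub>R _"])
  moreover have "(\<lambda>x. (1/c) *\<^sub>R x) -` W \<inter> space borel \<in> sets borel"
    by measurable
  ultimately show ?thesis by metis
qed

text \<open>Dilation by c multiplies volume by c^d and the integrand by c^-b. This homogeneity
  replaces polar coordinates: convergence and divergence below both come from comparing a region
  with its double or its half.\<close>

lemma radial_power_scale:
  fixes W :: "'a::euclidean_space set"
  assumes [measurable]: "W \<in> sets borel" and c: "c > 0"
  shows "radial_power b ((*\<^sub>R) c ` W) = ennreal (c powr (real DIM('a) - b)) * radial_power b W"
proof -
  note [measurable] = borel_scale_image[OF assms]
  have "radial_power b ((*\<^sub>R) c ` W) = ennreal (c powr real DIM('a)) *
     (\<integral>\<^sup>+y. ennreal (norm (c *\<^sub>R y) powr - b) * indicator ((*\<^sub>R) c ` W) (c *\<^sub>R y) \<partial>lborel)"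
    unfolding radial_power_def using c
    by (subst nn_integral_lborel_affine[where c=c and t=0]) (auto simp: powr_realpow)
  also have "(\<lambda>y. ennreal (norm (c *\<^sub>R y) powr - b) * indicator ((*\<^sub>R) c ` W) (c *\<^sub>R y)) =
     (\<lambda>y. ennreal (c powr - b) * (ennreal (norm y powr - b) * indicator W y))"
    using c by (auto simp: fun_eq_iff powr_mult ennreal_mult' indicator_def)
  also have "(\<integral>\<^sup>+y. ennreal (c powr - b) * (ennreal (norm y powr - b) * indicator W y) \<partial>lborel) =
      ennreal (c powr - b) * radial_power b W"
    unfolding radial_power_def by (rule nn_integral_cmult) simp
  finally show ?thesis
    by (simp add: mult.assoc[symmetric] ennreal_mult'[symmetric] powr_add[symmetric] powr_diff)
qed

lemma radial_power_Un:
  fixes V W :: "'a::euclidean_space set"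
  assumes [measurable]: "V \<in> sets borel" "W \<in> sets borel" and "V \<inter> W = {}"
  shows "radial_power b (V \<union> W) = radial_power b V + radial_power b W"
  unfolding radial_power_def using assms(3)
  by (subst nn_integral_add[symmetric]) (auto intro!: nn_integral_cong simp: indicator_def)

lemma radial_power_mono:
  "V \<subseteq> W \<Longrightarrow> radial_power b V \<le> radial_power b W"
  unfolding radial_power_def by (intro nn_integral_mono) (auto simp: indicator_def)

lemma radial_power_finite:
  fixes W :: "'a::euclidean_space set"
  assumes "W \<in> sets borel" "bounded W" "r > 0" "\<And>y. y \<in> W \<Longrightarrow> r \<le> norm y"
  shows "radial_power b W < \<infinity>"
proof -
  obtain R where R: "\<And>y. y \<in> W \<Longrightarrow> norm y \<le> R" using assms(2) by (auto simp: bounded_iff)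
  define M where "M = r powr - b + R powr - b"
  have "norm y powr - b \<le> M" if "y \<in> W" for y
  proof (cases "b \<ge> 0")
    case True
    then have "norm y powr - b \<le> r powr - b"
      using assms(3) assms(4)[OF that] by (intro powr_mono2') auto
    then show ?thesis by (simp add: M_def add_increasing2)
  next
    case False
    then have "norm y powr - b \<le> R powr - b"
      using assms(3) assms(4)[OF that] R[OF that] by (intro powr_mono2) auto
    then show ?thesis by (simp add: M_def add_increasing)
  qed
  then have "radial_power b W \<le> (\<integral>\<^sup>+y. ennreal M * indicator W y \<partial>lborel)"
    unfolding radial_power_def by (intro nn_integral_mono) (auto simp: indicator_def ennreal_leI)
  also have "\<dots> = ennreal M * emeasure lborel W"
    using assms(1) by (simp add: nn_integral_cmult_indicator)
  also have "\<dots> < \<infinity>"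
    using emeasure_bounded_finite[OF assms(2)] by (auto simp: ennreal_mult_less_top)
  finally show ?thesis .
qed

lemma radial_power_pos:
  fixes W :: "'a::euclidean_space set"
  assumes "open W" "W \<noteq> {}" "0 \<notin> W" "W \<subseteq> V"
  shows "0 < radial_power b V"
proof -
  have "0 < emeasure lborel W"
    using assms emeasure_lborel_countable[of W] 
    by (metis open_not_negligible negligible_iff_null_sets null_sets_completionI
        null_setsI borel_open sets_lborel zero_less_iff_neq_zero)
  have W[measurable]: "W \<in> sets borel" using assms by auto
  have "radial_power b W \<noteq> 0"
  proof
    assume "radial_power b W = 0"
    then have "AE y in lborel. ennreal (norm y powr - b) * indicator W y = 0"
      unfolding radial_power_def by (subst (asm) nn_integral_0_iff_AE) auto
    then have "AE y in lborel. y \<notin> W"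
      by eventually_elim (use assms in \<open>auto simp: indicator_def split: if_splits\<close>)
    then have "emeasure lborel W = 0"
      by (subst (asm) AE_iff_measurable[of W]) auto
    with \<open>0 < emeasure lborel W\<close> show False by simp
  qed
  then show ?thesis using radial_power_mono[OF assms(4), of b]
    by (metis le_zero_eq zero_less_iff_neq_zero)
qed

lemma scale_norm_set:
  fixes c :: real
  assumes "c > 0"
  shows "(*\<^sub>R) c ` {y::'a::euclidean_space. P (norm y)} = {y. P (norm y / c)}"
proof -
  have "y \<in> (*\<^sub>R) c ` {y. P (norm y)}" if "P (norm y / c)" for y :: 'a
    using assms that by (auto intro!: image_eqI[of _ _ "(1/c) *\<^sub>R y"])
  then show ?thesis using assms by auto
qed

lemma ex_norm_between:
  assumes "0 \<le> a" "a < b"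
  shows "\<exists>y::'a::euclidean_space. a < norm y \<and> norm y < b"
proof -
  obtain e :: 'a where e: "e \<in> Basis" using nonempty_Basis by blast
  then show ?thesis using assms by (intro exI[of _ "((a+b)/2) *\<^sub>R e"]) auto
qed

lemma radial_power_shell_pos:
  assumes "0 \<le> a" "a < b"
  shows "0 < radial_power s {y::'a::euclidean_space. a \<le> norm y \<and> norm y < b}"
proof (rule radial_power_pos)
  show "open {y::'a. a < norm y \<and> norm y < b}"
    by (intro open_Collect_conj open_Collect_less continuous_intros)
qed (use ex_norm_between[OF assms, where 'a='a] assms in auto)

text \<open>The shell up to radius 2^(n+1) R is covered by the first shell and the double of the
  shell up to 2^n R, so the integrals satisfy a(n+1) \<le> f + q a(n) with q = 2^(d-b) < 1. The
  fixed point f/(1-q) bounds them all, and monotone convergence finishes.\<close>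

lemma radial_power_outside:
  assumes b: "b > real DIM('a)" and R: "R > 0"
  shows "radial_power b {y::'a::euclidean_space. R \<le> norm y} < \<infinity>"
proof -
  define S where "S n = {y::'a. R \<le> norm y \<and> norm y < 2^n * R}" for n
  have [measurable]: "S n \<in> sets borel" for n unfolding S_def by measurable
  define q where "q = 2 powr (real DIM('a) - b)"
  have q: "0 < q" "q < 1" unfolding q_def using b powr_less_mono[of "real DIM('a) - b" 0 2] by auto
  have "radial_power b (S 1) < \<infinity>"
    using R by (intro radial_power_finite[where r=R]) (auto simp: S_def intro!: bounded_subset[OF bounded_ball[of 0 "2*R"]])
  then obtain f where f: "f \<ge> 0" "radial_power b (S 1) = ennreal f"
    by (cases "radial_power b (S 1)") auto
  have step: "radial_power b (S (Suc n)) \<le> ennreal f + ennreal q * radial_power b (S n)" for n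
  proof -
    have "S (Suc n) \<subseteq> S 1 \<union> (*\<^sub>R) 2 ` S n"
      unfolding S_def by (subst scale_norm_set) (auto simp: field_simps)
    then have "radial_power b (S (Suc n)) \<le> radial_power b (S 1 \<union> (*\<^sub>R) 2 ` S n)"
      by (rule radial_power_mono)
    also have "\<dots> = radial_power b (S 1) + radial_power b ((*\<^sub>R) 2 ` S n)"
    proof (intro radial_power_Un borel_scale_image)
      show "S 1 \<inter> (*\<^sub>R) 2 ` S n = {}"
        unfolding S_def by (subst scale_norm_set) (auto simp: field_simps)
    qed simp_all
    finally show ?thesis by (simp add: radial_power_scale f(2)[symmetric] q_def)
  qed
  have bound: "radial_power b (S n) \<le> ennreal (f / (1 - q))" for n
  proof (induction n)
    case 0
    have "S 0 = {}" by (auto simp: S_def)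
    then show ?case by (simp add: radial_power_def)
  next
    case (Suc n)
    have "radial_power b (S (Suc n)) \<le> ennreal f + ennreal q * ennreal (f / (1 - q))"
      by (rule order_trans[OF step]) (intro add_left_mono mult_left_mono Suc, auto)
    also have "\<dots> = ennreal (f / (1 - q))"
      using q f by (simp add: ennreal_mult[symmetric] ennreal_plus[symmetric] field_simps del: ennreal_plus)
    finally show ?case .
  qed
  have "radial_power b {y::'a. R \<le> norm y} = (\<integral>\<^sup>+y. (SUP n. ennreal (norm y powr - b) * indicator (S n) y) \<partial>lborel)"
    unfolding radial_power_def
  proof (intro nn_integral_cong)
    fix y :: 'a
    obtain n where n: "norm y / R < 2 ^ n" using real_arch_pow[of 2 "norm y / R"] by auto
    show "ennreal (norm y powr - b) * indicator {y. R \<le> norm y} y = (SUP n. ennreal (norm y powr - b) * indicator (S n) y)"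
    proof (rule antisym)
      show "ennreal (norm y powr - b) * indicator {y. R \<le> norm y} y \<le> (SUP n. ennreal (norm y powr - b) * indicator (S n) y)"
        by (rule SUP_upper2[of n]) (use n R in \<open>auto simp: indicator_def S_def field_simps\<close>)
      show "(SUP n. ennreal (norm y powr - b) * indicator (S n) y) \<le> ennreal (norm y powr - b) * indicator {y. R \<le> norm y} y"
        by (rule SUP_least) (auto simp: indicator_def S_def)
    qed
  qed
  also have "\<dots> = (SUP n. radial_power b (S n))"
    unfolding radial_power_def
  proof (rule nn_integral_monotone_convergence_SUP)
    show "incseq (\<lambda>n y. ennreal (norm y powr - b) * indicator (S n) y)"
    proof (rule incseq_SucI, rule le_funI)
      fix n and y :: 'a
      have "2^n * R \<le> 2^Suc n * R" using R by simp
      then have "S n \<subseteq> S (Suc n)" by (auto simp: S_def)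
      then show "ennreal (norm y powr - b) * indicator (S n) y \<le> ennreal (norm y powr - b) * indicator (S (Suc n)) y"
        by (auto simp: indicator_def)
    qed
  qed simp
  also have "\<dots> \<le> ennreal (f / (1 - q))" by (rule SUP_least) (rule bound)
  also have "\<dots> < \<infinity>" by simp
  finally show ?thesis .
qed

lemma radial_power_inside:
  assumes b: "b < real DIM('a)" and R: "R > 0"
  shows "radial_power b {y::'a::euclidean_space. norm y < R} < \<infinity>"
proof -
  define S where "S n = {y::'a. R / 2^n \<le> norm y \<and> norm y < R}" for n
  have [measurable]: "S n \<in> sets borel" for n unfolding S_def by measurable
  define q where "q = (1/2) powr (real DIM('a) - b)"
  have q: "0 < q" "q < 1" unfolding q_def using b by (auto simp: powr_divide)
  have "radial_power b (S 1) < \<infinity>"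
    using R by (intro radial_power_finite[where r="R/2"]) (auto simp: S_def intro!: bounded_subset[OF bounded_ball[of 0 "R"]])
  then obtain f where f: "f \<ge> 0" "radial_power b (S 1) = ennreal f"
    by (cases "radial_power b (S 1)") auto
  have step: "radial_power b (S (Suc n)) \<le> ennreal f + ennreal q * radial_power b (S n)" for n
  proof -
    have "S (Suc n) \<subseteq> S 1 \<union> (*\<^sub>R) (1/2) ` S n"
      unfolding S_def by (subst scale_norm_set) (auto simp: field_simps)
    then have "radial_power b (S (Suc n)) \<le> radial_power b (S 1 \<union> (*\<^sub>R) (1/2) ` S n)"
      by (rule radial_power_mono)
    also have "\<dots> = radial_power b (S 1) + radial_power b ((*\<^sub>R) (1/2) ` S n)"
    proof (intro radial_power_Un borel_scale_image)
      show "S 1 \<inter> (*\<^sub>R) (1/2) ` S n = {}"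
        unfolding S_def by (subst scale_norm_set) (auto simp: field_simps)
    qed simp_all
    finally show ?thesis by (simp add: radial_power_scale f(2)[symmetric] q_def)
  qed
  have bound: "radial_power b (S n) \<le> ennreal (f / (1 - q))" for n
  proof (induction n)
    case 0
    have "S 0 = {}" by (auto simp: S_def)
    then show ?case by (simp add: radial_power_def)
  next
    case (Suc n)
    have "radial_power b (S (Suc n)) \<le> ennreal f + ennreal q * ennreal (f / (1 - q))"
      by (rule order_trans[OF step]) (intro add_left_mono mult_left_mono Suc, auto)
    also have "\<dots> = ennreal (f / (1 - q))"
      using q f by (simp add: ennreal_mult[symmetric] ennreal_plus[symmetric] field_simps del: ennreal_plus)
    finally show ?case .
  qed
  have "radial_power b {y::'a. norm y < R} = (\<integral>\<^sup>+y. (SUP n. ennreal (norm y powr - b) * indicator (S n) y) \<partial>lborel)"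
    unfolding radial_power_def
  proof (intro nn_integral_cong)
    fix y :: 'a
    show "ennreal (norm y powr - b) * indicator {y. norm y < R} y = (SUP n. ennreal (norm y powr - b) * indicator (S n) y)"
    proof (rule antisym)
      show "ennreal (norm y powr - b) * indicator {y. norm y < R} y \<le> (SUP n. ennreal (norm y powr - b) * indicator (S n) y)"
      \<comment> \<open>The shells never reach the origin, but the integrand is 0 there because
        \<open>0 powr _ = 0\<close>.\<close>
      proof (cases "y = 0")
        case False
        obtain n where n: "R / norm y < 2 ^ n" using real_arch_pow[of 2 "R / norm y"] by auto
        show ?thesis
          by (rule SUP_upper2[of n]) (use n R False in \<open>auto simp: indicator_def S_def field_simps\<close>)
      qed simp
      show "(SUP n. ennreal (norm y powr - b) * indicator (S n) y) \<le> ennreal (norm y powr - b) * indicator {y. norm y < R} y"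
        by (rule SUP_least) (auto simp: indicator_def S_def)
    qed
  qed
  also have "\<dots> = (SUP n. radial_power b (S n))"
    unfolding radial_power_def
  proof (rule nn_integral_monotone_convergence_SUP)
    show "incseq (\<lambda>n y. ennreal (norm y powr - b) * indicator (S n) y)"
    proof (rule incseq_SucI, rule le_funI)
      fix n and y :: 'a
      have "R / 2^Suc n \<le> R / 2^n" using R by (simp add: field_simps)
      then have "S n \<subseteq> S (Suc n)" by (auto simp: S_def)
      then show "ennreal (norm y powr - b) * indicator (S n) y \<le> ennreal (norm y powr - b) * indicator (S (Suc n)) y"
        by (auto simp: indicator_def)
    qed
  qed simp
  also have "\<dots> \<le> ennreal (f / (1 - q))" by (rule SUP_least) (rule bound)
  also have "\<dots> < \<infinity>" by simp
  finally show ?thesis .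
qed

lemma ennreal_infinite_if_gain:
  fixes I F :: ennreal
  assumes "F + I \<le> I" "0 < F"
  shows "I = \<infinity>"
  using assms by (metis ennreal_add_left_cancel_le ennreal_add_less_top infinity_ennreal_def
      add.commute add_0 leD less_le not_less top.not_eq_extremum)

text \<open>The exterior region is a shell together with its own double, and doubling multiplies the
  integral by 2^(d-b) \<ge> 1. The integral therefore does not change when the positive amount of
  the shell is added, which only infinity allows.\<close>

lemma radial_power_outside_infinite:
  assumes b: "b \<le> real DIM('a)" and R: "R > 0"
  shows "radial_power b {y::'a::euclidean_space. R \<le> norm y} = \<infinity>"
proof -
  let ?W = "{y::'a. R \<le> norm y}" and ?D = "{y::'a. R \<le> norm y \<and> norm y < 2 * R}"
  have mW: "?W \<in> sets borel" and mD: "?D \<in> sets borel" by measurable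
  have W: "?W = ?D \<union> (*\<^sub>R) 2 ` ?W" by (subst scale_norm_set) (use R in auto)
  have U: "radial_power b (?D \<union> (*\<^sub>R) 2 ` ?W) = radial_power b ?D + radial_power b ((*\<^sub>R) 2 ` ?W)"
  proof (intro radial_power_Un borel_scale_image)
    show "?D \<inter> (*\<^sub>R) 2 ` ?W = {}" by (subst scale_norm_set) (use R in auto)
  qed (use mW mD in auto)
  have sc: "radial_power b ((*\<^sub>R) 2 ` ?W) = ennreal (2 powr (real DIM('a) - b)) * radial_power b ?W"
    by (rule radial_power_scale[OF mW]) simp
  have E: "radial_power b ?W = radial_power b ?D + ennreal (2 powr (real DIM('a) - b)) * radial_power b ?W"
    by (subst W, subst U, subst sc) (rule refl)
  have "1 \<le> 2 powr (real DIM('a) - b)"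
    using b by (intro ge_one_powr_ge_zero) auto
  then have q: "1 * radial_power b ?W \<le> ennreal (2 powr (real DIM('a) - b)) * radial_power b ?W"
    by (intro mult_right_mono) (auto simp: ennreal_le_iff simp flip: ennreal_1)
  have "radial_power b ?D + radial_power b ?W \<le> radial_power b ?W"
    by (rule ord_le_eq_trans[OF _ E[symmetric]]) (use add_left_mono[OF q] in \<open>simp only: mult_1\<close>)
  then show ?thesis
    by (rule ennreal_infinite_if_gain[OF _ radial_power_shell_pos]) (use R in auto)
qed

lemma radial_power_inside_infinite:
  assumes b: "b \<ge> real DIM('a)" and R: "R > 0"
  shows "radial_power b {y::'a::euclidean_space. norm y < R} = \<infinity>"
proof -
  let ?W = "{y::'a. norm y < R}" and ?D = "{y::'a. R / 2 \<le> norm y \<and> norm y < R}"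
  have mW: "?W \<in> sets borel" and mD: "?D \<in> sets borel" by measurable
  have W: "?W = ?D \<union> (*\<^sub>R) (1/2) ` ?W" by (subst scale_norm_set) (use R in auto)
  have U: "radial_power b (?D \<union> (*\<^sub>R) (1/2) ` ?W) = radial_power b ?D + radial_power b ((*\<^sub>R) (1/2) ` ?W)"
  proof (intro radial_power_Un borel_scale_image)
    show "?D \<inter> (*\<^sub>R) (1/2) ` ?W = {}" by (subst scale_norm_set) (use R in auto)
  qed (use mW mD in auto)
  have sc: "radial_power b ((*\<^sub>R) (1/2) ` ?W) = ennreal ((1/2) powr (real DIM('a) - b)) * radial_power b ?W"
    by (rule radial_power_scale[OF mW]) simp
  have E: "radial_power b ?W = radial_power b ?D + ennreal ((1/2) powr (real DIM('a) - b)) * radial_power b ?W"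
    by (subst W, subst U, subst sc) (rule refl)
  have "1 \<le> (1/2) powr (real DIM('a) - b)"
    using b powr_mono'[of "real DIM('a) - b" 0 "1/2::real"] by simp
  then have q: "1 * radial_power b ?W \<le> ennreal ((1/2) powr (real DIM('a) - b)) * radial_power b ?W"
    by (intro mult_right_mono) (auto simp: ennreal_le_iff simp flip: ennreal_1)
  have "radial_power b ?D + radial_power b ?W \<le> radial_power b ?W"
    by (rule ord_le_eq_trans[OF _ E[symmetric]]) (use add_left_mono[OF q] in \<open>simp only: mult_1\<close>)
  then show ?thesis
    by (rule ennreal_infinite_if_gain[OF _ radial_power_shell_pos]) (use R in auto)
qed

section \<open>Change of variables: inversions and orthogonal maps\<close>

text \<open>The change of variables theorem of the library needs a well-ordered index type; every finite
  index type is in bijection with such a copy.\<close>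

typedef (overloaded) ('n::finite) enumerated = "{..<CARD('n)}"
  by (auto intro!: exI[of _ 0])

instantiation enumerated :: (finite) wellorder
begin

definition less_enumerated :: "'a enumerated \<Rightarrow> 'a enumerated \<Rightarrow> bool" where
  "x < y \<longleftrightarrow> Rep_enumerated x < Rep_enumerated y"

definition less_eq_enumerated :: "'a enumerated \<Rightarrow> 'a enumerated \<Rightarrow> bool" where
  "x \<le> y \<longleftrightarrow> Rep_enumerated x \<le> Rep_enumerated y"

instance
proof
  fix x y z :: "'a enumerated"
  show "x < y \<longleftrightarrow> x \<le> y \<and> \<not> y \<le> x" "x \<le> x" "x \<le> y \<or> y \<le> x"
    unfolding less_enumerated_def less_eq_enumerated_def by (rule less_le_not_le order_refl linear)+
  show "x \<le> y \<Longrightarrow> y \<le> z \<Longrightarrow> x \<le> z"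
    unfolding less_eq_enumerated_def by (rule order_trans)
  show "x \<le> y \<Longrightarrow> y \<le> x \<Longrightarrow> x = y"
    unfolding less_eq_enumerated_def by (metis Rep_enumerated_inject order_antisym)
next
  fix P :: "'a enumerated \<Rightarrow> bool" and a :: "'a enumerated"
  assume step: "\<And>x. (\<And>y. y < x \<Longrightarrow> P y) \<Longrightarrow> P x"
  show "P a"
  proof (induction "Rep_enumerated a" arbitrary: a rule: less_induct)
    case less
    show ?case by (rule step, rule less) (simp only: less_enumerated_def)
  qed
qed

end

instance enumerated :: (finite) finite
proof
  have "(UNIV :: 'a enumerated set) = Abs_enumerated ` {..<CARD('a)}"
    by (metis type_definition.Abs_image type_definition_enumerated)
  then show "finite (UNIV :: 'a enumerated set)" by (metis finite_imageI finite_lessThan)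
qed

lemma CARD_enumerated: "CARD('n::finite enumerated) = CARD('n)"
  using type_definition.card[OF type_definition_enumerated[where 'n='n]] by simp

lemma ex_reindex: "\<exists>\<pi> :: 'n::finite enumerated \<Rightarrow> 'n. bij \<pi>"
  by (rule finite_same_card_bij) (simp_all add: CARD_enumerated)

definition reindex :: "('m \<Rightarrow> 'n) \<Rightarrow> real^'n \<Rightarrow> real^'m" where
  "reindex \<pi> x = (\<chi> i. x $ \<pi> i)"

lemma linear_reindex: "linear (reindex \<pi>)"
  by (rule linearI) (auto simp: reindex_def vec_eq_iff)

lemma norm_reindex: 
  fixes \<pi> :: "'m::finite \<Rightarrow> 'n::finite"
  assumes "bij \<pi>" shows "norm (reindex \<pi> x) = norm x"
proof -
  have "(\<Sum>i\<in>UNIV. (norm (x $ \<pi> i))\<^sup>2) = (\<Sum>i\<in>UNIV. (norm (x $ i))\<^sup>2)"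
    using assms by (rule sum.reindex_bij_betw)
  then show ?thesis by (simp add: reindex_def norm_vec_def L2_set_def)
qed

lemma borel_measurable_reindex [measurable]:
  "reindex (\<pi> :: 'm::finite \<Rightarrow> 'n::finite) \<in> borel_measurable borel"
  by (intro borel_measurable_continuous_onI linear_continuous_on linear_linear[THEN iffD2] linear_reindex)

text \<open>A bijection of the index sets carries boxes to boxes and only permutes the factors of
  their volume; Lebesgue measure is determined by its values on boxes.\<close>

lemma distr_reindex:
  fixes \<pi> :: "'m::finite \<Rightarrow> 'n::finite"
  assumes "bij \<pi>"
  shows "distr lborel borel (reindex \<pi>) = lborel"
proof (rule lborel_eqI[symmetric])
  fix l u :: "real^'m" assume le: "\<And>b. b \<in> Basis \<Longrightarrow> l \<bullet> b \<le> u \<bullet> b"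
  have le': "l $ i \<le> u $ i" for i using le[of "axis i 1"] by (simp add: inner_axis)
  define q where "q = inv \<pi>"
  have q: "bij q" "\<And>i. \<pi> (q i) = i" "\<And>i. q (\<pi> i) = i"
    using assms unfolding q_def by (auto simp: bij_imp_bij_inv bij_is_surj surj_f_inv_f bij_is_inj)
  have prod_vec: "(\<Prod>b\<in>Basis. x \<bullet> b) = (\<Prod>i\<in>UNIV. x $ i)" for x :: "real^'k::finite"
  proof -
    have "Basis = range (\<lambda>i. axis i (1::real) :: real^'k)" by (auto simp: Basis_vec_def)
    then have "(\<Prod>b\<in>Basis. x \<bullet> b) = (\<Prod>b\<in>range (\<lambda>i. axis i 1). x \<bullet> b)" by (simp only:)
    also have "\<dots> = (\<Prod>i\<in>UNIV. x $ i)"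
      by (subst prod.reindex) (auto simp: inj_on_def axis_eq_axis inner_axis)
    finally show ?thesis .
  qed
  have vim: "reindex \<pi> -` box l u = box (reindex q l) (reindex q u)"
  proof -
    have "(\<forall>i. l $ i < x $ \<pi> i \<and> x $ \<pi> i < u $ i) \<longleftrightarrow> (\<forall>i. l $ q i < x $ i \<and> x $ i < u $ q i)" for x :: "real^'n"
      using q(2,3) by metis
    then show ?thesis by (auto simp: box_def Basis_vec_def inner_axis reindex_def)
  qed
  have "emeasure (distr lborel borel (reindex \<pi>)) (box l u) = emeasure lborel (box (reindex q l) (reindex q u))"
    by (subst emeasure_distr) (simp_all add: vim)
  also have "\<dots> = ennreal (\<Prod>b\<in>Basis. (reindex q u - reindex q l) \<bullet> b)"
    using le' by (subst emeasure_lborel_box) (auto simp: Basis_vec_def inner_axis reindex_def)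
  also have "(\<Prod>b\<in>Basis. (reindex q u - reindex q l) \<bullet> b) = (\<Prod>i\<in>UNIV. (u - l) $ q i)"
    unfolding prod_vec by (simp add: reindex_def)
  also have "\<dots> = (\<Prod>i\<in>UNIV. (u - l) $ i)"
    using q(1) by (rule prod.reindex_bij_betw)
  also have "\<dots> = (\<Prod>b\<in>Basis. (u - l) \<bullet> b)" by (simp add: prod_vec)
  finally show "emeasure (distr lborel borel (reindex \<pi>)) (box l u) = (\<Prod>b\<in>Basis. (u - l) \<bullet> b)" .
qed simp

text \<open>Fixes the origin, since division by zero is zero.\<close>

definition inversion :: "real \<Rightarrow> 'a::real_normed_vector \<Rightarrow> 'a" where
  "inversion l z = (l\<^sup>2 / (norm z)\<^sup>2) *\<^sub>R z"

lemma inversion_reindex: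
  assumes "bij (\<pi> :: 'm::finite \<Rightarrow> 'n::finite)"
  shows "inversion l (reindex \<pi> x) = reindex \<pi> (inversion l x)"
  using norm_reindex[OF assms, of x] by (simp add: inversion_def linear_cmul[OF linear_reindex])

lemma norm_inversion: "norm (inversion l z) = l\<^sup>2 / norm z"
  by (cases "z = 0") (auto simp: inversion_def power2_eq_square field_simps)

lemma inversion_inversion [simp]: "l \<noteq> 0 \<Longrightarrow> inversion l (inversion l z) = z"
  by (cases "z = 0") (auto simp: inversion_def power2_eq_square field_simps)

lemma inversion_eq_0 [simp]: "l \<noteq> 0 \<Longrightarrow> inversion l z = 0 \<longleftrightarrow> z = 0"
  by (auto simp: inversion_def)

lemma borel_measurable_inversion [measurable]:
  "(inversion l :: 'a::euclidean_space \<Rightarrow> 'a) \<in> borel_measurable borel"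
  unfolding inversion_def by measurable

text \<open>In this form the derivative is visibly the factor (l/|z|)^2 times the reflection in the
  hyperplane orthogonal to z, so the modulus of its determinant can be read off.\<close>

lemma inversion_has_derivative:
  fixes z :: "'a::real_inner"
  assumes "z \<noteq> 0"
  shows "(inversion l has_derivative
     (\<lambda>h. (l\<^sup>2 / (norm z)\<^sup>2) *\<^sub>R (h - (2 * (z \<bullet> h) / (norm z)\<^sup>2) *\<^sub>R z))) (at z within S)"
proof -
  have "((\<lambda>z. (l\<^sup>2 / (z \<bullet> z)) *\<^sub>R z) has_derivative
     (\<lambda>h. (l\<^sup>2 / (z \<bullet> z)) *\<^sub>R h + (- l\<^sup>2 * (z \<bullet> h + h \<bullet> z) / (z \<bullet> z)\<^sup>2) *\<^sub>R z)) (at z within S)"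
    using assms by (auto intro!: derivative_eq_intros simp: power2_eq_square field_simps)
  moreover have "(\<lambda>h. (l\<^sup>2 / (z \<bullet> z)) *\<^sub>R h + (- l\<^sup>2 * (z \<bullet> h + h \<bullet> z) / (z \<bullet> z)\<^sup>2) *\<^sub>R z) =
    (\<lambda>h. (l\<^sup>2 / (norm z)\<^sup>2) *\<^sub>R (h - (2 * (z \<bullet> h) / (norm z)\<^sup>2) *\<^sub>R z))"
    using assms unfolding power2_norm_eq_inner
    by (auto simp: fun_eq_iff algebra_simps inner_commute power2_eq_square)
  ultimately show ?thesis
    by (simp add: inversion_def[abs_def] power2_norm_eq_inner)
qed

lemma orthogonal_transformation_householder:
  fixes z :: "'a::euclidean_space"
  assumes "z \<noteq> 0"
  shows "orthogonal_transformation (\<lambda>h. h - (2 * (z \<bullet> h) / (norm z)\<^sup>2) *\<^sub>R z)"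
  unfolding orthogonal_transformation_def
proof (intro conjI allI)
  show "linear (\<lambda>h. h - (2 * (z \<bullet> h) / (norm z)\<^sup>2) *\<^sub>R z)"
    by (rule linearI) (auto simp: algebra_simps inner_add_right add_divide_distrib)
  fix v w
  have "z \<bullet> z \<noteq> 0" using assms by simp
  then show "(v - (2 * (z \<bullet> v) / (norm z)\<^sup>2) *\<^sub>R z) \<bullet> (w - (2 * (z \<bullet> w) / (norm z)\<^sup>2) *\<^sub>R z) = v \<bullet> w"
    by (simp add: power2_norm_eq_inner inner_diff_left inner_diff_right inner_commute field_simps)
qed

lemma abs_det_inversion_derivative:
  fixes z :: "real^'n"
  assumes "z \<noteq> 0"
  shows "\<bar>det (matrix (\<lambda>h. (l\<^sup>2 / (norm z)\<^sup>2) *\<^sub>R (h - (2 * (z \<bullet> h) / (norm z)\<^sup>2) *\<^sub>R z)))\<bar> =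
     (\<bar>l\<bar> / norm z) ^ (2 * CARD('n))"
proof -
  let ?R = "\<lambda>h. h - (2 * (z \<bullet> h) / (norm z)\<^sup>2) *\<^sub>R z" and ?c = "l\<^sup>2 / (norm z)\<^sup>2"
  have R: "orthogonal_transformation ?R" by (rule orthogonal_transformation_householder[OF assms])
  have "matrix ((*\<^sub>R) ?c \<circ> ?R) = matrix ((*\<^sub>R) ?c) ** matrix ?R"
    by (rule matrix_compose) (auto intro: orthogonal_transformation_linear[OF R] linear_scaleR)
  then have "det (matrix (\<lambda>h. ?c *\<^sub>R ?R h)) = ?c ^ CARD('n) * det (matrix ?R)"
    by (simp add: o_def det_mul)
  moreover have "\<bar>det (matrix ?R)\<bar> = 1"
    by (rule orthogonal_transformation_det[OF orthogonal_transformation_householder[OF assms]])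
  ultimately show ?thesis
    by (simp add: abs_mult power_mult power_divide power_abs)
qed


text \<open>Formulated with an explicit inverse \<open>U\<close> and with all regularity only off
  the origin, which is what an inversion offers. It suffices that Lebesgue measure is the image
  under \<open>T\<close> of the measure with density \<open>J\<close>; this is checked on subsets of
  the unit-width shells \<open>C i\<close>, and the shells are then added up. The origin is null for
  both measures.\<close>

lemma nn_integral_change_of_variables_enumerated:
  fixes T U :: "real^'m::{finite,wellorder} \<Rightarrow> real^'m::_"
  assumes [measurable]: "T \<in> borel_measurable borel" "U \<in> borel_measurable borel"
      "J \<in> borel_measurable borel" "f \<in> borel_measurable borel"
    and der: "\<And>z. z \<noteq> 0 \<Longrightarrow> (T has_derivative T' z) (at z)"
    and J: "\<And>z. z \<noteq> 0 \<Longrightarrow> \<bar>det (matrix (T' z))\<bar> = J z"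
    and 0: "\<And>z. z \<noteq> 0 \<Longrightarrow> T z \<noteq> 0" "\<And>z. z \<noteq> 0 \<Longrightarrow> U z \<noteq> 0"
    and TU: "\<And>z. T (U z) = z" "\<And>z. U (T z) = z"
  shows "(\<integral>\<^sup>+z. f (T z) * ennreal (J z) \<partial>lborel) = (\<integral>\<^sup>+z. f z \<partial>lborel)"
proof -
  let ?M = "distr (density lborel (\<lambda>z. ennreal (J z))) borel T"
  define C where "C i = {z::real^'m::_. z \<noteq> 0 \<and> real i \<le> norm z \<and> norm z < real i + 1}" for i :: nat
  have [measurable]: "C i \<in> sets borel" for i unfolding C_def by measurable
  have C_disj: "disjoint_family C"
    unfolding disjoint_family_on_def C_def by (auto simp: nat_neq_iff) (linarith+)?
  have C_Un: "(\<Union>i. C i) = - {0}"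
  proof -
    have "\<exists>i::nat. real i \<le> norm z \<and> norm z < real i + 1" for z :: "real^'m::_"
      by (intro exI[of _ "nat \<lfloor>norm z\<rfloor>"]) auto
    then show ?thesis by (auto simp: C_def)
  qed
  have piece: "emeasure lborel B = emeasure ?M B" if B[measurable]: "B \<in> sets borel" and BC: "B \<subseteq> C i" for B i
  proof -
    define S where "S = U ` B"
    have S: "S = T -` B \<inter> space borel" using TU by (auto simp: S_def image_iff) metis
    have [measurable]: "S \<in> sets borel" unfolding S by measurable
    have TS: "T ` S = B" using TU by (auto simp: S_def image_iff)
    have nz: "z \<noteq> 0" if "z \<in> S" for z using that BC 0 by (auto simp: S_def C_def)
    have "bounded B" by (rule bounded_subset[OF _ BC[unfolded C_def]]) (auto intro!: bounded_subset[OF bounded_ball[of 0 "real i + 1"]])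
    then have lm: "B \<in> lmeasurable" by (rule bounded_set_imp_lmeasurable) simp
    have S_leb: "S \<in> sets lebesgue" by simp
    have dS: "\<And>x. x \<in> S \<Longrightarrow> (T has_derivative T' x) (at x within S)"
      using der nz has_derivative_at_withinI by blast
    have inj: "inj_on T S" using TU by (metis inj_onI)
    have int: "(\<lambda>x. \<bar>det (matrix (T' x))\<bar>) integrable_on S"
      using measurable_differentiable_image_eq[OF S_leb dS inj] lm TS by simp
    have "emeasure lborel B = emeasure lebesgue B" by simp
    also have "\<dots> = ennreal (measure lebesgue (T ` S))"
      using lm TS by (simp add: emeasure_eq_measure2)
    also have "measure lebesgue (T ` S) = integral S (\<lambda>x. \<bar>det (matrix (T' x))\<bar>)"
      by (rule measure_differentiable_image_eq[OF S_leb dS inj int])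
    also have "ennreal \<dots> = (\<integral>\<^sup>+x. ennreal \<bar>det (matrix (T' x))\<bar> * indicator S x \<partial>lborel)"
      by (rule nn_integral_has_integral_lebesgue'[symmetric]) (use int in \<open>auto intro: integrable_integral\<close>)
    also have "\<dots> = (\<integral>\<^sup>+x. ennreal (J x) * indicator S x \<partial>lborel)"
      by (intro nn_integral_cong) (use J nz in \<open>auto simp: indicator_def\<close>)
    also have "\<dots> = emeasure (density lborel (\<lambda>z. ennreal (J z))) S"
      by (rule emeasure_density[symmetric]) simp_all
    also have "\<dots> = emeasure ?M B"
      by (subst emeasure_distr) (simp_all add: S)
    finally show ?thesis .
  qed
  have "lborel = ?M"
  proof (rule measure_eqI)
    fix A :: "(real^'m::_) set" assume "A \<in> sets lborel"
    then have [measurable]: "A \<in> sets borel" by simp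
    have dj: "disjoint_family (\<lambda>i. A \<inter> C i)"
      using C_disj by (auto simp: disjoint_family_on_def)
    have "emeasure lborel (A - {0}) = emeasure ?M (A - {0})"
    proof -
      have un: "(\<Union>i. A \<inter> C i) = A - {0}" using C_Un by auto
      have "emeasure lborel (A - {0}) = (\<Sum>i. emeasure lborel (A \<inter> C i))"
        unfolding un[symmetric] by (rule suminf_emeasure[symmetric]) (use dj in auto)
      also have "\<dots> = (\<Sum>i. emeasure ?M (A \<inter> C i))"
        by (intro suminf_cong piece) auto
      also have "\<dots> = emeasure ?M (A - {0})"
        unfolding un[symmetric] by (rule suminf_emeasure) (use dj in auto)
      finally show ?thesis .
    qed
    moreover have "emeasure lborel (A - {0}) = emeasure lborel A"
      by (rule emeasure_Diff_null_set) (auto simp: null_sets_def)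
    moreover have "emeasure ?M (A - {0}) = emeasure ?M A"
    proof (rule emeasure_Diff_null_set)
      have "(\<integral>\<^sup>+x. ennreal (J x) * indicator (T -` {0}) x \<partial>lborel) = (\<integral>\<^sup>+x. 0 \<partial>(lborel :: (real^'m::_) measure))"
      proof (rule nn_integral_cong_AE)
        have "AE x in lborel. x \<noteq> (0::real^'m::_)" by (rule AE_lborel_singleton)
        then show "AE x in lborel. ennreal (J x) * indicator (T -` {0}) x = 0"
          by eventually_elim (use 0 in \<open>auto simp: indicator_def\<close>)
      qed
      moreover have "T -` {0} \<inter> space borel \<in> sets borel" by measurable
      then have "T -` {0} \<in> sets borel" by simp
      ultimately show "{0} \<in> null_sets ?M"
        by (simp add: null_sets_def emeasure_distr emeasure_density)
    qed simp
    ultimately show "emeasure lborel A = emeasure ?M A" by simp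
  qed simp
  then have "(\<integral>\<^sup>+z. f z \<partial>lborel) = (\<integral>\<^sup>+z. f z \<partial>?M)"
    by (rule arg_cong[where f="\<lambda>M. nn_integral M f"])
  also have "\<dots> = (\<integral>\<^sup>+z. f (T z) * ennreal (J z) \<partial>lborel)"
    by (simp add: nn_integral_distr nn_integral_density mult.commute)
  finally show ?thesis by simp
qed

lemma nn_integral_reindex:
  fixes \<pi> :: "'m::finite \<Rightarrow> 'n::finite"
  assumes "bij \<pi>" and [measurable]: "f \<in> borel_measurable borel"
  shows "(\<integral>\<^sup>+z. f (reindex \<pi> z) \<partial>lborel) = (\<integral>\<^sup>+z. f z \<partial>lborel)"
proof -
  have "(\<integral>\<^sup>+z. f z \<partial>lborel) = (\<integral>\<^sup>+z. f z \<partial>distr lborel borel (reindex \<pi>))"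
    by (simp only: distr_reindex[OF assms(1)])
  also have "\<dots> = (\<integral>\<^sup>+z. f (reindex \<pi> z) \<partial>lborel)"
    by (rule nn_integral_distr) simp_all
  finally show ?thesis by (rule sym)
qed

lemma reindex_inv:
  assumes "bij \<pi>"
  shows "reindex (inv \<pi>) (reindex \<pi> x) = x" "reindex \<pi> (reindex (inv \<pi>) y) = y"
proof -
  have "inv \<pi> (\<pi> i) = i" "\<pi> (inv \<pi> j) = j" for i j
    using assms by (auto simp: bij_is_surj surj_f_inv_f bij_is_inj)
  then show "reindex (inv \<pi>) (reindex \<pi> x) = x" "reindex \<pi> (reindex (inv \<pi>) y) = y"
    by (simp_all add: reindex_def vec_eq_iff)
qed

text \<open>Relabelling coordinates preserves the norm and Lebesgue measure and commutes with
  inversion, so the substitution is carried out over the enumerated index type and carried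
  back.\<close>

lemma nn_integral_inversion:
  fixes f :: "real^'n \<Rightarrow> ennreal"
  assumes l: "l > 0" and f[measurable]: "f \<in> borel_measurable borel"
  shows "(\<integral>\<^sup>+z. f (inversion l z) * ennreal ((l / norm z) powr (2 * real CARD('n))) \<partial>lborel) =
     (\<integral>\<^sup>+z. f z \<partial>lborel)"
proof -
  obtain \<pi> :: "'n enumerated \<Rightarrow> 'n" where \<pi>: "bij \<pi>" using ex_reindex by blast
  define J where "J x = (l / x) powr (2 * real CARD('n))" for x
  have [measurable]: "J \<in> borel_measurable borel" unfolding J_def by measurable
  define g where "g z = f (reindex (inv \<pi>) z)" for z
  have [measurable]: "g \<in> borel_measurable borel" unfolding g_def by measurable
  have "(\<integral>\<^sup>+z. f (inversion l z) * ennreal (J (norm z)) \<partial>lborel) =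
      (\<integral>\<^sup>+z. g (inversion l (reindex \<pi> z)) * ennreal (J (norm (reindex \<pi> z))) \<partial>lborel)"
    by (simp add: g_def inversion_reindex[OF \<pi>] reindex_inv[OF \<pi>] norm_reindex[OF \<pi>])
  also have "\<dots> = (\<integral>\<^sup>+z. g (inversion l z) * ennreal (J (norm z)) \<partial>lborel)"
    by (rule nn_integral_reindex[OF \<pi>]) measurable
  also have "\<dots> = (\<integral>\<^sup>+z. g z \<partial>lborel)"
  proof (rule nn_integral_change_of_variables_enumerated[where U="inversion l", OF _ _ _ _ inversion_has_derivative])
    fix z :: "real^'n enumerated" assume z: "z \<noteq> 0"
    have "J (norm z) = (l / norm z) powr real (2 * CARD('n))" by (simp add: J_def)
    also have "\<dots> = (l / norm z) ^ (2 * CARD('n))" using l z by (intro powr_realpow) auto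
    finally show "\<bar>det (matrix (\<lambda>h. (l\<^sup>2 / (norm z)\<^sup>2) *\<^sub>R (h - (2 * (z \<bullet> h) / (norm z)\<^sup>2) *\<^sub>R z)))\<bar> = J (norm z)"
      using l by (simp only: abs_det_inversion_derivative[OF z] CARD_enumerated abs_of_pos)
  qed (use l in \<open>simp_all\<close>)
  also have "\<dots> = (\<integral>\<^sup>+z. g (reindex \<pi> z) \<partial>lborel)"
    by (rule nn_integral_reindex[OF \<pi>, symmetric]) measurable
  finally show ?thesis by (simp add: g_def reindex_inv[OF \<pi>] J_def)
qed

lemma nn_integral_orthogonal:
  fixes f :: "real^'n \<Rightarrow> ennreal" and T :: "real^'n \<Rightarrow> real^'n"
  assumes T: "orthogonal_transformation T" and f[measurable]: "f \<in> borel_measurable borel"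
  shows "(\<integral>\<^sup>+z. f (T z) \<partial>lborel) = (\<integral>\<^sup>+z. f z \<partial>lborel)"
proof -
  obtain \<pi> :: "'n enumerated \<Rightarrow> 'n" where \<pi>: "bij \<pi>" using ex_reindex by blast
  have \<pi>': "bij (inv \<pi>)" using \<pi> by (rule bij_imp_bij_inv)
  define g where "g z = f (reindex (inv \<pi>) z)" for z
  have [measurable]: "g \<in> borel_measurable borel" unfolding g_def by measurable
  define V where "V z = reindex \<pi> (T (reindex (inv \<pi>) z))" for z
  have V: "orthogonal_transformation V"
    unfolding orthogonal_transformation
  proof
    show "linear V" unfolding V_def[abs_def]
      using linear_compose[OF linear_compose[OF linear_reindex[of "inv \<pi>"] orthogonal_transformation_linear[OF T]] linear_reindex[of \<pi>]]
      by (simp add: o_def)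
    show "\<forall>v. norm (V v) = norm v"
      by (simp add: V_def norm_reindex[OF \<pi>] norm_reindex[OF \<pi>'] orthogonal_transformation_norm[OF T])
  qed
  have lin: "linear V" by (rule orthogonal_transformation_linear[OF V])
  have inv: "orthogonal_transformation (inv V)" by (rule orthogonal_transformation_inv[OF V])
  have meas: "W \<in> borel_measurable borel" if "orthogonal_transformation W" for W :: "real^'n enumerated \<Rightarrow> real^'n enumerated"
    using that by (intro borel_measurable_continuous_onI linear_continuous_on linear_linear[THEN iffD2]
        orthogonal_transformation_linear)
  note [measurable] = meas[OF V] meas[OF inv]
  have bijV: "bij V" using orthogonal_transformation_bij[OF V] .
  have VU: "V (inv V z) = z" "inv V (V z) = z" for z
    using surj_f_inv_f[OF bij_is_surj[OF bijV]] inv_f_f[OF bij_is_inj[OF bijV]] by auto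
  have nz: "V z \<noteq> 0" "inv V z \<noteq> 0" if "z \<noteq> 0" for z
    using that orthogonal_transformation_norm[OF V, of z] orthogonal_transformation_norm[OF inv, of z] by auto
  have "(\<integral>\<^sup>+z. f (T z) \<partial>lborel) = (\<integral>\<^sup>+z. g (V (reindex \<pi> z)) \<partial>lborel)"
    by (simp add: g_def V_def reindex_inv[OF \<pi>])
  also have "\<dots> = (\<integral>\<^sup>+z. g (V z) \<partial>lborel)"
    by (rule nn_integral_reindex[OF \<pi>]) measurable
  also have "\<dots> = (\<integral>\<^sup>+z. g (V z) * ennreal 1 \<partial>lborel)" by simp
  also have "\<dots> = (\<integral>\<^sup>+z. g z \<partial>lborel)"
  proof (rule nn_integral_change_of_variables_enumerated[where U="inv V" and T'="\<lambda>_. V"])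
    show "(V has_derivative V) (at z)" for z by (rule linear_imp_has_derivative[OF lin])
    show "\<bar>det (matrix V)\<bar> = 1" by (rule orthogonal_transformation_det[OF V])
  qed (simp_all add: nz VU)
  also have "\<dots> = (\<integral>\<^sup>+z. g (reindex \<pi> z) \<partial>lborel)"
    by (rule nn_integral_reindex[OF \<pi>, symmetric]) measurable
  finally show ?thesis by (simp add: g_def reindex_inv[OF \<pi>])
qed

section \<open>Composition of Riesz kernels\<close>

lemma nn_integral_infinite_if_slow_decay:
  fixes f :: "'a::euclidean_space \<Rightarrow> ennreal"
  assumes f: "\<And>y. R \<le> norm y \<Longrightarrow> ennreal (c * norm y powr - s) \<le> f y"
    and s: "s \<le> real DIM('a)" and R: "R > 0" and c: "c > 0"
  shows "(\<integral>\<^sup>+y. f y \<partial>lborel) = \<infinity>"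
proof -
  have "\<infinity> = ennreal c * radial_power s {y::'a. R \<le> norm y}"
    using radial_power_outside_infinite[OF s R] c by (simp add: ennreal_mult_top)
  also have "\<dots> = (\<integral>\<^sup>+y. ennreal c * (ennreal (norm y powr - s) * indicator {y::'a. R \<le> norm y} y) \<partial>lborel)"
    unfolding radial_power_def by (rule nn_integral_cmult[symmetric]) measurable
  also have "\<dots> \<le> (\<integral>\<^sup>+y. f y \<partial>lborel)"
    using f c by (intro nn_integral_mono) (auto simp: indicator_def ennreal_mult')
  finally show ?thesis by (simp add: top_unique)
qed

text \<open>The integrand is the dominating function for a product of two Riesz kernels with poles
  at distance 1: near its pole it behaves like |y|^-b with b < d, far away it is |y|^-(a+b) with a +
  b > d.\<close>

lemma max_powr_integral_finite:
  assumes a: "0 \<le> a" and b: "b < real DIM('a)" and ab: "a + b > real DIM('a)"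
  shows "(\<integral>\<^sup>+y. ennreal (norm (y::'a::euclidean_space) powr - b * max (norm y) (1/2) powr - a) \<partial>lborel) < \<infinity>"
proof -
  have "(\<integral>\<^sup>+y. ennreal (norm (y::'a) powr - b * max (norm y) (1/2) powr - a) \<partial>lborel) \<le>
     (\<integral>\<^sup>+y. ennreal (2 powr a) * (ennreal (norm (y::'a) powr - b) * indicator {y. norm y < 1/2} y) +
        ennreal (norm (y::'a) powr - (a + b)) * indicator {y. 1/2 \<le> norm y} y \<partial>lborel)"
  proof (intro nn_integral_mono)
    fix y :: 'a
    show "ennreal (norm y powr - b * max (norm y) (1/2) powr - a) \<le>
       ennreal (2 powr a) * (ennreal (norm (y::'a) powr - b) * indicator {y. norm y < 1/2} y) +
        ennreal (norm (y::'a) powr - (a + b)) * indicator {y. 1/2 \<le> norm y} y"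
    proof (cases "norm y < 1/2")
      case True
      have "(1/2 :: real) powr - a = 2 powr a" by (simp add: powr_minus powr_divide)
      then show ?thesis using True by (simp add: ennreal_mult'[symmetric] max_def mult.commute)
    next
      case False
      then have "max (norm y) (1/2) = norm y" by simp
      then have "norm y powr - b * max (norm y) (1/2) powr - a = norm y powr - (a + b)"
        by (simp add: powr_add[symmetric] add.commute)
      then show ?thesis using False by simp
    qed
  qed
  also have "\<dots> = ennreal (2 powr a) * radial_power b {y::'a. norm y < 1/2} + radial_power (a + b) {y::'a. 1/2 \<le> norm y}"
    unfolding radial_power_def by (subst nn_integral_add) (auto simp: nn_integral_cmult)
  also have "\<dots> < \<infinity>"
    using radial_power_inside[OF b, of "1/2"] radial_power_outside[OF ab, of "1/2"]
    by (simp add: ennreal_mult_less_top)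
  finally show ?thesis .
qed

lemma nn_integral_pos_if_AE_pos:
  fixes f :: "'a::euclidean_space \<Rightarrow> ennreal"
  assumes "f \<in> borel_measurable borel" "AE y in lborel. f y > 0"
  shows "(\<integral>\<^sup>+y. f y \<partial>lborel) > 0"
proof (rule ccontr)
  assume "\<not> ?thesis"
  then have "(\<integral>\<^sup>+y. f y \<partial>lborel) = 0" by simp
  then have "AE y in lborel. f y = 0" using assms(1) by (subst (asm) nn_integral_0_iff_AE) auto
  with assms(2) have "AE y in (lborel :: 'a measure). False" by eventually_elim auto
  then have "emeasure lborel (UNIV :: 'a set) = 0"
    by (subst (asm) AE_iff_measurable[of UNIV]) auto
  then show False by simp
qed

text \<open>Rotations and dilations reduce every x to one unit vector \<open>e\<close>, so the
  integral is a pure power of |x| and only its value at \<open>e\<close> has to be shown finite and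
  positive. That value is \<kappa>; the exponent d - a - b collects d from the volume and -a-b from
  the kernels.\<close>

lemma riesz_composition:
  assumes a: "0 < a" "a < real CARD('n)" and b: "0 < b" "b < real CARD('n)" and ab: "a + b > real CARD('n)"
  obtains \<kappa> where "\<kappa> > 0"
    "\<And>x :: real^'n::finite. x \<noteq> 0 \<Longrightarrow>
      (\<integral>\<^sup>+y. ennreal (norm (x - y) powr - a * norm y powr - b) \<partial>lborel) = ennreal (\<kappa> * norm x powr (real CARD('n) - a - b))"
proof -
  obtain e :: "real^'n" where "e \<in> Basis" using nonempty_Basis by blast
  then have e: "norm e = 1" by simp
  let ?d = "real CARD('n)"
  define F where "F x y = ennreal (norm (x - y) powr - a * norm y powr - b)" for x y :: "real^'n"
  have [measurable]: "F x \<in> borel_measurable borel" for x unfolding F_def by measurable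
  define I where "I = (\<integral>\<^sup>+y. F e y \<partial>lborel)"
  define H where "H b a y = ennreal (norm (y::real^'n) powr - b * max (norm y) (1/2) powr - a)" for a b y
  have [measurable]: "H a b \<in> borel_measurable borel" for a b unfolding H_def by measurable
  \<comment> \<open>The norms of y and e - y add up to at least 1. The longer of the two is
    therefore at least 1/2 and at least the shorter, so one of the two dominating functions applies
    at each point.\<close>
  have dom: "F e y \<le> H b a y + H a b (e - y)" for y
  proof -
    have tri: "norm e \<le> norm (e - y) + norm y" using norm_triangle_ineq[of "e - y" y] by simp
    show ?thesis
    proof (cases "norm y \<le> norm (e - y)")
      case True
      then have "norm (e - y) powr - a \<le> max (norm y) (1/2) powr - a"
        using tri e a by (intro powr_mono2') auto
      then have "F e y \<le> H b a y" unfolding F_def H_def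
        by (intro ennreal_leI) (simp add: mult.commute mult_left_mono)
      then show ?thesis by (simp add: add_increasing2)
    next
      case False
      then have "norm y powr - b \<le> max (norm (e - y)) (1/2) powr - b"
        using tri e b by (intro powr_mono2') auto
      then have "F e y \<le> H a b (e - y)" unfolding F_def H_def
        by (intro ennreal_leI) (simp add: mult_left_mono)
      then show ?thesis by (simp add: add_increasing)
    qed
  qed
  have "I \<le> (\<integral>\<^sup>+y. H b a y + H a b (e - y) \<partial>lborel)"
    unfolding I_def by (intro nn_integral_mono dom)
  also have "\<dots> = (\<integral>\<^sup>+y. H b a y \<partial>lborel) + (\<integral>\<^sup>+y. H a b y \<partial>lborel)"
    by (subst nn_integral_add) (simp_all add: nn_integral_lborel_reflect)
  also have "\<dots> < \<infinity>"
    using max_powr_integral_finite[of a b, where 'a="real^'n"] max_powr_integral_finite[of b a, where 'a="real^'n"] a b ab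
    by (simp add: H_def add.commute)
  finally have fin: "I < \<infinity>" .
  have pos: "I > 0" unfolding I_def
  proof (rule nn_integral_pos_if_AE_pos)
    have "AE y in lborel. y \<noteq> e" "AE y in lborel. y \<noteq> (0::real^'n)" by (rule AE_lborel_singleton)+
    then show "AE y in lborel. 0 < F e y"
      by eventually_elim (auto simp: F_def)
  qed simp
  obtain \<kappa> where \<kappa>: "I = ennreal \<kappa>" "\<kappa> > 0"
    using fin pos by (cases I) (auto simp: ennreal_less_zero_iff)
  have "(\<integral>\<^sup>+y. F x y \<partial>lborel) = ennreal (\<kappa> * norm x powr (?d - a - b))" if x: "x \<noteq> 0" for x :: "real^'n"
  proof -
    let ?r = "norm x"
    obtain T :: "real^'n \<Rightarrow> real^'n" where T: "orthogonal_transformation T" "T e = (1 / ?r) *\<^sub>R x"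
      using orthogonal_transformation_exists_1[of e "(1/?r) *\<^sub>R x"] e x by auto
    have lin: "linear T" by (rule orthogonal_transformation_linear[OF T(1)])
    have scale: "F x (?r *\<^sub>R T z) = ennreal (?r powr (- a - b)) * F e z" for z
    proof -
      have "x - ?r *\<^sub>R T z = ?r *\<^sub>R T (e - z)"
        using x by (simp add: linear_diff[OF lin] T(2) scaleR_diff_right)
      then have n: "norm (x - ?r *\<^sub>R T z) = ?r * norm (e - z)"
        by (simp only: norm_scaleR orthogonal_transformation_norm[OF T(1)] abs_norm_cancel)
      show ?thesis
        unfolding F_def n using x
        by (simp add: orthogonal_transformation_norm[OF T(1)] powr_mult ennreal_mult'[symmetric] powr_diff powr_minus field_simps)
    qed
    have "(\<integral>\<^sup>+y. F x y \<partial>lborel) = ennreal (?r ^ CARD('n)) * (\<integral>\<^sup>+y. F x (?r *\<^sub>R y) \<partial>lborel)"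
      using nn_integral_lborel_affine[of "F x" ?r 0] x by simp
    also have "(\<integral>\<^sup>+y. F x (?r *\<^sub>R y) \<partial>lborel) = (\<integral>\<^sup>+y. F x (?r *\<^sub>R T y) \<partial>lborel)"
      by (rule nn_integral_orthogonal[OF T(1), symmetric]) measurable
    also have "\<dots> = ennreal (?r powr (- a - b)) * I"
      unfolding scale I_def by (rule nn_integral_cmult) measurable
    also have "ennreal (?r ^ CARD('n)) * \<dots> = ennreal (\<kappa> * ?r powr (?d - a - b))"
      using x \<kappa> by (simp add: ennreal_mult'[symmetric] powr_realpow[symmetric] powr_add[symmetric] mult.assoc[symmetric])
         (simp add: algebra_simps)
    finally show ?thesis .
  qed
  then show ?thesis using that \<kappa>(2) unfolding F_def by blast
qed

section \<open>The diagonal Hardy--Littlewood--Sobolev inequality\<close>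

text \<open>Applied pointwise below to suitably normalised factors, this takes the place of
  Hoelder's inequality for integrals.\<close>

lemma weighted_young:
  fixes x y \<alpha> :: real
  assumes "0 \<le> \<alpha>" "\<alpha> \<le> 1" "x \<ge> 0" "y \<ge> 0"
  shows "x powr \<alpha> * y powr (1 - \<alpha>) \<le> \<alpha> * x + (1 - \<alpha>) * y"
  using Youngs_inequality_0[of \<alpha> "1 - \<alpha>" x y] assms
  by (cases "x = 0 \<or> y = 0") auto

lemma radial_power_ball:
  fixes x :: "'a::euclidean_space"
  assumes "\<rho> > 0"
  shows "(\<integral>\<^sup>+z. ennreal (norm (x - z) powr - b) * indicator {z. norm (x - z) < \<rho>} z \<partial>lborel) =
     ennreal (\<rho> powr (real DIM('a) - b)) * radial_power b {y::'a. norm y < 1}"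
    and "(\<integral>\<^sup>+z. ennreal (norm (x - z) powr - b) * indicator {z. \<rho> \<le> norm (x - z)} z \<partial>lborel) =
     ennreal (\<rho> powr (real DIM('a) - b)) * radial_power b {y::'a. 1 \<le> norm y}"
proof -
  have gen: "(\<integral>\<^sup>+z. ennreal (norm (x - z) powr - b) * indicator {z. P (norm (x - z))} z \<partial>lborel) =
     ennreal (\<rho> powr (real DIM('a) - b)) * radial_power b {y::'a. P (\<rho> * norm y)}"
    if [measurable]: "{y::'a. P (norm y)} \<in> sets borel" "{y::'a. P (\<rho> * norm y)} \<in> sets borel" for P
  proof -
    have "(\<integral>\<^sup>+z. ennreal (norm (x - z) powr - b) * indicator {z. P (norm (x - z))} z \<partial>lborel) =
      (\<integral>\<^sup>+z. ennreal (norm (x - z) powr - b) * indicator {z. P (norm z)} (x - z) \<partial>lborel)"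
      by (simp add: indicator_def)
    also have "\<dots> = radial_power b {y::'a. P (norm y)}"
      unfolding radial_power_def
      by (rule nn_integral_lborel_reflect[where f="\<lambda>z. ennreal (norm z powr - b) * indicator {z. P (norm z)} z"]) measurable
    also have "{y::'a. P (norm y)} = (*\<^sub>R) \<rho> ` {y. P (\<rho> * norm y)}"
      using assms by (subst scale_norm_set) auto
    finally show ?thesis using assms by (simp add: radial_power_scale)
  qed
  show "(\<integral>\<^sup>+z. ennreal (norm (x - z) powr - b) * indicator {z. norm (x - z) < \<rho>} z \<partial>lborel) =
     ennreal (\<rho> powr (real DIM('a) - b)) * radial_power b {y::'a. norm y < 1}"
    using gen[of "\<lambda>t. t < \<rho>"] assms by simp
  show "(\<integral>\<^sup>+z. ennreal (norm (x - z) powr - b) * indicator {z. \<rho> \<le> norm (x - z)} z \<partial>lborel) =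
     ennreal (\<rho> powr (real DIM('a) - b)) * radial_power b {y::'a. 1 \<le> norm y}"
    using gen[of "\<lambda>t. \<rho> \<le> t"] assms by simp
qed

text \<open>Where \<open>f z \<le> t\<close>, the potential of \<open>f\<close> is bounded by splitting at the radius \<open>\<rho>\<close> with
  \<open>\<rho>\<^sup>d = s t\<^sup>-\<^sup>r\<close>, which balances the two pieces.\<close>

lemma truncated_potential_bound:
  fixes f :: "'a::euclidean_space \<Rightarrow> real" and g r :: real
  defines "d \<equiv> real DIM('a)"
  assumes g: "0 < g" "g < d" and r: "r = 2 * d / (2 * d - g)"
  obtains C where "C \<ge> 0"
    "\<And>(f :: 'a \<Rightarrow> real) s t x. \<lbrakk>f \<in> borel_measurable borel; \<And>z. 0 \<le> f z; (\<integral>\<^sup>+z. ennreal (f z powr r) \<partial>lborel) = ennreal s;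
        s > 0; t > 0\<rbrakk> \<Longrightarrow>
      (\<integral>\<^sup>+z. ennreal (f z * norm (x - z) powr - g) * indicator {z. f z \<le> t} z \<partial>lborel) \<le> ennreal (C * (s powr ((d - g) / d) * t powr (r - 1)))"
proof -
  have dpos: "d > 0" by (simp add: d_def)
  obtain K1 where K1: "radial_power g {y::'a. norm y < 1} = ennreal K1" "K1 \<ge> 0"
    using radial_power_inside[of g 1, where 'a='a] g by (cases "radial_power g {y::'a. norm y < 1}") (auto simp: d_def)
  obtain K2 where K2: "radial_power (2 * d) {y::'a. 1 \<le> norm y} = ennreal K2" "K2 \<ge> 0"
    using radial_power_outside[of "2 * d" 1, where 'a='a] dpos by (cases "radial_power (2 * d) {y::'a. 1 \<le> norm y}") (auto simp: d_def)
  show thesis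
  \<comment> \<open>By the choice of \<rho> the near kernel, the term with f^r and the far kernel
    contribute t \<rho>^(d-g) times \<open>K1\<close>, 1 and \<open>K2\<close> respectively.\<close>
  proof (rule that[of "K1 + 1 + K2"])
    fix f :: "'a \<Rightarrow> real" and s t :: real and x :: 'a
    assume [measurable]: "f \<in> borel_measurable borel" and f0: "\<And>z. 0 \<le> f z"
      and s: "(\<integral>\<^sup>+z. ennreal (f z powr r) \<partial>lborel) = ennreal s" "s > 0" and t: "t > 0"
    define \<rho> where "\<rho> = (s * t powr - r) powr (1 / d)"
    have \<rho>: "\<rho> > 0" using s t by (simp add: \<rho>_def)
    have \<rho>d: "\<rho> powr d = s * t powr - r" using s t dpos by (simp add: \<rho>_def powr_powr)
    \<comment> \<open>Away from x the product is split by Young's inequality with weights 1/r and 1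
      - 1/r = g/(2d). The kernel is raised to the power 2d/g in this way and becomes |x-z|^(-2d),
      which is integrable at infinity, while f becomes f^r.\<close>
    have pw: "f z * norm (x - z) powr - g \<le>
        t powr (1 - r) * \<rho> powr - g * f z powr r + t * \<rho> powr (2 * d - g) * norm (x - z) powr - (2 * d)" if "norm (x - z) \<ge> \<rho>" for z
    proof -
      have nz: "norm (x - z) > 0" using that \<rho> by linarith
      have r1: "1 / r = (2 * d - g) / (2 * d)" "1 - 1 / r = g / (2 * d)" using g dpos by (auto simp: r field_simps)
      have rp: "r > 0" using g by (simp add: r)
      have "f z * norm (x - z) powr - g = t * \<rho> powr - g * ((f z / t) * (\<rho> / norm (x - z)) powr g)"
        using t \<rho> nz by (simp add: powr_divide powr_minus field_simps)
      also have "(f z / t) * (\<rho> / norm (x - z)) powr g = ((f z / t) powr r) powr (1 / r) * ((\<rho> / norm (x - z)) powr (2 * d)) powr (1 - 1 / r)"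
        unfolding r1(2) using f0[of z] t rp dpos by (simp add: powr_powr)
      also have "\<dots> \<le> (1 / r) * (f z / t) powr r + (1 - 1 / r) * (\<rho> / norm (x - z)) powr (2 * d)"
        by (rule weighted_young) (use g dpos in \<open>auto simp: r1\<close>)
      also have "\<dots> \<le> 1 * (f z / t) powr r + 1 * (\<rho> / norm (x - z)) powr (2 * d)"
        unfolding r1 by (intro add_mono mult_right_mono) (use g dpos in \<open>auto simp: field_simps\<close>)
      finally have "f z * norm (x - z) powr - g \<le> t * \<rho> powr - g * ((f z / t) powr r + (\<rho> / norm (x - z)) powr (2 * d))"
        using t by (simp add: mult_left_mono)
      also have "\<dots> = t powr (1 - r) * \<rho> powr - g * f z powr r + t * \<rho> powr (2 * d - g) * norm (x - z) powr - (2 * d)"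
        using t \<rho> nz f0[of z] by (simp add: powr_divide powr_diff powr_minus field_simps)
      finally show ?thesis .
    qed
    have "(\<integral>\<^sup>+z. ennreal (f z * norm (x - z) powr - g) * indicator {z. f z \<le> t} z \<partial>lborel) \<le>
      (\<integral>\<^sup>+z. ennreal t * (ennreal (norm (x - z) powr - g) * indicator {z. norm (x - z) < \<rho>} z) +
         ennreal (t powr (1 - r) * \<rho> powr - g) * ennreal (f z powr r) +
         ennreal (t * \<rho> powr (2 * d - g)) * (ennreal (norm (x - z) powr - (2 * d)) * indicator {z. \<rho> \<le> norm (x - z)} z) \<partial>lborel)"
    proof (intro nn_integral_mono)
      fix z
      show "ennreal (f z * norm (x - z) powr - g) * indicator {z. f z \<le> t} z \<le>
         ennreal t * (ennreal (norm (x - z) powr - g) * indicator {z. norm (x - z) < \<rho>} z) +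
         ennreal (t powr (1 - r) * \<rho> powr - g) * ennreal (f z powr r) +
         ennreal (t * \<rho> powr (2 * d - g)) * (ennreal (norm (x - z) powr - (2 * d)) * indicator {z. \<rho> \<le> norm (x - z)} z)"
      proof (cases "norm (x - z) < \<rho>")
        case True
        have "ennreal (f z * norm (x - z) powr - g) * indicator {z. f z \<le> t} z \<le> ennreal (t * norm (x - z) powr - g)"
          by (auto simp: indicator_def intro!: ennreal_leI mult_right_mono)
        also have "\<dots> \<le> ennreal t * (ennreal (norm (x - z) powr - g) * indicator {z. norm (x - z) < \<rho>} z) +
            ennreal (t powr (1 - r) * \<rho> powr - g) * ennreal (f z powr r)"
          using True t by (simp add: ennreal_mult' add_increasing2)
        finally show ?thesis using True by simp
      next
        case False
        have "ennreal (f z * norm (x - z) powr - g) * indicator {z. f z \<le> t} z \<le> ennreal (f z * norm (x - z) powr - g)"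
          by (auto simp: indicator_def)
        also have "\<dots> \<le> ennreal (t powr (1 - r) * \<rho> powr - g * f z powr r + t * \<rho> powr (2 * d - g) * norm (x - z) powr - (2 * d))"
          using pw[of z] False by (intro ennreal_leI) auto
        finally show ?thesis using False t by (simp add: ennreal_mult'[symmetric] ennreal_plus)
      qed
    qed
    also have "\<dots> = ennreal t * (ennreal (\<rho> powr (d - g)) * ennreal K1) + ennreal (t powr (1 - r) * \<rho> powr - g) * ennreal s +
        ennreal (t * \<rho> powr (2 * d - g)) * (ennreal (\<rho> powr (d - 2 * d)) * ennreal K2)"
      using radial_power_ball[OF \<rho>, of x] K1 K2 s(1)
      by (subst nn_integral_add, simp, simp)+ (simp add: nn_integral_cmult d_def)
    also have "\<dots> = ennreal (t * \<rho> powr (d - g) * K1 + t powr (1 - r) * \<rho> powr - g * s + t * \<rho> powr (2 * d - g) * \<rho> powr (d - 2 * d) * K2)"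
      using t s K1 K2 by (simp add: ennreal_mult'[symmetric] ennreal_plus[symmetric] mult.assoc del: ennreal_plus)
    also have "t * \<rho> powr (d - g) * K1 + t powr (1 - r) * \<rho> powr - g * s + t * \<rho> powr (2 * d - g) * \<rho> powr (d - 2 * d) * K2 =
       (K1 + 1 + K2) * (t * \<rho> powr (d - g))"
    proof -
      have "t powr (1 - r) * \<rho> powr - g * s = t powr (1 - r) * \<rho> powr - g * (\<rho> powr d * t powr r)"
        using \<rho>d t by (simp add: powr_minus field_simps)
      also have "\<dots> = t * \<rho> powr (d - g)"
        using t \<rho> by (simp add: powr_diff powr_minus field_simps)
      finally have 1: "t powr (1 - r) * \<rho> powr - g * s = t * \<rho> powr (d - g)" .
      have 2: "t * \<rho> powr (2 * d - g) * \<rho> powr (d - 2 * d) = t * \<rho> powr (d - g)"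
        by (simp add: powr_add[symmetric] mult.assoc)
      show ?thesis unfolding 1 2 by (simp add: algebra_simps)
    qed
    also have "t * \<rho> powr (d - g) = s powr ((d - g) / d) * t powr (r - 1)"
    proof -
      have "\<rho> powr (d - g) = s powr ((d - g) / d) * t powr (- r * ((d - g) / d))"
        using s t by (simp add: \<rho>_def powr_powr powr_mult)
      moreover have "r - 1 = 1 + - r * ((d - g) / d)"
        using g dpos by (simp add: r field_simps)
      then have "t powr (r - 1) = t * t powr (- r * ((d - g) / d))"
        using t by (simp only: powr_add powr_one)
      ultimately show ?thesis by (simp only: mult_ac)
    qed
    finally show "(\<integral>\<^sup>+z. ennreal (f z * norm (x - z) powr - g) * indicator {z. f z \<le> t} z \<partial>lborel)
      \<le> ennreal ((K1 + 1 + K2) * (s powr ((d - g) / d) * t powr (r - 1)))" .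
  qed (use K1 K2 in simp)
qed

text \<open>Each pair (y, z) is charged to the point where f is larger, at the cost of a factor 2.
  The inner integral is then a potential truncated at the level t = f y, and its bound t^(r-1),
  multiplied by f y, is again f^r. The powers of s combine because 2/r = (d-g)/d + 1. No weak-type
  estimate or interpolation enters.\<close>

lemma hardy_littlewood_sobolev_diagonal:
  fixes g r :: real
  defines "d \<equiv> real DIM('a::euclidean_space)"
  assumes g: "0 < g" "g < d" and r: "r = 2 * d / (2 * d - g)"
  obtains C where "C \<ge> 0"
    "\<And>(f :: 'a \<Rightarrow> real) s. \<lbrakk>f \<in> borel_measurable borel; \<And>z. 0 \<le> f z; (\<integral>\<^sup>+z. ennreal (f z powr r) \<partial>lborel) = ennreal s; s \<ge> 0\<rbrakk> \<Longrightarrow>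
      (\<integral>\<^sup>+y. ennreal (f y) * (\<integral>\<^sup>+z. ennreal (f z * norm (y - z) powr - g) \<partial>lborel) \<partial>lborel) \<le> ennreal (C * s powr (2 / r))"
proof -
  have dpos: "d > 0" by (simp add: d_def)
  obtain C where C: "C \<ge> 0" and bound: "\<And>(f :: 'a \<Rightarrow> real) s t x. \<lbrakk>f \<in> borel_measurable borel; \<And>z. 0 \<le> f z; (\<integral>\<^sup>+z. ennreal (f z powr r) \<partial>lborel) = ennreal s;
        s > 0; t > 0\<rbrakk> \<Longrightarrow>
      (\<integral>\<^sup>+z. ennreal (f z * norm (x - z) powr - g) * indicator {z. f z \<le> t} z \<partial>lborel) \<le> ennreal (C * (s powr ((d - g) / d) * t powr (r - 1)))"
    using truncated_potential_bound[of g r, where 'a='a] g r unfolding d_def by blast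
  show thesis
  proof (rule that[of "2 * C"])
    fix f :: "'a \<Rightarrow> real" and s
    assume f[measurable]: "f \<in> borel_measurable borel" and f0: "\<And>z. 0 \<le> f z"
      and s: "(\<integral>\<^sup>+z. ennreal (f z powr r) \<partial>lborel) = ennreal s" "s \<ge> 0"
    let ?L = "\<integral>\<^sup>+y. ennreal (f y) * (\<integral>\<^sup>+z. ennreal (f z * norm (y - z) powr - g) \<partial>lborel) \<partial>lborel"
    show "?L \<le> ennreal (2 * C * s powr (2 / r))"
    proof (cases "s = 0")
      case True
      have "AE z in lborel. f z = 0"
      proof -
        have "(\<integral>\<^sup>+z. ennreal (f z powr r) \<partial>lborel) = 0" using s True by simp
        then have "AE z in lborel. ennreal (f z powr r) = 0"
          by (subst (asm) nn_integral_0_iff_AE) auto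
        then show ?thesis by eventually_elim (auto simp: ennreal_eq_0_iff powr_def split: if_splits)
      qed
      then have "?L = (\<integral>\<^sup>+y. 0 \<partial>(lborel :: 'a measure))" by (intro nn_integral_cong_AE) auto
      then show ?thesis by simp
    next
      case False
      then have s0: "s > 0" using s by simp
      define k where "k y z = ennreal (f y) * (ennreal (f z * norm (y - z) powr - g) * indicator {z. f z \<le> f y} z)" for y z
      have [measurable]: "case_prod k \<in> borel_measurable (lborel \<Otimes>\<^sub>M lborel)" 
        unfolding k_def indicator_def case_prod_unfold by measurable
      have k2: "(\<lambda>(y, z). k z y) \<in> borel_measurable (lborel \<Otimes>\<^sub>M lborel)"
        unfolding k_def indicator_def case_prod_unfold by measurable
      have split: "ennreal (f y) * ennreal (f z * norm (y - z) powr - g) \<le> k y z + k z y" for y z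
        by (cases "f z \<le> f y") (auto simp: k_def norm_minus_commute mult.left_commute ennreal_mult' f0 add_increasing add_increasing2)
      have "?L = (\<integral>\<^sup>+y. \<integral>\<^sup>+z. ennreal (f y) * ennreal (f z * norm (y - z) powr - g) \<partial>lborel \<partial>lborel)"
        by (intro nn_integral_cong nn_integral_cmult[symmetric]) measurable
      also have "\<dots> \<le> (\<integral>\<^sup>+y. \<integral>\<^sup>+z. k y z + k z y \<partial>lborel \<partial>lborel)"
        by (intro nn_integral_mono split)
      also have "\<dots> = (\<integral>\<^sup>+y. (\<integral>\<^sup>+z. k y z \<partial>lborel) + (\<integral>\<^sup>+z. k z y \<partial>lborel) \<partial>lborel)"
        by (intro nn_integral_cong nn_integral_add) measurable
      also have "\<dots> = (\<integral>\<^sup>+y. \<integral>\<^sup>+z. k y z \<partial>lborel \<partial>lborel) + (\<integral>\<^sup>+y. \<integral>\<^sup>+z. k z y \<partial>lborel \<partial>lborel)"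
        by (intro nn_integral_add) measurable
      also have "(\<integral>\<^sup>+y. \<integral>\<^sup>+z. k z y \<partial>lborel \<partial>lborel) = (\<integral>\<^sup>+y. \<integral>\<^sup>+z. k y z \<partial>lborel \<partial>lborel)"
        by (rule lborel_pair.Fubini') measurable
      finally have "?L \<le> 2 * (\<integral>\<^sup>+y. \<integral>\<^sup>+z. k y z \<partial>lborel \<partial>lborel)" by (simp add: mult_2)
      also have "(\<integral>\<^sup>+y. \<integral>\<^sup>+z. k y z \<partial>lborel \<partial>lborel) \<le> (\<integral>\<^sup>+y. ennreal (C * s powr ((d - g) / d)) * ennreal (f y powr r) \<partial>lborel)"
      proof (intro nn_integral_mono)
        fix y
        show "(\<integral>\<^sup>+z. k y z \<partial>lborel) \<le> ennreal (C * s powr ((d - g) / d)) * ennreal (f y powr r)"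
        proof (cases "f y = 0")
          case False
          then have fy: "f y > 0" using f0[of y] by simp
          have "(\<integral>\<^sup>+z. k y z \<partial>lborel) = ennreal (f y) * (\<integral>\<^sup>+z. ennreal (f z * norm (y - z) powr - g) * indicator {z. f z \<le> f y} z \<partial>lborel)"
            unfolding k_def by (rule nn_integral_cmult) measurable
          also have "\<dots> \<le> ennreal (f y) * ennreal (C * (s powr ((d - g) / d) * f y powr (r - 1)))"
            by (intro mult_left_mono bound f f0 s(1) s0 fy) simp
          also have "\<dots> = ennreal (C * s powr ((d - g) / d) * (f y * f y powr (r - 1)))"
            using fy C by (simp add: ennreal_mult'[symmetric] mult_ac)
          also have "f y * f y powr (r - 1) = f y powr r" using fy by (simp add: powr_diff)
          finally show ?thesis using C by (simp add: ennreal_mult')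
        qed (simp add: k_def)
      qed
      also have "\<dots> = ennreal (C * s powr ((d - g) / d)) * ennreal s"
        by (simp add: nn_integral_cmult s)
      also have "\<dots> = ennreal (C * s powr (2 / r))"
      proof -
        have "2 / r = (d - g) / d + 1" using g dpos by (simp add: r field_simps)
        then have "s powr (2 / r) = s powr ((d - g) / d) * s" using s0 by (simp add: powr_add)
        then show ?thesis using C s0 by (simp add: ennreal_mult'[symmetric] mult.assoc)
      qed
      also have "2 * ennreal (C * s powr (2 / r)) = ennreal (2 * C * s powr (2 / r))"
        using C by (simp add: ennreal_mult' mult.assoc)
      finally show ?thesis by (simp add: mult_left_mono)
    qed
  qed (use C in simp)
qed


text \<open>Testing w \<le> c I(Vw) with Vw and applying the previous inequality to f = Vw bounds Q,
  the integral of V w^2, by c C ||Vw||_r^2. Hoelder's inequality bounds ||Vw||_r^2 by Q times the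
  norm of V in L^(d/(d-g)). If that norm is small, Q \<le> \<theta> Q with \<theta> < 1, and
  finiteness of Q permits the conclusion Q = 0. Then Vw vanishes almost everywhere, and so does w
  through its own bound.\<close>

lemma potential_contraction:
  fixes g c :: real
  defines "d \<equiv> real DIM('a::euclidean_space)"
  assumes g: "0 < g" "g < d" and c: "c > 0"
  obtains \<epsilon> where "\<epsilon> > 0"
    "\<And>V w :: 'a \<Rightarrow> real. \<lbrakk>V \<in> borel_measurable borel; w \<in> borel_measurable borel; \<And>z. 0 \<le> V z; \<And>z. 0 \<le> w z;
        AE y in lborel. ennreal (w y) \<le> ennreal c * (\<integral>\<^sup>+z. ennreal (V z * w z * norm (y - z) powr - g) \<partial>lborel);
        (\<integral>\<^sup>+z. ennreal (V z * (w z)\<^sup>2) \<partial>lborel) < \<infinity>;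
        (\<integral>\<^sup>+z. ennreal (V z powr (d / (d - g))) \<partial>lborel) \<le> ennreal \<epsilon>\<rbrakk> \<Longrightarrow> AE y in lborel. w y = 0"
proof -
  define r where "r = 2 * d / (2 * d - g)"
  have dpos: "d > 0" by (simp add: d_def)
  have r: "0 < r" "r < 2" using g dpos by (auto simp: r_def field_simps)
  obtain C where C: "C \<ge> 0" and HLS: "\<And>(f :: 'a \<Rightarrow> real) s. \<lbrakk>f \<in> borel_measurable borel; \<And>z. 0 \<le> f z; (\<integral>\<^sup>+z. ennreal (f z powr r) \<partial>lborel) = ennreal s; s \<ge> 0\<rbrakk> \<Longrightarrow>
      (\<integral>\<^sup>+y. ennreal (f y) * (\<integral>\<^sup>+z. ennreal (f z * norm (y - z) powr - g) \<partial>lborel) \<partial>lborel) \<le> ennreal (C * s powr (2 / r))"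
    using hardy_littlewood_sobolev_diagonal[of g r, where 'a='a] g unfolding r_def d_def by blast
  \<comment> \<open>Chosen so that c C \<epsilon>^((d-g)/d) = cC / (2(cC + 1)) < 1; the summand 1
    also covers C = 0.\<close>
  define \<epsilon> where "\<epsilon> = (1 / (2 * (c * C + 1))) powr (d / (d - g))"
  have cC: "c * C \<ge> 0" using c C by simp
  have \<epsilon>: "\<epsilon> > 0" using cC by (simp add: \<epsilon>_def)
  have \<epsilon>p: "\<epsilon> powr ((d - g) / d) = 1 / (2 * (c * C + 1))" using cC g dpos by (simp add: \<epsilon>_def powr_powr)
  show thesis
  proof (rule that[OF \<epsilon>])
    fix V w :: "'a \<Rightarrow> real"
    assume [measurable]: "V \<in> borel_measurable borel" "w \<in> borel_measurable borel"
      and V0: "\<And>z. 0 \<le> V z" and w0: "\<And>z. 0 \<le> w z"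
      and le: "AE y in lborel. ennreal (w y) \<le> ennreal c * (\<integral>\<^sup>+z. ennreal (V z * w z * norm (y - z) powr - g) \<partial>lborel)"
      and fin: "(\<integral>\<^sup>+z. ennreal (V z * (w z)\<^sup>2) \<partial>lborel) < \<infinity>"
      and small: "(\<integral>\<^sup>+z. ennreal (V z powr (d / (d - g))) \<partial>lborel) \<le> ennreal \<epsilon>"
    let ?f = "\<lambda>z. V z * w z"
    obtain Q where Q: "(\<integral>\<^sup>+z. ennreal (V z * (w z)\<^sup>2) \<partial>lborel) = ennreal Q" "Q \<ge> 0"
      using fin by (cases "\<integral>\<^sup>+z. ennreal (V z * (w z)\<^sup>2) \<partial>lborel") auto
    have "Q = 0"
    proof (rule ccontr)
      assume "Q \<noteq> 0"
      then have Q0: "Q > 0" using Q by simp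
      \<comment> \<open>Hoelder's inequality for (Vw)^r = V^(r/2) (V w^2)^(r/2) has weights 1 - h
        and h with h = r/2, and h/(1-h) = d/(d-g) is exactly the exponent in which V is assumed
        small. It is carried out pointwise after dividing the two factors by \<epsilon> and
        Q.\<close>
      define h where "h = r / 2"
      have h: "0 < h" "h < 1" using r by (auto simp: h_def)
      have hv: "h = d / (2 * d - g)" "1 - h = (d - g) / (2 * d - g)"
        using g dpos by (auto simp: h_def r_def field_simps)
      have hd: "d / (d - g) * (1 - h) = h" "(1 - h) / h = (d - g) / d"
        unfolding hv(2) using g dpos by (auto simp: hv(1))
      define A where "A = \<epsilon> powr (1 - h) * Q powr h"
      have A: "A \<ge> 0" by (simp add: A_def)
      have pw: "?f z powr r \<le> A * ((1 - h) / \<epsilon> * V z powr (d / (d - g)) + h / Q * (V z * (w z)\<^sup>2))" for z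
      proof (cases "V z = 0 \<or> w z = 0")
        case True then show ?thesis using A h \<epsilon> Q0 V0[of z] by (auto intro!: mult_nonneg_nonneg add_nonneg_nonneg simp: r)
      next
        case False
        then have p: "V z > 0" "w z > 0" using V0[of z] w0[of z] by auto
        have w2: "(w z)\<^sup>2 powr h = w z powr r"
          using powr_powr[of "w z" 2 h] p by (simp add: h_def)
        have Vr: "V z powr r = V z powr h * V z powr h"
          by (simp add: powr_add[symmetric] h_def)
        have "?f z powr r = V z powr (d / (d - g) * (1 - h)) * (V z * (w z)\<^sup>2) powr h"
          unfolding hd(1) using p by (simp add: powr_mult w2 Vr mult_ac)
        also have "\<dots> = (V z powr (d / (d - g))) powr (1 - h) * (V z * (w z)\<^sup>2) powr h"
          by (simp add: powr_powr)
        also have "\<dots> = A * ((V z * (w z)\<^sup>2 / Q) powr h * (V z powr (d / (d - g)) / \<epsilon>) powr (1 - h))"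
          using p \<epsilon> Q0 by (simp add: A_def powr_divide)
        also have "\<dots> \<le> A * (h * (V z * (w z)\<^sup>2 / Q) + (1 - h) * (V z powr (d / (d - g)) / \<epsilon>))"
          using A h p \<epsilon> Q0 by (intro mult_left_mono weighted_young) auto
        finally show ?thesis by (simp add: algebra_simps)
      qed
      have "(\<integral>\<^sup>+z. ennreal (?f z powr r) \<partial>lborel) \<le>
         (\<integral>\<^sup>+z. ennreal A * (ennreal ((1 - h) / \<epsilon>) * ennreal (V z powr (d / (d - g))) + ennreal (h / Q) * ennreal (V z * (w z)\<^sup>2)) \<partial>lborel)"
        using pw A h \<epsilon> Q0 V0
        by (intro nn_integral_mono) (simp add: ennreal_mult[symmetric] ennreal_plus[symmetric] ennreal_leI del: ennreal_plus)
      also have "\<dots> = ennreal A * (ennreal ((1 - h) / \<epsilon>) * (\<integral>\<^sup>+z. ennreal (V z powr (d / (d - g))) \<partial>lborel) + ennreal (h / Q) * ennreal Q)"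
        by (simp add: nn_integral_cmult nn_integral_add Q(1))
      also have "\<dots> \<le> ennreal A * (ennreal ((1 - h) / \<epsilon>) * ennreal \<epsilon> + ennreal (h / Q) * ennreal Q)"
        by (intro mult_left_mono add_mono small) auto
      also have "\<dots> = ennreal A"
        using h \<epsilon> Q0 A by (simp add: ennreal_mult[symmetric] ennreal_plus[symmetric] del: ennreal_plus)
      finally have sA: "(\<integral>\<^sup>+z. ennreal (?f z powr r) \<partial>lborel) \<le> ennreal A" .
      then obtain s where s: "(\<integral>\<^sup>+z. ennreal (?f z powr r) \<partial>lborel) = ennreal s" "s \<ge> 0"
        by (cases "\<integral>\<^sup>+z. ennreal (?f z powr r) \<partial>lborel") (auto simp: top_unique)
      with sA A have sA': "s \<le> A" by simp
      have "ennreal Q = (\<integral>\<^sup>+y. ennreal (?f y) * ennreal (w y) \<partial>lborel)"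
        unfolding Q(1)[symmetric] by (intro nn_integral_cong) (simp add: ennreal_mult[symmetric] V0 w0 power2_eq_square mult.assoc)
      also have "\<dots> \<le> (\<integral>\<^sup>+y. ennreal (?f y) * (ennreal c * (\<integral>\<^sup>+z. ennreal (?f z * norm (y - z) powr - g) \<partial>lborel)) \<partial>lborel)"
      proof (rule nn_integral_mono_AE)
        show "AE y in lborel. ennreal (?f y) * ennreal (w y) \<le>
            ennreal (?f y) * (ennreal c * (\<integral>\<^sup>+z. ennreal (?f z * norm (y - z) powr - g) \<partial>lborel))"
          using le by eventually_elim (auto intro!: mult_left_mono)
      qed
      also have "\<dots> = ennreal c * (\<integral>\<^sup>+y. ennreal (?f y) * (\<integral>\<^sup>+z. ennreal (?f z * norm (y - z) powr - g) \<partial>lborel) \<partial>lborel)"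
        by (subst nn_integral_cmult[symmetric]) (auto simp: mult.left_commute)
      also have "\<dots> \<le> ennreal c * ennreal (C * s powr (2 / r))"
        by (intro mult_left_mono HLS s) (auto simp: V0 w0)
      also have "\<dots> \<le> ennreal c * ennreal (C * A powr (2 / r))"
        using s sA' C r by (intro mult_left_mono ennreal_leI powr_mono2) auto
      also have "A powr (2 / r) = \<epsilon> powr ((d - g) / d) * Q"
      proof -
        have "A powr (2 / r) = A powr (1 / h)" by (simp add: h_def)
        also have "\<dots> = \<epsilon> powr ((1 - h) / h) * Q"
          using h Q0 by (simp add: A_def powr_mult powr_powr)
        finally show ?thesis by (simp add: hd)
      qed
      also have "ennreal c * ennreal (C * (\<epsilon> powr ((d - g) / d) * Q)) = ennreal (c * C / (2 * (c * C + 1)) * Q)"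
        using c C Q0 by (simp add: \<epsilon>p ennreal_mult[symmetric] mult.assoc)
      finally have "Q \<le> c * C / (2 * (c * C + 1)) * Q" using cC Q0 by (simp add: ennreal_le_iff)
      moreover have "c * C / (2 * (c * C + 1)) < 1" using cC by (simp add: field_simps)
      then have "c * C / (2 * (c * C + 1)) * Q < 1 * Q" using Q0 by (rule mult_strict_right_mono)
      ultimately show False by simp
    qed
    then have "AE z in lborel. ennreal (V z * (w z)\<^sup>2) = 0"
      using Q by (subst nn_integral_0_iff_AE[symmetric]) auto
    then have "AE z in lborel. ?f z = 0"
      by eventually_elim (use V0 w0 in \<open>auto simp: ennreal_eq_0_iff mult_le_0_iff antisym\<close>)
    then have "(\<integral>\<^sup>+z. ennreal (V z * w z * norm (y - z) powr - g) \<partial>lborel) = (\<integral>\<^sup>+z. 0 \<partial>(lborel :: 'a measure))" for y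
      by (intro nn_integral_cong_AE) auto
    with le show "AE y in lborel. w y = 0"
      by (auto elim!: eventually_mono simp: ennreal_eq_0_iff antisym w0)
  qed
qed

section \<open>Inversions and the Kelvin transform\<close>

lemma norm_inversion_diff:
  fixes y z :: "'a::real_inner"
  assumes "y \<noteq> 0" "z \<noteq> 0"
  shows "norm (inversion l y - inversion l z) = l\<^sup>2 * norm (y - z) / (norm y * norm z)"
proof (rule power2_eq_imp_eq)
  have "y \<bullet> y \<noteq> 0" "z \<bullet> z \<noteq> 0" using assms by auto
  then show "(norm (inversion l y - inversion l z))\<^sup>2 = (l\<^sup>2 * norm (y - z) / (norm y * norm z))\<^sup>2"
    unfolding inversion_def power_divide power_mult_distrib power2_norm_eq_inner
    by (simp add: inner_diff_left inner_diff_right inner_commute field_simps power2_eq_square)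
qed simp_all

lemma norm_inversion_swap:
  fixes y z :: "'a::real_inner"
  assumes "l > 0" "y \<noteq> 0" "z \<noteq> 0"
  shows "norm y * norm (inversion l y - z) = norm z * norm (y - inversion l z)"
  using norm_inversion_diff[of y "inversion l z" l] assms
  by (simp add: norm_inversion field_simps power2_eq_square)

text \<open>The difference of the squares of the two sides is (|y|^2 - l^2)(|z|^2 - l^2)/l^2. Its
  sign is the source of every comparison below: between two points outside the sphere the kernel
  beats its Kelvin transform.\<close>

lemma inversion_farther:
  fixes y z :: "'a::real_inner"
  assumes l: "l > 0" "l < norm y" "l < norm z"
  shows "norm (y - z) < norm y / l * norm (inversion l y - z)"
proof (rule power2_less_imp_less)
  have y0: "y \<bullet> y \<noteq> 0" using l by auto
  have "(norm y / l * norm (inversion l y - z))\<^sup>2 - (norm (y - z))\<^sup>2 =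
      ((norm y)\<^sup>2 - l\<^sup>2) * ((norm z)\<^sup>2 - l\<^sup>2) / l\<^sup>2"
    unfolding power_mult_distrib power_divide inversion_def power2_norm_eq_inner
    using y0 l(1) by (simp add: inner_diff_left inner_diff_right inner_commute field_simps power2_eq_square)
  moreover have "\<dots> > 0"
    using l by (intro divide_pos_pos mult_pos_pos) (auto simp: power_strict_mono)
  ultimately show "(norm (y - z))\<^sup>2 < (norm y / l * norm (inversion l y - z))\<^sup>2" by linarith
qed (use l in \<open>simp add: divide_nonneg_nonneg\<close>)

lemma AE_norm_neq:
  fixes l :: real
  shows "AE z::'a::euclidean_space in lborel. norm z \<noteq> l"
proof (rule AE_I')
  have "sphere (0::'a) l \<in> null_sets lebesgue"
    using negligible_sphere negligible_iff_null_sets by blast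
  then show "sphere (0::'a) l \<in> null_sets lborel"
    by (simp add: null_sets_def)
qed (auto simp: sphere_def)

lemma nn_integral_inside_inversion:
  fixes f :: "real^'n \<Rightarrow> ennreal"
  assumes l: "l > 0" and [measurable]: "f \<in> borel_measurable borel"
  shows "(\<integral>\<^sup>+z. f z * indicator {z. norm z < l} z \<partial>lborel) =
     (\<integral>\<^sup>+z. f (inversion l z) * ennreal ((l / norm z) powr (2 * real CARD('n))) * indicator {z. l < norm z} z \<partial>lborel)"
proof -
  have "(\<integral>\<^sup>+z. f z * indicator {z. norm z < l} z \<partial>lborel) =
     (\<integral>\<^sup>+z. f (inversion l z) * indicator {z. norm z < l} (inversion l z) * ennreal ((l / norm z) powr (2 * real CARD('n))) \<partial>lborel)"
    by (rule nn_integral_inversion[OF l, symmetric]) measurable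
  also have "\<dots> = (\<integral>\<^sup>+z. f (inversion l z) * ennreal ((l / norm z) powr (2 * real CARD('n))) * indicator {z. l < norm z} z \<partial>lborel)"
  proof (intro nn_integral_cong)
    fix z :: "real^'n"
    have "l\<^sup>2 / norm z < l \<longleftrightarrow> l < norm z" if "z \<noteq> 0"
      using l that by (simp add: field_simps power2_eq_square)
    then show "f (inversion l z) * indicator {z. norm z < l} (inversion l z) * ennreal ((l / norm z) powr (2 * real CARD('n))) =
       f (inversion l z) * ennreal ((l / norm z) powr (2 * real CARD('n))) * indicator {z. l < norm z} z"
      by (cases "z = 0") (auto simp: indicator_def norm_inversion)
  qed
  finally show ?thesis .
qed

lemma AE_inversion:
  fixes P :: "real^'n \<Rightarrow> bool"
  assumes l: "l > 0" and "AE z in lborel. P z"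
  shows "AE z in lborel. z \<noteq> 0 \<longrightarrow> P (inversion l z)"
proof -
  obtain N where N: "N \<in> sets lborel" "emeasure lborel N = 0" "{z. \<not> P z} \<subseteq> N"
    using assms(2) by (auto elim!: AE_E)
  have [measurable]: "N \<in> sets borel" using N(1) by simp
  have "(\<integral>\<^sup>+z. indicator N (inversion l z) * ennreal ((l / norm z) powr (2 * real CARD('n))) \<partial>lborel) = 0"
    by (subst nn_integral_inversion[OF l]) (use N in auto)
  then have "AE z in lborel. indicator N (inversion l z) * ennreal ((l / norm z) powr (2 * real CARD('n))) = 0"
    by (subst (asm) nn_integral_0_iff_AE) auto
  then show ?thesis
    by eventually_elim (use l N(3) in \<open>auto simp: indicator_def ennreal_eq_0_iff split: if_splits\<close>)
qed

text \<open>Convexity of the power: this is the tangent inequality at x, obtained from Young's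
  inequality with weight 1/p, so that y = 0 needs no special treatment.\<close>

lemma powr_diff_le_derivative:
  fixes x y p :: real
  assumes "p \<ge> 1" "0 \<le> y" "y \<le> x"
  shows "x powr p - y powr p \<le> p * x powr (p - 1) * (x - y)"
proof (cases "x = 0")
  case False
  then have x: "x > 0" using assms by simp
  have "(y powr p) powr (1/p) * (x powr p) powr (1 - 1/p) \<le> 1/p * y powr p + (1 - 1/p) * x powr p"
    by (rule weighted_young) (use assms in auto)
  moreover have "(y powr p) powr (1/p) = y" "(x powr p) powr (1 - 1/p) = x powr (p - 1)"
    using assms by (auto simp: powr_powr algebra_simps)
  ultimately have "p * (y * x powr (p - 1)) \<le> p * (1/p * y powr p + (1 - 1/p) * x powr p)"
    using assms by (intro mult_left_mono) auto
  also have "\<dots> = y powr p + (p - 1) * x powr p" using assms by (simp add: field_simps)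
  finally have "p * (y * x powr (p - 1)) \<le> y powr p + (p - 1) * x powr p" .
  moreover have "x powr (p - 1) * x = x powr p" using x by (simp add: powr_diff)
  ultimately show ?thesis by (simp add: algebra_simps)
qed (use assms in auto)

definition potential :: "real \<Rightarrow> real \<Rightarrow> real \<Rightarrow> ('a::euclidean_space \<Rightarrow> real) \<Rightarrow> 'a \<Rightarrow> ennreal" where
  "potential c g p v y = ennreal c * (\<integral>\<^sup>+z. ennreal (v z powr p * norm (y - z) powr - g) \<partial>lborel)"

text \<open>The weight carries the exponent g of the kernel, whatever p is; this makes the kernel
  transform exactly, and the mismatch caused by p is collected in one power of l/|z|, with exponent
  \<open>\<tau>\<close> below.\<close>

definition kelvin :: "real \<Rightarrow> real \<Rightarrow> ('a::euclidean_space \<Rightarrow> real) \<Rightarrow> 'a \<Rightarrow> real" where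
  "kelvin g l v y = (l / norm y) powr g * v (inversion l y)"

lemma potential_translate:
  assumes [measurable]: "v \<in> borel_measurable borel"
  shows "potential c g p (\<lambda>z. v (x + z)) y = potential c g p v (x + y)"
  using nn_integral_lborel_translate[of "\<lambda>z. ennreal (v z powr p * norm (x + y - z) powr - g)" x]
  by (simp add: potential_def add_diff_eq algebra_simps)

lemma borel_measurable_potential [measurable]:
  fixes v :: "'a::euclidean_space \<Rightarrow> real"
  assumes [measurable]: "v \<in> borel_measurable borel"
  shows "potential c g p v \<in> borel_measurable borel"
proof -
  have "(\<lambda>y. \<integral>\<^sup>+z. ennreal (v z powr p * norm (y - z) powr - g) \<partial>lborel) \<in> borel_measurable borel"
    by (rule lborel.borel_measurable_nn_integral) (simp add: case_prod_unfold)
  then show ?thesis unfolding potential_def by measurable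
qed

text \<open>Nontrivial nonnegative solutions of the boundary equation \<open>v = c I(v\<^sup>p)\<close>, where \<open>I\<close> has kernel
  \<open>|x - z|\<^sup>-\<^sup>g\<close>.\<close>

locale riesz_solution =
  fixes d c g p :: real and v :: "real^'n::finite \<Rightarrow> real"
  assumes d_eq: "d = real CARD('n)"
    and c_pos: "c > 0" and g_pos: "g > 0" and g_less: "g < d" and p_pos: "p > 0"
    and v_measurable [measurable]: "v \<in> borel_measurable borel"
    and v_nonneg: "0 \<le> v z"
    and v_nontrivial: "\<not> (AE z in lborel. v z = 0)"
    and v_eq: "AE y in lborel. ennreal (v y) = potential c g p v y"
begin

text \<open>The defect of conformal invariance: 2d from the Jacobian of the inversion, -g from the
  kernel and -pg from v^p. It vanishes exactly at the critical exponent p = 2d/g - 1.\<close>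

abbreviation \<tau> :: real where "\<tau> \<equiv> 2 * d - g - p * g"

abbreviation V :: "real^'n \<Rightarrow> ennreal" where "V \<equiv> potential c g p v"

text \<open>The Kelvin transform of the kernel |y - z|^-g in the variable y. It is also its Kelvin
  transform in z, by \<open>out_kernel_swap\<close>.\<close>

definition out_kernel :: "real \<Rightarrow> real^'n \<Rightarrow> real^'n \<Rightarrow> real" where
  "out_kernel l y z = (l / norm y) powr g * norm (inversion l y - z) powr - g"

text \<open>The density that the mass of v^p inside the sphere presents outside it after inversion.
  For \<open>\<tau>\<close> = 0 it is the p-th power of the Kelvin transform.\<close>

definition reflected :: "real \<Rightarrow> real^'n \<Rightarrow> real" where
  "reflected l z = (l / norm z) powr \<tau> * kelvin g l v z powr p"

lemma measurable_kelvin [measurable]: "kelvin g l v \<in> borel_measurable borel"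
  unfolding kelvin_def by measurable

lemma measurable_reflected [measurable]: "reflected l \<in> borel_measurable borel"
  unfolding reflected_def by measurable

lemma measurable_out_kernel [measurable]: "out_kernel l y \<in> borel_measurable borel"
  unfolding out_kernel_def by measurable

lemma kelvin_nonneg: "0 \<le> kelvin g l v z"
  by (simp add: kelvin_def v_nonneg)

lemma reflected_nonneg: "0 \<le> reflected l z"
  by (simp add: reflected_def)

lemma out_kernel_nonneg: "0 \<le> out_kernel l y z"
  by (simp add: out_kernel_def)

lemma out_kernel_swap:
  assumes "l > 0" "y \<noteq> 0" "z \<noteq> 0"
  shows "out_kernel l y z = (l / norm z) powr g * norm (y - inversion l z) powr - g"
proof -
  have "out_kernel l y z = l powr g * (norm y * norm (inversion l y - z)) powr - g"
    using assms by (simp add: out_kernel_def powr_divide powr_minus powr_mult field_simps)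
  also have "\<dots> = l powr g * (norm z * norm (y - inversion l z)) powr - g"
    by (simp only: norm_inversion_swap[OF assms])
  also have "\<dots> = (l / norm z) powr g * norm (y - inversion l z) powr - g"
    using assms by (simp add: powr_divide powr_minus powr_mult field_simps)
  finally show ?thesis .
qed

text \<open>Strictness matters for the case of equality: it turns a single point of contact into
  identity of the two functions.\<close>

lemma out_kernel_less:
  assumes l: "l > 0" "l < norm y" "l < norm z" and "y \<noteq> z"
  shows "out_kernel l y z < norm (y - z) powr - g"
proof -
  have "0 < norm (y - z)" using assms by simp
  with inversion_farther[OF l]
  have "(norm y / l * norm (inversion l y - z)) powr - g < norm (y - z) powr - g"
    using g_pos by (intro powr_less_mono2_neg) auto
  moreover have "(norm y / l * norm (inversion l y - z)) powr - g = out_kernel l y z"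
    using l by (auto simp: out_kernel_def powr_mult powr_divide powr_minus field_simps)
  ultimately show ?thesis by simp
qed

lemma out_kernel_le:
  assumes l: "l > 0" "l < norm y" "l < norm z" and "y \<noteq> z"
  shows "out_kernel l y z \<le> norm (y - z) powr - g"
  using out_kernel_less[OF assms] by simp

lemma v_inversion:
  assumes "l > 0" "z \<noteq> 0"
  shows "v (inversion l z) = (l / norm z) powr - g * kelvin g l v z"
  using assms by (simp add: kelvin_def mult.assoc[symmetric] powr_add[symmetric])

lemma v_inversion_powr:
  assumes "l > 0" "z \<noteq> 0"
  shows "v (inversion l z) powr q * (l / norm z) powr s = (l / norm z) powr (s - g * q) * kelvin g l v z powr q"
proof -
  have "v (inversion l z) powr q = (l / norm z) powr (- g * q) * kelvin g l v z powr q"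
    by (simp add: v_inversion[OF assms] powr_mult powr_powr)
  moreover have "(l / norm z) powr (s - g * q) = (l / norm z) powr (- g * q) * (l / norm z) powr s"
    by (simp add: powr_add[symmetric])
  ultimately show ?thesis by (simp only: mult_ac)
qed

text \<open>Folding the part of the integral inside the sphere onto the outside by inversion writes
  the potential and its Kelvin transform over the same domain. In one of them \<open>v^p\<close>
  meets the direct kernel and \<open>reflected\<close> the transformed one; in the other the pairing
  is exchanged. Formally their difference is therefore the integral of the product
  (\<open>v^p\<close> - \<open>reflected\<close>)(direct - transformed kernel).\<close>

lemma potential_split:
  assumes l: "l > 0" and y: "y \<noteq> 0"
  shows "V y = ennreal c * (\<integral>\<^sup>+z. ennreal (v z powr p * norm (y - z) powr - g + reflected l z * out_kernel l y z)
           * indicator {z. l < norm z} z \<partial>lborel)" (is "_ = _ * ?R")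
    and "ennreal ((l / norm y) powr g) * V (inversion l y) =
         ennreal c * (\<integral>\<^sup>+z. ennreal (v z powr p * out_kernel l y z + reflected l z * norm (y - z) powr - g)
           * indicator {z. l < norm z} z \<partial>lborel)" (is "_ = _ * ?S")
proof -
  have split: "(\<integral>\<^sup>+z. ennreal (F z) \<partial>lborel) =
      (\<integral>\<^sup>+z. ennreal (F z + F (inversion l z) * (l / norm z) powr (2 * d)) * indicator {z. l < norm z} z \<partial>lborel)"
    if [measurable]: "F \<in> borel_measurable borel" and F0: "\<And>z. 0 \<le> F z" for F :: "real^'n \<Rightarrow> real"
  proof -
    have "(\<integral>\<^sup>+z. ennreal (F z) \<partial>lborel) =
       (\<integral>\<^sup>+z. ennreal (F z) * indicator {z. l < norm z} z + ennreal (F z) * indicator {z. norm z < l} z \<partial>lborel)"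
      using AE_norm_neq[of l] by (intro nn_integral_cong_AE) (auto elim!: eventually_mono simp: indicator_def)
    also have "\<dots> = (\<integral>\<^sup>+z. ennreal (F z) * indicator {z. l < norm z} z \<partial>lborel) + (\<integral>\<^sup>+z. ennreal (F z) * indicator {z. norm z < l} z \<partial>lborel)"
      by (rule nn_integral_add) measurable
    also have "(\<integral>\<^sup>+z. ennreal (F z) * indicator {z. norm z < l} z \<partial>lborel) =
       (\<integral>\<^sup>+z. ennreal (F (inversion l z)) * ennreal ((l / norm z) powr (2 * d)) * indicator {z. l < norm z} z \<partial>lborel)"
      unfolding d_eq by (rule nn_integral_inside_inversion[OF l]) measurable
    also have "(\<integral>\<^sup>+z. ennreal (F z) * indicator {z. l < norm z} z \<partial>lborel) + \<dots> =
       (\<integral>\<^sup>+z. ennreal (F z) * indicator {z. l < norm z} z + ennreal (F (inversion l z)) * ennreal ((l / norm z) powr (2 * d)) * indicator {z. l < norm z} z \<partial>lborel)"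
      by (rule nn_integral_add[symmetric]) measurable
    also have "\<dots> = (\<integral>\<^sup>+z. ennreal (F z + F (inversion l z) * (l / norm z) powr (2 * d)) * indicator {z. l < norm z} z \<partial>lborel)"
      using F0 by (intro nn_integral_cong) (auto simp: indicator_def ennreal_mult)
    finally show ?thesis .
  qed
  have "(\<integral>\<^sup>+z. ennreal (v z powr p * norm (y - z) powr - g) \<partial>lborel) = ?R"
  proof (subst split, simp, simp, rule nn_integral_cong)
    fix z
    have "v (inversion l z) powr p * norm (y - inversion l z) powr - g * (l / norm z) powr (2 * d) =
       reflected l z * out_kernel l y z" if "z \<noteq> 0"
    proof -
      have "v (inversion l z) powr p * norm (y - inversion l z) powr - g * (l / norm z) powr (2 * d) =
         (l / norm z) powr (2 * d - g * p) * kelvin g l v z powr p * norm (y - inversion l z) powr - g"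
        using v_inversion_powr[OF l that, of p "2 * d"] by (simp add: mult_ac)
      also have "(l / norm z) powr (2 * d - g * p) = (l / norm z) powr \<tau> * (l / norm z) powr g"
        by (simp add: powr_add[symmetric] algebra_simps)
      finally show ?thesis
        using out_kernel_swap[OF l y that] by (simp add: reflected_def mult_ac)
    qed
    then show "ennreal (v z powr p * norm (y - z) powr - g + v (inversion l z) powr p * norm (y - inversion l z) powr - g * (l / norm z) powr (2 * d))
        * indicator {z. l < norm z} z =
      ennreal (v z powr p * norm (y - z) powr - g + reflected l z * out_kernel l y z) * indicator {z. l < norm z} z"
      using l by (cases "z = 0") auto
  qed
  then show "V y = ennreal c * ?R" by (simp add: potential_def)
  have "ennreal ((l / norm y) powr g) * V (inversion l y) =
    ennreal c * (ennreal ((l / norm y) powr g) * (\<integral>\<^sup>+z. ennreal (v z powr p * norm (inversion l y - z) powr - g) \<partial>lborel))"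
    by (simp add: potential_def mult.left_commute)
  also have "ennreal ((l / norm y) powr g) * (\<integral>\<^sup>+z. ennreal (v z powr p * norm (inversion l y - z) powr - g) \<partial>lborel) =
     (\<integral>\<^sup>+z. ennreal (v z powr p * out_kernel l y z) \<partial>lborel)"
    by (subst nn_integral_cmult[symmetric]) (auto simp: out_kernel_def ennreal_mult'[symmetric] mult_ac)
  also have "\<dots> = ?S"
  proof (subst split, simp, simp add: out_kernel_nonneg, rule nn_integral_cong)
    fix z
    have "v (inversion l z) powr p * out_kernel l y (inversion l z) * (l / norm z) powr (2 * d) =
       reflected l z * norm (y - z) powr - g" if z: "z \<noteq> 0"
    proof -
      have "out_kernel l y (inversion l z) = (l / norm y) powr g * (l\<^sup>2 * norm (y - z) / (norm y * norm z)) powr - g"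
        by (simp add: out_kernel_def norm_inversion_diff[OF y z])
      also have "l\<^sup>2 * norm (y - z) / (norm y * norm z) = (l / norm y) * ((l / norm z) * norm (y - z))"
        by (simp add: power2_eq_square)
      also have "(l / norm y) powr g * \<dots> powr - g = (l / norm z) powr - g * norm (y - z) powr - g"
      proof -
        have "(l / norm y * (l / norm z * norm (y - z))) powr - g =
            (l / norm y) powr - g * ((l / norm z) powr - g * norm (y - z) powr - g)"
          by (simp only: powr_mult)
        moreover have "(l / norm y) powr g * (l / norm y) powr - g = 1"
          using l y by (simp add: powr_add[symmetric])
        ultimately show ?thesis by (simp only: mult.assoc[symmetric] mult_1)
      qed
      finally have k: "out_kernel l y (inversion l z) = (l / norm z) powr - g * norm (y - z) powr - g" .
      have "v (inversion l z) powr p * out_kernel l y (inversion l z) * (l / norm z) powr (2 * d) =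
        (l / norm z) powr (2 * d - g * p) * kelvin g l v z powr p * (l / norm z) powr - g * norm (y - z) powr - g"
        unfolding k using v_inversion_powr[OF l that, of p "2 * d"] by (simp add: mult_ac)
      also have "\<dots> = ((l / norm z) powr (2 * d - g * p) * (l / norm z) powr - g) * kelvin g l v z powr p * norm (y - z) powr - g"
        by (simp add: mult_ac)
      also have "(l / norm z) powr (2 * d - g * p) * (l / norm z) powr - g = (l / norm z) powr \<tau>"
        by (simp add: powr_add[symmetric] algebra_simps)
      finally show ?thesis by (simp add: reflected_def)
    qed
    then show "ennreal (v z powr p * out_kernel l y z + v (inversion l z) powr p * out_kernel l y (inversion l z) * (l / norm z) powr (2 * d))
        * indicator {z. l < norm z} z =
      ennreal (v z powr p * out_kernel l y z + reflected l z * norm (y - z) powr - g) * indicator {z. l < norm z} z"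
      using l by (cases "z = 0") auto
  qed
  finally show "ennreal ((l / norm y) powr g) * V (inversion l y) = ennreal c * ?S" .
qed

text \<open>Pointwise, with A = v^p, P = \<open>reflected\<close> and kernels a > b: if P \<le> A,
  then (A-P)(a-b) \<ge> 0 gives the claim without a correction; otherwise A b \<le> P b, and adding
  (P-A)a is enough. No potential is subtracted, as either may be infinite.\<close>

lemma kelvin_potential_le:
  assumes l: "l > 0" and y: "l < norm y"
  shows "ennreal ((l / norm y) powr g) * V (inversion l y) \<le>
    V y + ennreal c * (\<integral>\<^sup>+z. ennreal (max 0 (reflected l z - v z powr p) * norm (y - z) powr - g) * indicator {z. l < norm z} z \<partial>lborel)"
proof -
  have y0: "y \<noteq> 0" using l y by auto
  let ?I = "\<lambda>z. indicator {z. l < norm z} z :: ennreal"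
  have "(\<integral>\<^sup>+z. ennreal (v z powr p * out_kernel l y z + reflected l z * norm (y - z) powr - g) * ?I z \<partial>lborel)
     \<le> (\<integral>\<^sup>+z. ennreal (v z powr p * norm (y - z) powr - g + reflected l z * out_kernel l y z) * ?I z +
         ennreal (max 0 (reflected l z - v z powr p) * norm (y - z) powr - g) * ?I z \<partial>lborel)"
  proof (intro nn_integral_mono_AE)
    have "AE z in lborel. z \<noteq> y" by (rule AE_lborel_singleton)
    then show "AE z in lborel. ennreal (v z powr p * out_kernel l y z + reflected l z * norm (y - z) powr - g) * ?I z \<le>
         ennreal (v z powr p * norm (y - z) powr - g + reflected l z * out_kernel l y z) * ?I z +
         ennreal (max 0 (reflected l z - v z powr p) * norm (y - z) powr - g) * ?I z"
    proof eventually_elim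
      fix z assume "z \<noteq> y"
      define a b A P where "a = norm (y - z) powr - g" and "b = out_kernel l y z" and "A = v z powr p" and "P = reflected l z"
      have nn: "0 \<le> b" "0 \<le> A" "0 \<le> P" "0 \<le> a"
        by (auto simp: a_def b_def A_def P_def reflected_nonneg out_kernel_nonneg)
      have "A * b + P * a \<le> A * a + P * b + max 0 (P - A) * a" if "l < norm z"
      proof (cases "P \<le> A")
        case True
        have "b \<le> a" unfolding a_def b_def using out_kernel_le[OF l y that] \<open>z \<noteq> y\<close> by auto
        with True have "0 \<le> (A - P) * (a - b)" by simp
        then show ?thesis using True by (simp add: algebra_simps)
      next
        case False
        then have "A * b \<le> P * b" using nn by (intro mult_right_mono) auto
        then show ?thesis using False by (simp add: algebra_simps)
      qed
      then show "ennreal (A * b + P * a) * ?I z \<le> ennreal (A * a + P * b) * ?I z + ennreal (max 0 (P - A) * a) * ?I z"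
        using nn by (auto simp: indicator_def ennreal_plus[symmetric] intro!: ennreal_leI simp del: ennreal_plus)
    qed
  qed
  also have "\<dots> = (\<integral>\<^sup>+z. ennreal (v z powr p * norm (y - z) powr - g + reflected l z * out_kernel l y z) * ?I z \<partial>lborel) +
      (\<integral>\<^sup>+z. ennreal (max 0 (reflected l z - v z powr p) * norm (y - z) powr - g) * ?I z \<partial>lborel)"
    by (rule nn_integral_add) measurable
  finally show ?thesis
    unfolding potential_split[OF l y0] by (simp add: distrib_left[symmetric] mult_left_mono)
qed

text \<open>The exact form of the comparison once the reflected density lies below. Both factors
  under the last integral are nonnegative, so equal finite values at one point force the integrand
  to vanish almost everywhere.\<close>

lemma potential_kelvin_diff:
  assumes l: "l > 0" and y: "l < norm y"
    and le: "\<And>z. l < norm z \<Longrightarrow> reflected l z \<le> v z powr p"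
  shows "V y = ennreal ((l / norm y) powr g) * V (inversion l y) +
    ennreal c * (\<integral>\<^sup>+z. ennreal ((v z powr p - reflected l z) * (norm (y - z) powr - g - out_kernel l y z)) * indicator {z. l < norm z} z \<partial>lborel)"
proof -
  have y0: "y \<noteq> 0" using l y by auto
  let ?I = "\<lambda>z. indicator {z. l < norm z} z :: ennreal"
  have "(\<integral>\<^sup>+z. ennreal (v z powr p * norm (y - z) powr - g + reflected l z * out_kernel l y z) * ?I z \<partial>lborel)
     = (\<integral>\<^sup>+z. ennreal (v z powr p * out_kernel l y z + reflected l z * norm (y - z) powr - g) * ?I z +
         ennreal ((v z powr p - reflected l z) * (norm (y - z) powr - g - out_kernel l y z)) * ?I z \<partial>lborel)"
  proof (intro nn_integral_cong_AE)
    have "AE z in lborel. z \<noteq> y" by (rule AE_lborel_singleton)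
    then show "AE z in lborel. ennreal (v z powr p * norm (y - z) powr - g + reflected l z * out_kernel l y z) * ?I z =
         ennreal (v z powr p * out_kernel l y z + reflected l z * norm (y - z) powr - g) * ?I z +
         ennreal ((v z powr p - reflected l z) * (norm (y - z) powr - g - out_kernel l y z)) * ?I z"
    proof eventually_elim
      fix z assume "z \<noteq> y"
      define a b A P where "a = norm (y - z) powr - g" and "b = out_kernel l y z" and "A = v z powr p" and "P = reflected l z"
      have nn: "0 \<le> b" "0 \<le> A" "0 \<le> P" "0 \<le> a"
        by (auto simp: a_def b_def A_def P_def reflected_nonneg out_kernel_nonneg)
      have "0 \<le> (A - P) * (a - b)" if "l < norm z"
        using out_kernel_le[OF l y that] \<open>z \<noteq> y\<close> le[OF that] unfolding a_def b_def A_def P_def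
        by (intro mult_nonneg_nonneg) auto
      moreover have "A * a + P * b = A * b + P * a + (A - P) * (a - b)" by (simp add: algebra_simps)
      ultimately show "ennreal (A * a + P * b) * ?I z = ennreal (A * b + P * a) * ?I z + ennreal ((A - P) * (a - b)) * ?I z"
        using nn by (auto simp: indicator_def ennreal_plus[symmetric] simp del: ennreal_plus)
    qed
  qed
  also have "\<dots> = (\<integral>\<^sup>+z. ennreal (v z powr p * out_kernel l y z + reflected l z * norm (y - z) powr - g) * ?I z \<partial>lborel) +
      (\<integral>\<^sup>+z. ennreal ((v z powr p - reflected l z) * (norm (y - z) powr - g - out_kernel l y z)) * ?I z \<partial>lborel)"
    by (rule nn_integral_add) measurable
  finally show ?thesis
    unfolding potential_split[OF l y0] by (simp add: distrib_left)
qed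

text \<open>For q = p + 1 the weight exponent 2d - gq is \<open>\<tau>\<close>; this is how
  integrability of v inside a sphere controls its Kelvin transform outside.\<close>

lemma kelvin_power_integral:
  assumes l: "l > 0"
  shows "(\<integral>\<^sup>+z. ennreal ((l / norm z) powr (2 * d - g * q) * kelvin g l v z powr q) * indicator {z. l < norm z} z \<partial>lborel) =
    (\<integral>\<^sup>+z. ennreal (v z powr q) * indicator {z. norm z < l} z \<partial>lborel)"
proof -
  have "(\<integral>\<^sup>+z. ennreal (v z powr q) * indicator {z. norm z < l} z \<partial>lborel) =
     (\<integral>\<^sup>+z. ennreal (v (inversion l z) powr q) * ennreal ((l / norm z) powr (2 * d)) * indicator {z. l < norm z} z \<partial>lborel)"
    unfolding d_eq by (rule nn_integral_inside_inversion[OF l]) measurable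
  also have "\<dots> = (\<integral>\<^sup>+z. ennreal ((l / norm z) powr (2 * d - g * q) * kelvin g l v z powr q) * indicator {z. l < norm z} z \<partial>lborel)"
  proof (intro nn_integral_cong)
    fix z :: "real^'n"
    show "ennreal (v (inversion l z) powr q) * ennreal ((l / norm z) powr (2 * d)) * indicator {z. l < norm z} z =
      ennreal ((l / norm z) powr (2 * d - g * q) * kelvin g l v z powr q) * indicator {z. l < norm z} z"
      using v_inversion_powr[OF l, of z q "2 * d"] l by (cases "z = 0") (auto simp: ennreal_mult[symmetric])
  qed
  finally show ?thesis by simp
qed

end

text \<open>The Kelvin transform stays below the solution as soon as the weight of the linearised reflected
  equation, restricted to the set where this fails, is small in the scale-invariant norm.\<close>

lemma kelvin_comparison:
  fixes c g p :: real
  defines "d \<equiv> real CARD('n::finite)"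
  assumes "c > 0" "g > 0" "g < d" "p \<ge> 1" and tau: "2 * d - g - p * g \<ge> 0"
  obtains \<epsilon> where "\<epsilon> > 0"
    "\<And>(v :: real^'n \<Rightarrow> real) l y. \<lbrakk>riesz_solution d c g p v; l > 0;
       (\<integral>\<^sup>+z. ennreal (v z powr (p + 1)) * indicator {z. norm z < l} z \<partial>lborel) < \<infinity>;
       (\<integral>\<^sup>+z. ennreal (((l / norm z) powr (2 * d - g - p * g) * kelvin g l v z powr (p - 1)) powr (d / (d - g)))
           * indicator {z. l < norm z \<and> v z < kelvin g l v z} z \<partial>lborel) \<le> ennreal \<epsilon>;
       l < norm y\<rbrakk> \<Longrightarrow> ennreal ((l / norm y) powr g) * potential c g p v (inversion l y) \<le> potential c g p v y"
proof -
  have p: "p > 0" "c * p > 0" using assms by auto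
  define q where "q = d / (d - g)"
  have q: "q > 0" using assms by (simp add: q_def)
  obtain \<epsilon> where \<epsilon>: "\<epsilon> > 0" and contr: "\<And>V w :: real^'n \<Rightarrow> real. \<lbrakk>V \<in> borel_measurable borel; w \<in> borel_measurable borel; \<And>z. 0 \<le> V z; \<And>z. 0 \<le> w z;
        AE y in lborel. ennreal (w y) \<le> ennreal (c * p) * (\<integral>\<^sup>+z. ennreal (V z * w z * norm (y - z) powr - g) \<partial>lborel);
        (\<integral>\<^sup>+z. ennreal (V z * (w z)\<^sup>2) \<partial>lborel) < \<infinity>;
        (\<integral>\<^sup>+z. ennreal (V z powr q) \<partial>lborel) \<le> ennreal \<epsilon>\<rbrakk> \<Longrightarrow> AE y in lborel. w y = 0"
    using potential_contraction[of g "c * p", where 'a="real^'n"] assms p unfolding q_def d_def by auto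
  show thesis
  proof (rule that[OF \<epsilon>])
    fix v :: "real^'n \<Rightarrow> real" and l :: real and y :: "real^'n"
    assume "riesz_solution d c g p v" and l: "l > 0"
      and fin: "(\<integral>\<^sup>+z. ennreal (v z powr (p + 1)) * indicator {z. norm z < l} z \<partial>lborel) < \<infinity>"
      and small: "(\<integral>\<^sup>+z. ennreal (((l / norm z) powr (2 * d - g - p * g) * kelvin g l v z powr (p - 1)) powr (d / (d - g)))
           * indicator {z. l < norm z \<and> v z < kelvin g l v z} z \<partial>lborel) \<le> ennreal \<epsilon>"
      and y: "l < norm y"
    interpret riesz_solution d c g p v by fact
    \<comment> \<open>\<open>E\<close> is the set where the comparison fails, \<open>w\<close> the
      excess on it, and \<open>W\<close> the weight of the linearised equation on it; the aim is to
      show that \<open>w\<close> vanishes almost everywhere.\<close>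
    define E where "E = {z. l < norm z \<and> v z < kelvin g l v z}"
    have [measurable]: "E \<in> sets borel" unfolding E_def by measurable
    define W where "W z = (l / norm z) powr \<tau> * kelvin g l v z powr (p - 1) * indicator E z" for z
    define w where "w z = (kelvin g l v z - v z) * indicator E z" for z
    have [measurable]: "W \<in> borel_measurable borel" "w \<in> borel_measurable borel"
      unfolding W_def w_def by measurable
    have W0: "0 \<le> W z" for z by (simp add: W_def)
    have w0: "0 \<le> w z" for z by (auto simp: w_def E_def indicator_def)
    have ratio: "(l / norm z) powr \<tau> \<le> 1" if "l < norm z" for z
      using that l tau powr_mono2[of \<tau> "l / norm z" 1] by (simp add: divide_simps)
    \<comment> \<open>Since \<open>\<tau>\<close> \<ge> 0, the factor (l/|z|)^\<tau> is at most 1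
      outside the sphere. If the reflected density exceeds v^p, then z lies in \<open>E\<close>, and
      the factor can be put in front of v^p as well before the tangent inequality is
      applied.\<close>
    have excess: "max 0 (reflected l z - v z powr p) \<le> p * (W z * w z)" if z: "l < norm z" for z
    proof (cases "reflected l z \<le> v z powr p")
      case True then show ?thesis using p W0 w0 by simp
    next
      case False
      let ?k = "kelvin g l v z" and ?r = "(l / norm z) powr \<tau>"
      have k: "?k \<ge> 0" by (rule kelvin_nonneg)
      have "v z powr p < ?r * ?k powr p" using False by (simp add: reflected_def)
      also have "\<dots> \<le> 1 * ?k powr p" by (intro mult_right_mono ratio z) simp
      finally have "v z powr p < ?k powr p" by simp
      then have vk: "v z < ?k" using p k v_nonneg[of z] powr_mono2[of p ?k "v z"] by (meson not_less leD less_imp_le)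
      have "reflected l z - v z powr p \<le> ?r * ?k powr p - ?r * v z powr p"
        using mult_right_mono[OF ratio[OF z], of "v z powr p"] by (simp add: reflected_def)
      also have "\<dots> = ?r * (?k powr p - v z powr p)" by (simp add: algebra_simps)
      also have "\<dots> \<le> ?r * (p * ?k powr (p - 1) * (?k - v z))"
        using assms vk v_nonneg by (intro mult_left_mono powr_diff_le_derivative) auto
      also have "\<dots> = p * (W z * w z)"
        using z vk by (simp add: W_def w_def E_def)
      finally show ?thesis using p W0 w0 by simp
    qed
    have pot: "ennreal ((l / norm y) powr g) * V (inversion l y) \<le> V y + ennreal (c * p) * (\<integral>\<^sup>+z. ennreal (W z * w z * norm (y - z) powr - g) \<partial>lborel)"
      if "l < norm y" for y
    proof -
      have "(\<integral>\<^sup>+z. ennreal (max 0 (reflected l z - v z powr p) * norm (y - z) powr - g) * indicator {z. l < norm z} z \<partial>lborel) \<le>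
         (\<integral>\<^sup>+z. ennreal p * ennreal (W z * w z * norm (y - z) powr - g) \<partial>lborel)"
      proof (intro nn_integral_mono)
        fix z
        show "ennreal (max 0 (reflected l z - v z powr p) * norm (y - z) powr - g) * indicator {z. l < norm z} z \<le>
           ennreal p * ennreal (W z * w z * norm (y - z) powr - g)"
        proof (cases "l < norm z")
          case True
          have "max 0 (reflected l z - v z powr p) * norm (y - z) powr - g \<le> p * (W z * w z) * norm (y - z) powr - g"
            by (intro mult_right_mono excess True) simp
          then have "ennreal (max 0 (reflected l z - v z powr p) * norm (y - z) powr - g) \<le> ennreal (p * (W z * w z * norm (y - z) powr - g))"
            by (intro ennreal_leI) (simp add: mult_ac)
          then show ?thesis using p True by (simp add: ennreal_mult')
        qed simp
      qed
      also have "\<dots> = ennreal p * (\<integral>\<^sup>+z. ennreal (W z * w z * norm (y - z) powr - g) \<partial>lborel)"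
        by (rule nn_integral_cmult) measurable
      finally have "ennreal c * (\<integral>\<^sup>+z. ennreal (max 0 (reflected l z - v z powr p) * norm (y - z) powr - g) * indicator {z. l < norm z} z \<partial>lborel)
         \<le> ennreal (c * p) * (\<integral>\<^sup>+z. ennreal (W z * w z * norm (y - z) powr - g) \<partial>lborel)"
        using p c_pos by (simp add: ennreal_mult mult.assoc mult_left_mono)
      then show ?thesis
        by (rule order_trans[OF kelvin_potential_le[OF l that] add_left_mono])
    qed
    \<comment> \<open>The contraction needs finite energy: W w^2 is at most (l/|z|)^\<tau> times the
      (p+1)-st power of the Kelvin transform, and inversion turns the integral of that into the
      integral of v^(p+1) over the ball.\<close>
    have "AE y in lborel. w y = 0"
    proof (rule contr[of W w])
      have "AE y in lborel. y \<noteq> 0 \<longrightarrow> ennreal (v (inversion l y)) = V (inversion l y)"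
        by (rule AE_inversion[OF l v_eq])
      then show "AE y in lborel. ennreal (w y) \<le> ennreal (c * p) * (\<integral>\<^sup>+z. ennreal (W z * w z * norm (y - z) powr - g) \<partial>lborel)"
        using v_eq
      proof eventually_elim
        fix y assume 1: "y \<noteq> 0 \<longrightarrow> ennreal (v (inversion l y)) = V (inversion l y)" and 2: "ennreal (v y) = V y"
        let ?X = "ennreal (c * p) * (\<integral>\<^sup>+z. ennreal (W z * w z * norm (y - z) powr - g) \<partial>lborel)"
        show "ennreal (w y) \<le> ?X"
        proof (cases "y \<in> E")
          case True
          then have ly: "l < norm y" and vk: "v y < kelvin g l v y" by (auto simp: E_def)
          then have "y \<noteq> 0" using l by auto
          then have "ennreal (kelvin g l v y) = ennreal ((l / norm y) powr g) * V (inversion l y)"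
            using 1 by (simp add: kelvin_def ennreal_mult v_nonneg)
          also have "\<dots> \<le> ennreal (v y) + ?X" using pot[OF ly] by (simp add: 2)
          also have "ennreal (kelvin g l v y) = ennreal (v y) + ennreal (w y)"
            using vk True v_nonneg[of y] by (simp add: w_def ennreal_plus[symmetric] del: ennreal_plus)
          finally show ?thesis by (simp add: ennreal_add_left_cancel_le)
        qed (simp add: w_def)
      qed
      have "(\<integral>\<^sup>+z. ennreal (W z * (w z)\<^sup>2) \<partial>lborel) \<le>
        (\<integral>\<^sup>+z. ennreal ((l / norm z) powr (2 * d - g * (p + 1)) * kelvin g l v z powr (p + 1)) * indicator {z. l < norm z} z \<partial>lborel)"
      proof (intro nn_integral_mono)
        fix z
        show "ennreal (W z * (w z)\<^sup>2) \<le> ennreal ((l / norm z) powr (2 * d - g * (p + 1)) * kelvin g l v z powr (p + 1)) * indicator {z. l < norm z} z"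
        proof (cases "z \<in> E")
          case True
          let ?k = "kelvin g l v z"
          have z: "l < norm z" and vk: "v z < ?k" using True by (auto simp: E_def)
          have k: "?k > 0" using vk v_nonneg[of z] by linarith
          have "W z * (w z)\<^sup>2 \<le> (l / norm z) powr \<tau> * ?k powr (p - 1) * ?k\<^sup>2"
            unfolding W_def w_def using True vk v_nonneg[of z] by (simp add: mult_left_mono power_mono)
          also have "\<dots> = (l / norm z) powr \<tau> * (?k powr (p - 1) * ?k powr 2)"
            using k by (simp add: mult.assoc)
          also have "?k powr (p - 1) * ?k powr 2 = ?k powr (p + 1)" by (simp add: powr_add[symmetric] add.commute)
          also have "\<tau> = 2 * d - g * (p + 1)" by (simp add: algebra_simps)
          finally show ?thesis using z by (simp add: ennreal_leI)
        qed (simp add: w_def)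
      qed
      also have "\<dots> < \<infinity>" unfolding kelvin_power_integral[OF l] by (rule fin)
      finally show "(\<integral>\<^sup>+z. ennreal (W z * (w z)\<^sup>2) \<partial>lborel) < \<infinity>" .
      have "(\<integral>\<^sup>+z. ennreal (W z powr q) \<partial>lborel) = (\<integral>\<^sup>+z. ennreal (((l / norm z) powr \<tau> * kelvin g l v z powr (p - 1)) powr (d / (d - g)))
           * indicator {z. l < norm z \<and> v z < kelvin g l v z} z \<partial>lborel)"
        by (intro nn_integral_cong) (auto simp: W_def E_def indicator_def q_def)
      with small show "(\<integral>\<^sup>+z. ennreal (W z powr q) \<partial>lborel) \<le> ennreal \<epsilon>" by simp
    qed (simp_all add: W0 w0)
    then have "(\<integral>\<^sup>+z. ennreal (W z * w z * norm (y - z) powr - g) \<partial>lborel) = (\<integral>\<^sup>+z. 0 \<partial>(lborel :: (real^'n) measure))"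
      by (intro nn_integral_cong_AE) (auto elim!: eventually_mono)
    \<comment> \<open>\<open>pot\<close> holds at every point outside the sphere, so the vanishing
      of \<open>w\<close> almost everywhere gives the comparison of the potentials
      everywhere.\<close>
    with pot[OF y] show "ennreal ((l / norm y) powr g) * V (inversion l y) \<le> V y" by simp
  qed
qed

text \<open>Dropping the restriction to the bad set, inversion moves the smallness condition into
  the ball: with q = (p-1)d/(d-g) the identity \<tau> d/(d-g) = 2d - gq matches the weight of
  \<open>kelvin_power_integral\<close>. The Kelvin transform disappears from the hypotheses.\<close>

lemma kelvin_comparison_small_ball:
  fixes c g p :: real
  defines "d \<equiv> real CARD('n::finite)"
  assumes "c > 0" "g > 0" "g < d" "p \<ge> 1" and tau: "2 * d - g - p * g \<ge> 0"
  obtains \<epsilon> where "\<epsilon> > 0"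
    "\<And>(v :: real^'n \<Rightarrow> real) l y. \<lbrakk>riesz_solution d c g p v; l > 0;
       (\<integral>\<^sup>+z. ennreal (v z powr (p + 1)) * indicator {z. norm z < l} z \<partial>lborel) < \<infinity>;
       (\<integral>\<^sup>+z. ennreal (v z powr ((p - 1) * d / (d - g))) * indicator {z. norm z < l} z \<partial>lborel) \<le> ennreal \<epsilon>;
       l < norm y\<rbrakk> \<Longrightarrow> ennreal ((l / norm y) powr g) * potential c g p v (inversion l y) \<le> potential c g p v y"
proof -
  obtain \<epsilon> where \<epsilon>: "\<epsilon> > 0" and comp: 
    "\<And>(v :: real^'n \<Rightarrow> real) l y. \<lbrakk>riesz_solution d c g p v; l > 0;
       (\<integral>\<^sup>+z. ennreal (v z powr (p + 1)) * indicator {z. norm z < l} z \<partial>lborel) < \<infinity>;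
       (\<integral>\<^sup>+z. ennreal (((l / norm z) powr (2 * d - g - p * g) * kelvin g l v z powr (p - 1)) powr (d / (d - g)))
           * indicator {z. l < norm z \<and> v z < kelvin g l v z} z \<partial>lborel) \<le> ennreal \<epsilon>;
       l < norm y\<rbrakk> \<Longrightarrow> ennreal ((l / norm y) powr g) * potential c g p v (inversion l y) \<le> potential c g p v y"
    using kelvin_comparison[of c g p, where 'n='n] assms by auto
  show thesis
  proof (rule that[OF \<epsilon>])
    fix v :: "real^'n \<Rightarrow> real" and l :: real and y :: "real^'n"
    assume v: "riesz_solution d c g p v" and l: "l > 0"
      and fin: "(\<integral>\<^sup>+z. ennreal (v z powr (p + 1)) * indicator {z. norm z < l} z \<partial>lborel) < \<infinity>"
      and small: "(\<integral>\<^sup>+z. ennreal (v z powr ((p - 1) * d / (d - g))) * indicator {z. norm z < l} z \<partial>lborel) \<le> ennreal \<epsilon>"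
      and y: "l < norm y"
    interpret riesz_solution d c g p v by fact
    let ?q = "(p - 1) * d / (d - g)"
    have "(\<integral>\<^sup>+z. ennreal (((l / norm z) powr (2 * d - g - p * g) * kelvin g l v z powr (p - 1)) powr (d / (d - g)))
           * indicator {z. l < norm z \<and> v z < kelvin g l v z} z \<partial>lborel) \<le>
       (\<integral>\<^sup>+z. ennreal ((l / norm z) powr (2 * d - g * ?q) * kelvin g l v z powr ?q) * indicator {z. l < norm z} z \<partial>lborel)"
    proof (intro nn_integral_mono)
      fix z
      have "(2 * d - g - p * g) * (d / (d - g)) = 2 * d - g * ?q"
        using g_less by (simp add: field_simps)
      then have "((l / norm z) powr (2 * d - g - p * g) * kelvin g l v z powr (p - 1)) powr (d / (d - g)) =
        (l / norm z) powr (2 * d - g * ?q) * kelvin g l v z powr ?q"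
        by (simp add: powr_mult powr_powr)
      then show "ennreal (((l / norm z) powr (2 * d - g - p * g) * kelvin g l v z powr (p - 1)) powr (d / (d - g)))
           * indicator {z. l < norm z \<and> v z < kelvin g l v z} z \<le>
          ennreal ((l / norm z) powr (2 * d - g * ?q) * kelvin g l v z powr ?q) * indicator {z. l < norm z} z"
        by (auto simp: indicator_def)
    qed
    also have "\<dots> \<le> ennreal \<epsilon>" unfolding kelvin_power_integral[OF l] by (rule small)
    finally show "ennreal ((l / norm y) powr g) * V (inversion l y) \<le> V y"
      by (intro comp[OF v l fin _ y])
  qed
qed

section \<open>Regularity\<close>

lemma AE_translate:
  fixes x :: "'a::euclidean_space"
  assumes "AE z in lborel. P z"
  shows "AE z in lborel. P (x + z)"
proof -
  obtain N where N: "N \<in> sets lborel" "emeasure lborel N = 0" "{z. \<not> P z} \<subseteq> N"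
    using assms by (auto elim!: AE_E)
  have [measurable]: "N \<in> sets borel" using N(1) by simp
  have "(\<integral>\<^sup>+z. indicator N (x + z) \<partial>lborel) = (\<integral>\<^sup>+z. indicator N z \<partial>lborel)"
    by (rule nn_integral_lborel_translate) measurable
  also have "\<dots> = 0" using N by simp
  finally have "AE z in lborel. indicator N (x + z) = (0::ennreal)"
    by (subst (asm) nn_integral_0_iff_AE) auto
  then show ?thesis
    by eventually_elim (use N(3) in \<open>auto simp: indicator_def split: if_splits\<close>)
qed

text \<open>Uniform absolute continuity of the integral: F is cut at a height n above which it has
  integral below \<epsilon>/2, and a ball of radius \<delta> contributes at most n times its volume
  to the rest, independently of its centre.\<close>

lemma uniformly_small_on_balls:
  fixes F :: "'a::euclidean_space \<Rightarrow> ennreal"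
  assumes [measurable]: "F \<in> borel_measurable borel" and fin: "(\<integral>\<^sup>+z. F z \<partial>lborel) < \<infinity>" and \<epsilon>: "\<epsilon> > 0"
  obtains \<delta> where "\<delta> > 0"
    "\<And>x. (\<integral>\<^sup>+z. F z * indicator {z. norm (z - x) < \<delta>} z \<partial>lborel) \<le> ennreal \<epsilon>"
proof -
  have "(\<lambda>n. \<integral>\<^sup>+z. F z * indicator {z. F z > of_nat n} z \<partial>lborel) \<longlonglongrightarrow> (\<integral>\<^sup>+z. 0 \<partial>(lborel :: 'a measure))"
  proof (rule nn_integral_dominated_convergence[where w=F])
    have "AE z in lborel. F z \<noteq> \<infinity>" by (rule nn_integral_noteq_infinite) (use fin in auto)
    then show "AE z in lborel. (\<lambda>n. F z * indicator {z. F z > of_nat n} z) \<longlonglongrightarrow> 0"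
    proof eventually_elim
      fix z assume "F z \<noteq> \<infinity>"
      then obtain n0 :: nat where n0: "F z < of_nat n0"
        using ennreal_Ex_less_of_nat[of "F z"] by (auto simp: top.not_eq_extremum)
      have "\<forall>\<^sub>F n in sequentially. F z * indicator {z. F z > of_nat n} z = 0"
      proof (rule eventually_sequentiallyI)
        fix n assume "n0 \<le> n"
        then have "of_nat n0 \<le> (of_nat n :: ennreal)" by simp
        with n0 have "F z < of_nat n" by (rule less_le_trans)
        then show "F z * indicator {z. F z > of_nat n} z = 0" by (simp add: less_le_not_le)
      qed
      then show "(\<lambda>n. F z * indicator {z. F z > of_nat n} z) \<longlonglongrightarrow> 0"
        by (rule tendsto_eventually)
    qed
  qed (use fin in \<open>auto simp: indicator_def\<close>)
  then have "(\<lambda>n. \<integral>\<^sup>+z. F z * indicator {z. F z > of_nat n} z \<partial>lborel) \<longlonglongrightarrow> 0" by simp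
  then have "\<forall>\<^sub>F n in sequentially. (\<integral>\<^sup>+z. F z * indicator {z. F z > of_nat n} z \<partial>lborel) < ennreal (\<epsilon> / 2)"
    by (rule order_tendstoD) (use \<epsilon> in simp)
  then obtain n :: nat where n: "(\<integral>\<^sup>+z. F z * indicator {z. F z > of_nat n} z \<partial>lborel) < ennreal (\<epsilon> / 2)"
    by (auto simp: eventually_sequentially)
  define D where "D = DIM('a)"
  define U where "U = unit_ball_vol (real D)"
  have U: "U > 0" "D > 0" by (auto simp: U_def D_def)
  define \<delta> where "\<delta> = min 1 (\<epsilon> / (2 * (real n + 1) * U))"
  have \<delta>: "\<delta> > 0" "\<delta> \<le> 1" using \<epsilon> U by (auto simp: \<delta>_def)
  have small: "real n * (U * \<delta> ^ D) \<le> \<epsilon> / 2"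
  proof -
    have "\<delta> ^ D \<le> \<delta> ^ 1" using \<delta> U by (intro power_decreasing) auto
    then have "real n * (U * \<delta> ^ D) \<le> (real n + 1) * (U * \<delta>)" using U \<delta> by (intro mult_mono) auto
    also have "\<dots> \<le> (real n + 1) * (U * (\<epsilon> / (2 * (real n + 1) * U)))"
      using U by (intro mult_left_mono) (auto simp: \<delta>_def)
    also have "\<dots> = \<epsilon> / 2"
    proof -
      have N: "N * (U * (\<epsilon> / (2 * N * U))) = \<epsilon> / 2" if "N > 0" for N :: real
        using that U by simp
      show ?thesis by (rule N) simp
    qed
    finally show ?thesis .
  qed
  show thesis
  proof (rule that[OF \<delta>(1)])
    fix x :: 'a
    have ball: "{z. norm (z - x) < \<delta>} = ball x \<delta>" by (auto simp: dist_norm norm_minus_commute)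
    have "(\<integral>\<^sup>+z. F z * indicator {z. norm (z - x) < \<delta>} z \<partial>lborel) \<le>
      (\<integral>\<^sup>+z. F z * indicator {z. F z > of_nat n} z + ennreal (real n) * indicator {z. norm (z - x) < \<delta>} z \<partial>lborel)"
      by (intro nn_integral_mono) (auto simp: indicator_def ennreal_of_nat_eq_real_of_nat)
    also have "\<dots> = (\<integral>\<^sup>+z. F z * indicator {z. F z > of_nat n} z \<partial>lborel) + ennreal (real n) * emeasure lborel (ball x \<delta>)"
    proof -
      have [measurable]: "ball x \<delta> \<in> sets borel" by simp
      show ?thesis unfolding ball
        by (subst nn_integral_add, measurable) (simp add: nn_integral_cmult_indicator)
    qed
    also have "ennreal (real n) * emeasure lborel (ball x \<delta>) = ennreal (real n * (U * \<delta> ^ D))"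
      using \<delta> U by (simp add: emeasure_ball U_def D_def ennreal_mult ennreal_of_nat_eq_real_of_nat)
    also have "(\<integral>\<^sup>+z. F z * indicator {z. F z > of_nat n} z \<partial>lborel) + ennreal (real n * (U * \<delta> ^ D)) \<le> ennreal (\<epsilon> / 2) + ennreal (\<epsilon> / 2)"
      by (intro add_mono less_imp_le[OF n] ennreal_leI small)
    also have "\<dots> = ennreal \<epsilon>" using \<epsilon> by (simp add: ennreal_plus[symmetric] del: ennreal_plus)
    finally show "(\<integral>\<^sup>+z. F z * indicator {z. norm (z - x) < \<delta>} z \<partial>lborel) \<le> ennreal \<epsilon>" .
  qed
qed

lemma powr_le_one_plus_powr:
  fixes x :: real
  assumes "0 \<le> s" "s \<le> q" "0 \<le> x"
  shows "x powr s \<le> 1 + x powr q"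
proof (cases "x \<le> 1")
  case True
  then have "x powr s \<le> 1" using assms powr_mono2[of s x 1] by simp
  then show ?thesis by (simp add: add_increasing2)
next
  case False
  then have "x powr s \<le> x powr q" using assms by (intro powr_mono) auto
  then show ?thesis by simp
qed

context riesz_solution
begin

text \<open>Spheres about other centres are treated by translating the solution, so that inversions
  about the origin suffice.\<close>

lemma translate: "riesz_solution d c g p (\<lambda>z. v (x + z))"
proof
  show "\<not> (AE z in lborel. v (x + z) = 0)"
  proof
    assume "AE z in lborel. v (x + z) = 0"
    from AE_translate[OF this, of "- x"] have "AE z in lborel. v z = 0" by simp
    with v_nontrivial show False by simp
  qed
  show "AE y in lborel. ennreal (v (x + y)) = potential c g p (\<lambda>z. v (x + z)) y"
    using AE_translate[OF v_eq, of x] by (simp add: potential_translate)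
qed (auto simp: d_eq c_pos g_pos g_less[unfolded d_eq] p_pos v_nonneg)

lemma potential_pos: "V y > 0"
proof (rule ccontr)
  assume "\<not> ?thesis"
  then have "(\<integral>\<^sup>+z. ennreal (v z powr p * norm (y - z) powr - g) \<partial>lborel) = 0"
    using c_pos by (simp add: potential_def)
  then have "AE z in lborel. ennreal (v z powr p * norm (y - z) powr - g) = 0"
    by (subst (asm) nn_integral_0_iff_AE) auto
  moreover have "AE z in lborel. z \<noteq> y" by (rule AE_lborel_singleton)
  ultimately have "AE z in lborel. v z = 0"
    by eventually_elim (auto simp: ennreal_eq_0_iff mult_le_0_iff powr_def split: if_splits)
  with v_nontrivial show False by simp
qed

end

text \<open>2d/g is p + 1 for the critical p, and \<open>tau_nonneg\<close> says that p is at most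
  critical. Then 2d/g dominates both powers that the comparison in small balls asks for, p + 1 and
  (p-1)d/(d-g).\<close>

locale regular_riesz_solution = riesz_solution +
  assumes p_ge: "p \<ge> 1" and tau_nonneg: "\<tau> \<ge> 0"
    and v_loc: "\<And>R. (\<integral>\<^sup>+z. ennreal (v z powr (2 * d / g)) * indicator {z. norm z < R} z \<partial>lborel) < \<infinity>"
begin

lemma lower_power_loc:
  assumes "0 \<le> s" "s \<le> 2 * d / g"
  shows "(\<integral>\<^sup>+z. ennreal (v z powr s) * indicator {z. norm z < R} z \<partial>lborel) < \<infinity>"
proof -
  have "(\<integral>\<^sup>+z. ennreal (v z powr s) * indicator {z. norm z < R} z \<partial>lborel) \<le>
    (\<integral>\<^sup>+z. indicator {z. norm z < R} z + ennreal (v z powr (2 * d / g)) * indicator {z. norm z < R} z \<partial>lborel)"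
  proof (intro nn_integral_mono)
    fix z
    have "ennreal (v z powr s) \<le> 1 + ennreal (v z powr (2 * d / g))"
      using ennreal_leI[OF powr_le_one_plus_powr[OF assms v_nonneg, of z]] by simp
    then show "ennreal (v z powr s) * indicator {z. norm z < R} z
        \<le> indicator {z. norm z < R} z + ennreal (v z powr (2 * d / g)) * indicator {z. norm z < R} z"
      by (auto simp: indicator_def)
  qed
  also have "\<dots> = emeasure lborel {z::real^'a. norm z < R} + (\<integral>\<^sup>+z. ennreal (v z powr (2 * d / g)) * indicator {z. norm z < R} z \<partial>lborel)"
    by (subst nn_integral_add) auto
  also have "\<dots> < \<infinity>"
  proof -
    have "bounded {z::real^'a. norm z < R}"
      by (rule bounded_subset[OF bounded_ball[of 0 R]]) auto
    then show ?thesis using v_loc[of R] emeasure_bounded_finite by simp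
  qed
  finally show ?thesis .
qed

lemma exponents: "p + 1 \<le> 2 * d / g" "(p - 1) * d / (d - g) \<le> 2 * d / g" "0 \<le> (p - 1) * d / (d - g)"
proof -
  show "p + 1 \<le> 2 * d / g" using tau_nonneg g_pos by (simp add: field_simps)
  have "(p - 1) * g \<le> 2 * (d - g)" using tau_nonneg by (simp add: algebra_simps)
  then have "(p - 1) * g * d \<le> 2 * (d - g) * d" by (rule mult_right_mono) (simp add: d_eq)
  then show "(p - 1) * d / (d - g) \<le> 2 * d / g"
    using g_pos g_less by (simp add: field_simps)
  show "0 \<le> (p - 1) * d / (d - g)" using p_ge g_less by (simp add: d_eq)
qed

text \<open>Uniform absolute continuity supplies one radius for all centres in a bounded set. The
  radius is kept below 1, so that every ball involved lies in the ball of radius R + 1. No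
  continuity of v is presupposed; the comparison is between values of the potential.\<close>

lemma local_comparison:
  obtains l0 where "l0 > 0" "l0 \<le> 1"
    "\<And>x l y. \<lbrakk>norm x < R; 0 < l; l \<le> l0; l < norm y\<rbrakk> \<Longrightarrow>
       ennreal ((l / norm y) powr g) * V (x + inversion l y) \<le> V (x + y)"
proof -
  obtain \<epsilon> where \<epsilon>: "\<epsilon> > 0" and comp:
    "\<And>(v :: real^'a \<Rightarrow> real) l y. \<lbrakk>riesz_solution d c g p v; l > 0;
       (\<integral>\<^sup>+z. ennreal (v z powr (p + 1)) * indicator {z. norm z < l} z \<partial>lborel) < \<infinity>;
       (\<integral>\<^sup>+z. ennreal (v z powr ((p - 1) * d / (d - g))) * indicator {z. norm z < l} z \<partial>lborel) \<le> ennreal \<epsilon>;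
       l < norm y\<rbrakk> \<Longrightarrow> ennreal ((l / norm y) powr g) * potential c g p v (inversion l y) \<le> potential c g p v y"
    using kelvin_comparison_small_ball[of c g p, where 'n='a] c_pos g_pos g_less p_ge tau_nonneg unfolding d_eq by auto
  let ?s = "(p - 1) * d / (d - g)"
  define F where "F z = ennreal (v z powr ?s) * indicator {z. norm z < R + 1} z" for z
  have [measurable]: "F \<in> borel_measurable borel" unfolding F_def by measurable
  have "(\<integral>\<^sup>+z. F z \<partial>lborel) < \<infinity>" unfolding F_def by (rule lower_power_loc) (use exponents in auto)
  then obtain \<delta> where \<delta>: "\<delta> > 0" "\<And>x. (\<integral>\<^sup>+z. F z * indicator {z. norm (z - x) < \<delta>} z \<partial>lborel) \<le> ennreal \<epsilon>"
    using uniformly_small_on_balls[of F \<epsilon>] \<epsilon> by auto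
  show thesis
  proof (rule that[of "min \<delta> 1"])
    fix x y :: "real^'a" and l :: real assume x: "norm x < R" and l: "0 < l" "l \<le> min \<delta> 1" and y: "l < norm y"
    have shift: "(\<integral>\<^sup>+z. ennreal (v (x + z) powr q) * indicator {z. norm z < l} z \<partial>lborel) =
       (\<integral>\<^sup>+z. ennreal (v z powr q) * indicator {z. norm (z - x) < l} z \<partial>lborel)" for q
      using nn_integral_lborel_translate[of "\<lambda>z. ennreal (v z powr q) * indicator {z. norm (z - x) < l} z" x]
      by (simp add: indicator_def)
    have sub: "norm z < R + 1" if "norm (z - x) < l" for z
      using that x l norm_triangle_sub[of z x] by simp
    have "ennreal ((l / norm y) powr g) * potential c g p (\<lambda>z. v (x + z)) (inversion l y) \<le> potential c g p (\<lambda>z. v (x + z)) y"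
    proof (rule comp[OF translate l(1) _ _ y])
      have "(\<integral>\<^sup>+z. ennreal (v z powr (p + 1)) * indicator {z. norm (z - x) < l} z \<partial>lborel) \<le>
          (\<integral>\<^sup>+z. ennreal (v z powr (p + 1)) * indicator {z. norm z < R + 1} z \<partial>lborel)"
        using sub by (intro nn_integral_mono) (auto simp: indicator_def)
      also have "\<dots> < \<infinity>" using exponents p_pos by (intro lower_power_loc) auto
      finally show "(\<integral>\<^sup>+z. ennreal (v (x + z) powr (p + 1)) * indicator {z. norm z < l} z \<partial>lborel) < \<infinity>"
        unfolding shift .
      have "(\<integral>\<^sup>+z. ennreal (v z powr ?s) * indicator {z. norm (z - x) < l} z \<partial>lborel) \<le> (\<integral>\<^sup>+z. F z * indicator {z. norm (z - x) < \<delta>} z \<partial>lborel)"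
        using sub l by (intro nn_integral_mono) (auto simp: indicator_def F_def)
      also have "\<dots> \<le> ennreal \<epsilon>" by (rule \<delta>)
      finally show "(\<integral>\<^sup>+z. ennreal (v (x + z) powr ?s) * indicator {z. norm z < l} z \<partial>lborel) \<le> ennreal \<epsilon>"
        unfolding shift .
    qed
    then show "ennreal ((l / norm y) powr g) * V (x + inversion l y) \<le> V (x + y)"
      by (simp add: potential_translate)
  qed (use \<delta> in auto)
qed

text \<open>Given two nearby points, a small sphere centred on the line through them, outside the segment,
  exchanges them: the comparison for small spheres is already a Harnack inequality whose constant tends
  to \<open>1\<close>.\<close>

lemma harnack:
  obtains l0 where "l0 > 0"
    "\<And>x y. \<lbrakk>norm x < R; norm y < R; norm (y - x) \<le> l0\<rbrakk> \<Longrightarrow>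
       V x \<le> ennreal ((1 + 2 * norm (y - x) / l0) powr (g / 2)) * V y"
proof -
  obtain l0 where l0: "l0 > 0" "l0 \<le> 1" and comp:
    "\<And>x l y. \<lbrakk>norm x < R + 1; 0 < l; l \<le> l0; l < norm y\<rbrakk> \<Longrightarrow>
       ennreal ((l / norm y) powr g) * V (x + inversion l y) \<le> V (x + y)"
    using local_comparison[of "R + 1"] by auto
  show thesis
  proof (rule that[OF l0(1)])
    fix x y :: "real^'a" assume x: "norm x < R" and "norm y < R" and xy: "norm (y - x) \<le> l0"
    show "V x \<le> ennreal ((1 + 2 * norm (y - x) / l0) powr (g / 2)) * V y"
    proof (cases "x = y")
      case True then show ?thesis by simp
    next
      case False
      define s where "s = norm (y - x)"
      have s: "s > 0" "s \<le> l0" using False xy by (auto simp: s_def)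
      define a where "a = l0 / 2"
      have a: "a > 0" using l0 by (simp add: a_def)
      define e where "e = (1 / s) *\<^sub>R (y - x)"
      have e: "norm e = 1" "y = x + s *\<^sub>R e" using s by (auto simp: e_def s_def)
      \<comment> \<open>The sphere has centre x - a e, seen from which x is at distance a and y at
        distance a + s in the same direction; l^2 = a(a + s) makes the inversion exchange them. With
        a = l0/2 and s \<le> l0 the radius stays below l0.\<close>
      define l where "l = sqrt (a * (a + s))"
      have l2: "l\<^sup>2 = a * (a + s)" using a s by (simp add: l_def)
      have l: "l > 0" using a s by (simp add: l_def)
      have "l\<^sup>2 \<le> l0\<^sup>2"
      proof -
        have "a * (a + s) \<le> a * (2 * l0)" using a s l0 by (intro mult_left_mono) (auto simp: a_def)
        then show ?thesis unfolding l2 by (simp add: a_def power2_eq_square)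
      qed
      then have ll0: "l \<le> l0" by (rule power2_le_imp_le) (use l0 in simp)
      have "l\<^sup>2 < (a + s)\<^sup>2" unfolding l2 unfolding power2_eq_square using a s by (intro mult_strict_right_mono) auto
      then have las: "l < a + s" by (rule power2_less_imp_less) (use a s in simp)
      let ?c = "x - a *\<^sub>R e" and ?w = "(a + s) *\<^sub>R e"
      have nw: "norm ?w = a + s" using a s e(1) by simp
      have "norm ?c < R + 1" using x e(1) a l0 norm_triangle_ineq4[of x "a *\<^sub>R e"] by (simp add: a_def)
      then have "ennreal ((l / norm ?w) powr g) * V (?c + inversion l ?w) \<le> V (?c + ?w)"
        by (rule comp) (use l ll0 las nw in auto)
      moreover have "?c + ?w = y" using e(2) by (simp add: algebra_simps)
      moreover have "inversion l ?w = a *\<^sub>R e"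
        unfolding inversion_def nw l2 using a s by (simp add: power2_eq_square)
      ultimately have 1: "ennreal ((l / (a + s)) powr g) * V x \<le> V y" using nw by simp
      have r: "(l / (a + s)) powr g = (a / (a + s)) powr (g / 2)"
      proof -
        have "l / (a + s) = (l\<^sup>2 / (a + s)\<^sup>2) powr (1 / 2)"
          using l a s by (simp add: powr_half_sqrt real_sqrt_divide)
        also have "l\<^sup>2 / (a + s)\<^sup>2 = a / (a + s)" unfolding l2 using a s by (simp add: power2_eq_square)
        finally show ?thesis by (simp add: powr_powr)
      qed
      have "V x = ennreal (((a + s) / a) powr (g / 2) * (a / (a + s)) powr (g / 2)) * V x"
        using a s by (simp add: powr_mult[symmetric])
      also have "\<dots> = ennreal (((a + s) / a) powr (g / 2)) * (ennreal ((l / (a + s)) powr g) * V x)"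
        by (simp add: r ennreal_mult mult.assoc)
      also have "\<dots> \<le> ennreal (((a + s) / a) powr (g / 2)) * V y"
        by (rule mult_left_mono[OF 1]) simp
      also have "(a + s) / a = 1 + 2 * norm (y - x) / l0" using l0 by (simp add: a_def s_def[symmetric] field_simps)
      finally show ?thesis .
    qed
  qed
qed

text \<open>Arbitrarily close to x there are points where the potential equals the real number v;
  the Harnack inequality carries finiteness from such a point to x.\<close>

lemma potential_finite: "V x < \<infinity>"
proof -
  obtain l0 where l0: "l0 > 0" and H:
    "\<And>x' y. \<lbrakk>norm x' < norm x + 1; norm y < norm x + 1; norm (y - x') \<le> l0\<rbrakk> \<Longrightarrow>
       V x' \<le> ennreal ((1 + 2 * norm (y - x') / l0) powr (g / 2)) * V y"
    using harnack[of "norm x + 1"] by auto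
  let ?r = "min l0 1"
  have "\<exists>y. y \<in> ball x ?r \<and> ennreal (v y) = V y"
  proof (rule ccontr)
    assume "\<nexists>y. y \<in> ball x ?r \<and> ennreal (v y) = V y"
    then have "AE y in lborel. y \<notin> ball x ?r" using v_eq by (auto elim!: eventually_mono)
    then have "emeasure lborel (ball x ?r) = 0"
      by (subst (asm) AE_iff_measurable[of "ball x ?r"]) auto
    moreover have "unit_ball_vol (real CARD('a)) \<noteq> 0"
      by (metis less_irrefl of_nat_0_le_iff unit_ball_vol_pos)
    ultimately show False using l0
      by (auto simp: emeasure_ball ennreal_mult[symmetric] min_def split: if_splits)
  qed
  then obtain y where y: "norm (y - x) < ?r" "ennreal (v y) = V y" by (auto simp: dist_norm norm_minus_commute)
  have "V x \<le> ennreal ((1 + 2 * norm (y - x) / l0) powr (g / 2)) * V y"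
    using y norm_triangle_sub[of y x] by (intro H) auto
  also have "\<dots> < \<infinity>" unfolding y(2)[symmetric] by (simp add: ennreal_mult_less_top)
  finally show ?thesis .
qed

text \<open>The potential is defined at every point and agrees with v almost everywhere, hence it is
  the representative for which the equation holds everywhere.\<close>

definition v_cont :: "real^'a \<Rightarrow> real" where "v_cont x = enn2real (V x)"

lemma v_cont_eq: "ennreal (v_cont x) = V x"
  using potential_finite[of x] by (simp add: v_cont_def)

lemma v_cont_pos: "v_cont x > 0"
  using potential_pos[of x] unfolding v_cont_eq[symmetric] by (simp add: ennreal_less_zero_iff)

lemma v_cont_AE: "AE x in lborel. v x = v_cont x"
  using v_eq
proof eventually_elim
  fix x assume "ennreal (v x) = V x"
  then have "enn2real (ennreal (v x)) = v_cont x" by (simp add: v_cont_def)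
  then show "v x = v_cont x" by (simp add: v_nonneg)
qed

text \<open>The Harnack inequality used in both directions encloses the value at y between v(x)/K(y)
  and K(y) v(x), where K(y) tends to 1 as y approaches x.\<close>

lemma continuous_v_cont: "continuous_on UNIV v_cont"
proof (rule continuous_at_imp_continuous_on, rule ballI)
  fix x :: "real^'a"
  obtain l0 where l0: "l0 > 0" and H:
    "\<And>x' y. \<lbrakk>norm x' < norm x + 1; norm y < norm x + 1; norm (y - x') \<le> l0\<rbrakk> \<Longrightarrow>
       V x' \<le> ennreal ((1 + 2 * norm (y - x') / l0) powr (g / 2)) * V y"
    using harnack[of "norm x + 1"] by auto
  define K where "K y = (1 + 2 * norm (y - x) / l0) powr (g / 2)" for y
  have K0: "K y > 0" for y
  proof -
    have "1 + 2 * norm (y - x) / l0 > 0" using l0 by (intro add_pos_nonneg) auto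
    then show ?thesis by (simp add: K_def)
  qed
  have H': "v_cont x' \<le> (1 + 2 * norm (y - x') / l0) powr (g / 2) * v_cont y"
    if "norm x' < norm x + 1" "norm y < norm x + 1" "norm (y - x') \<le> l0" for x' y
    using H[OF that] v_cont_pos[of y] unfolding v_cont_eq[symmetric]
    by (simp add: ennreal_mult[symmetric] ennreal_le_iff)
  have near: "\<forall>\<^sub>F y in at x. norm (y - x) < min l0 1"
    unfolding eventually_at using l0 by (intro exI[of _ "min l0 1"]) (auto simp: dist_norm)
  have lo: "\<forall>\<^sub>F y in at x. v_cont x / K y \<le> v_cont y"
    using near
  proof eventually_elim
    case (elim y)
    have "v_cont x \<le> K y * v_cont y"
      unfolding K_def using elim norm_triangle_sub[of y x] by (intro H') auto
    then show ?case using K0[of y] by (simp add: field_simps)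
  qed
  have up: "\<forall>\<^sub>F y in at x. v_cont y \<le> K y * v_cont x"
    using near
  proof eventually_elim
    case (elim y)
    have "v_cont y \<le> (1 + 2 * norm (x - y) / l0) powr (g / 2) * v_cont x"
      using elim norm_triangle_sub[of y x] by (intro H') (auto simp: norm_minus_commute)
    then show ?case by (simp add: K_def norm_minus_commute)
  qed
  have "(K \<longlongrightarrow> (1 + 2 * norm (x - x) / l0) powr (g / 2)) (at x)"
    unfolding K_def by (intro tendsto_intros) (use l0 in auto)
  then have K: "(K \<longlongrightarrow> 1) (at x)" by simp
  have "((\<lambda>y. v_cont x / K y) \<longlongrightarrow> v_cont x / 1) (at x)" "((\<lambda>y. K y * v_cont x) \<longlongrightarrow> 1 * v_cont x) (at x)"
    by (rule tendsto_divide[OF tendsto_const K]) (simp, rule tendsto_mult[OF K tendsto_const])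
  then have "(v_cont \<longlongrightarrow> v_cont x) (at x)"
    by (intro tendsto_sandwich[OF lo up]) auto
  then show "isCont v_cont x" by (simp add: isCont_def)
qed

lemma v_cont_potential: "ennreal (v_cont x) = potential c g p v_cont x"
proof -
  have "(\<integral>\<^sup>+z. ennreal (v z powr p * norm (x - z) powr - g) \<partial>lborel) = (\<integral>\<^sup>+z. ennreal (v_cont z powr p * norm (x - z) powr - g) \<partial>lborel)"
    using v_cont_AE by (intro nn_integral_cong_AE) (auto elim!: eventually_mono)
  then show ?thesis unfolding v_cont_eq by (simp add: potential_def)
qed

end

section \<open>Moving spheres\<close>

lemma emeasure_zero_imp_empty:
  fixes U :: "'a::euclidean_space set"
  assumes "open U" "AE z in lborel. z \<notin> U"
  shows "U = {}"
proof (rule ccontr)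
  assume "U \<noteq> {}"
  then obtain x r where r: "r > 0" "ball x r \<subseteq> U"
    using assms(1) by (metis all_not_in_conv openE)
  have "AE z in lborel. z \<notin> ball x r" using assms(2) by eventually_elim (use r in auto)
  then have "emeasure lborel (ball x r) = 0" by (subst (asm) AE_iff_measurable[of "ball x r"]) auto
  moreover have "unit_ball_vol (real DIM('a)) \<noteq> 0"
    by (metis less_irrefl of_nat_0_le_iff unit_ball_vol_pos)
  ultimately show False using r by (simp add: emeasure_ball ennreal_mult[symmetric])
qed

locale continuous_riesz_solution = regular_riesz_solution +
  assumes v_continuous: "continuous_on UNIV v" and v_pos: "v x > 0"
    and v_eq_everywhere: "ennreal (v x) = V x" and p_gt: "p > 1"
begin

lemma translate_continuous: "continuous_riesz_solution d c g p (\<lambda>z. v (x + z))"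
proof -
  interpret T: riesz_solution d c g p "\<lambda>z. v (x + z)" by (rule translate)
  show ?thesis
  proof
    show "(\<integral>\<^sup>+z. ennreal (v (x + z) powr (2 * d / g)) * indicator {z. norm z < R} z \<partial>lborel) < \<infinity>" for R
    proof -
      have "(\<integral>\<^sup>+z. ennreal (v (x + z) powr (2 * d / g)) * indicator {z. norm z < R} z \<partial>lborel) =
         (\<integral>\<^sup>+z. ennreal (v z powr (2 * d / g)) * indicator {z. norm (z - x) < R} z \<partial>lborel)"
        using nn_integral_lborel_translate[of "\<lambda>z. ennreal (v z powr (2 * d / g)) * indicator {z. norm (z - x) < R} z" x]
        by (simp add: indicator_def)
      also have "\<dots> \<le> (\<integral>\<^sup>+z. ennreal (v z powr (2 * d / g)) * indicator {z. norm z < R + norm x} z \<partial>lborel)"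
      proof (intro nn_integral_mono)
        fix z
        have "norm z < R + norm x" if "norm (z - x) < R" using that norm_triangle_sub[of z x] by simp
        then show "ennreal (v z powr (2 * d / g)) * indicator {z. norm (z - x) < R} z \<le>
            ennreal (v z powr (2 * d / g)) * indicator {z. norm z < R + norm x} z"
          by (auto simp: indicator_def)
      qed
      also have "\<dots> < \<infinity>" by (rule v_loc)
      finally show ?thesis .
    qed
    show "continuous_on UNIV (\<lambda>z. v (x + z))"
      by (rule continuous_on_compose2[OF v_continuous]) (auto intro: continuous_intros)
    show "0 \<le> \<tau>" by (rule tau_nonneg)
  qed (simp_all add: p_ge v_pos v_eq_everywhere potential_translate p_gt)
qed

lemma isCont_v: "isCont v x"
  using v_continuous by (simp add: continuous_on_eq_continuous_at)

lemma v_tendsto: "(f \<longlongrightarrow> x) F \<Longrightarrow> ((\<lambda>t. v (f t)) \<longlongrightarrow> v x) F"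
  by (rule isCont_tendsto_compose[OF isCont_v])

lemma kelvin_tendsto:
  assumes "(f \<longlongrightarrow> l) F" "l > 0" "y \<noteq> 0"
  shows "((\<lambda>t. kelvin g (f t) v y) \<longlongrightarrow> kelvin g l v y) F"
  unfolding kelvin_def inversion_def using assms(2,3)
  by (intro tendsto_intros v_tendsto assms(1)) auto

lemma continuous_kelvin: "l > 0 \<Longrightarrow> continuous_on (- {0}) (kelvin g l v)"
  unfolding kelvin_def inversion_def
  by (intro continuous_intros continuous_on_compose2[OF v_continuous]) auto

definition below :: "real \<Rightarrow> bool" where
  "below l \<longleftrightarrow> (\<forall>y. l < norm y \<longrightarrow> kelvin g l v y \<le> v y)"

lemma kelvin_potential: "ennreal ((l / norm y) powr g) * V (inversion l y) = ennreal (kelvin g l v y)"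
  unfolding v_eq_everywhere[symmetric] by (simp add: kelvin_def ennreal_mult v_nonneg)

lemma below_if:
  assumes "\<And>y. l < norm y \<Longrightarrow> ennreal ((l / norm y) powr g) * V (inversion l y) \<le> V y"
  shows "below l"
  unfolding below_def
proof (intro allI impI)
  fix y :: "real^'a" assume "l < norm y"
  from assms[OF this] have "ennreal (kelvin g l v y) \<le> ennreal (v y)"
    unfolding kelvin_potential unfolding v_eq_everywhere[symmetric] .
  then show "kelvin g l v y \<le> v y" by (simp add: v_nonneg)
qed

lemma below_small: obtains l0 where "l0 > 0" "\<And>l. 0 < l \<Longrightarrow> l \<le> l0 \<Longrightarrow> below l"
proof -
  obtain l0 where l0: "l0 > 0" "l0 \<le> 1" and comp: "\<And>x l y. \<lbrakk>norm x < 1; 0 < l; l \<le> l0; l < norm y\<rbrakk> \<Longrightarrow>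
       ennreal ((l / norm y) powr g) * V (x + inversion l y) \<le> V (x + y)"
    by (rule local_comparison[of 1]) (rule that)
  have "below l" if "0 < l" "l \<le> l0" for l
  proof (rule below_if)
    fix y :: "real^'a" assume "l < norm y"
    then show "ennreal ((l / norm y) powr g) * V (inversion l y) \<le> V y"
      using comp[of 0 l y] that by simp
  qed
  with l0(1) show thesis by (rule that)
qed

lemma v_bounded: obtains M where "M > 0" "\<And>z. norm z \<le> L \<Longrightarrow> v z \<le> M"
proof -
  have "compact (v ` cball 0 L)"
    by (rule compact_continuous_image) (auto intro: continuous_on_subset[OF v_continuous])
  then obtain B where "\<forall>x\<in>v ` cball 0 L. norm x \<le> B"
    using compact_imp_bounded bounded_iff by metis
  then have B: "\<bar>v z\<bar> \<le> B" if "norm z \<le> L" for z using that by auto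
  show thesis
    by (rule that[of "max B 1"]) (use B in \<open>auto simp: abs_le_iff le_max_iff_disj\<close>)
qed

text \<open>This is the step that enlarges the sphere. Strict comparison at the radius l means that
  the bad sets for radii slightly above l shrink to nothing pointwise; by dominated convergence the
  weight on them becomes as small as \<open>kelvin_comparison\<close> requires. Nothing has to be
  known about the rate at infinity.\<close>

lemma below_continue:
  assumes l: "l > 0" and strict: "\<And>y. l < norm y \<Longrightarrow> kelvin g l v y < v y"
    and ls: "\<And>n. l < ls n" "ls \<longlonglongrightarrow> l"
  shows "\<exists>n. below (ls n)"
proof -
  let ?q = "d / (d - g)"
  obtain \<epsilon> where \<epsilon>: "\<epsilon> > 0" and comp:
    "\<And>(v :: real^'a \<Rightarrow> real) l y. \<lbrakk>riesz_solution d c g p v; l > 0;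
       (\<integral>\<^sup>+z. ennreal (v z powr (p + 1)) * indicator {z. norm z < l} z \<partial>lborel) < \<infinity>;
       (\<integral>\<^sup>+z. ennreal (((l / norm z) powr (2 * d - g - p * g) * kelvin g l v z powr (p - 1)) powr (d / (d - g)))
           * indicator {z. l < norm z \<and> v z < kelvin g l v z} z \<partial>lborel) \<le> ennreal \<epsilon>;
       l < norm y\<rbrakk> \<Longrightarrow> ennreal ((l / norm y) powr g) * potential c g p v (inversion l y) \<le> potential c g p v y"
    using kelvin_comparison[of c g p, where 'n='a] c_pos g_pos g_less p_ge tau_nonneg unfolding d_eq by auto
  have q: "?q > 0" "(2 * d - 2 * g) * ?q = 2 * d" using g_pos g_less by (auto simp: field_simps)
  obtain L where L: "\<And>n. ls n \<le> L"
    using Bseq_bdd_above[OF convergent_imp_Bseq[OF convergentI[OF ls(2)]]] by (auto simp: bdd_above_def)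
  have L0: "L > 0" using L[of 0] ls(1)[of 0] l by linarith
  obtain M where M: "M > 0" "\<And>z. norm z \<le> L \<Longrightarrow> v z \<le> M" using v_bounded by blast
  define K where "K = (M powr (p - 1)) powr ?q * L powr (2 * d)"
  define f where "f n z = ennreal (((ls n / norm z) powr \<tau> * kelvin g (ls n) v z powr (p - 1)) powr ?q)
           * indicator {z. ls n < norm z \<and> v z < kelvin g (ls n) v z} z" for n z
  have [measurable]: "f n \<in> borel_measurable borel" for n unfolding f_def by measurable
  \<comment> \<open>A point outside the sphere has its image within distance L of the origin, where
    v \<le> M. The powers of L/|z| are \<tau> + g(p-1) = 2d - 2g, which the exponent d/(d-g) turns
    into 2d: an integrable majorant outside the ball of radius l.\<close>
  have dom: "f n z \<le> ennreal K * (ennreal (norm z powr - (2 * d)) * indicator {z. l \<le> norm z} z)" for n z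
  proof (cases "ls n < norm z")
    case True
    have lsn: "ls n > 0" "l < norm z" using ls(1)[of n] l True by linarith+
    have z: "norm z > 0" using lsn l by linarith
    let ?r = "L / norm z"
    have r: "0 \<le> ls n / norm z" "ls n / norm z \<le> ?r" using lsn z L[of n] by (auto simp: divide_right_mono)
    have "(ls n)\<^sup>2 / norm z \<le> ls n * 1"
      unfolding power2_eq_square times_divide_eq_right[symmetric] using lsn True z
      by (intro mult_left_mono) auto
    then have "norm (inversion (ls n) z) \<le> L" using L[of n] by (simp add: norm_inversion)
    then have vM: "v (inversion (ls n) z) \<le> M" by (rule M)
    have "kelvin g (ls n) v z \<le> ?r powr g * M"
      unfolding kelvin_def using vM r g_pos v_nonneg by (intro mult_mono powr_mono2) auto
    then have "(ls n / norm z) powr \<tau> * kelvin g (ls n) v z powr (p - 1) \<le> ?r powr \<tau> * (?r powr g * M) powr (p - 1)"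
      using r tau_nonneg kelvin_nonneg p_gt by (intro mult_mono powr_mono2) auto
    also have "\<dots> = ?r powr (2 * d - 2 * g) * M powr (p - 1)"
      using z L0 M by (simp add: powr_mult powr_powr mult.assoc[symmetric] powr_add[symmetric]) (simp add: algebra_simps)
    finally have "((ls n / norm z) powr \<tau> * kelvin g (ls n) v z powr (p - 1)) powr ?q \<le> (?r powr (2 * d - 2 * g) * M powr (p - 1)) powr ?q"
      using q by (intro powr_mono2) (auto simp: kelvin_nonneg)
    also have "\<dots> = ?r powr (2 * d) * (M powr (p - 1)) powr ?q"
      by (simp only: powr_mult powr_powr[of ?r] q(2))
    also have "\<dots> = K * norm z powr - (2 * d)"
      using z L0 by (simp add: K_def powr_divide powr_minus field_simps)
    finally have "((ls n / norm z) powr \<tau> * kelvin g (ls n) v z powr (p - 1)) powr ?q \<le> K * norm z powr - (2 * d)" .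
    then show ?thesis using lsn by (simp add: f_def K_def ennreal_mult[symmetric] ennreal_leI indicator_def)
  qed (simp add: f_def)
  have "(\<lambda>n. \<integral>\<^sup>+z. f n z \<partial>lborel) \<longlonglongrightarrow> (\<integral>\<^sup>+z. 0 \<partial>(lborel :: (real^'a) measure))"
  proof (rule nn_integral_dominated_convergence[where w="\<lambda>z. ennreal K * (ennreal (norm z powr - (2 * d)) * indicator {z. l \<le> norm z} z)"])
    have "radial_power (2 * d) {y::real^'a. l \<le> norm y} < \<infinity>"
      by (rule radial_power_outside) (use l in \<open>auto simp: d_eq\<close>)
    then show "(\<integral>\<^sup>+z. ennreal K * (ennreal (norm (z::real^'a) powr - (2 * d)) * indicator {z. l \<le> norm z} z) \<partial>lborel) < \<infinity>"
      by (subst nn_integral_cmult) (auto simp: radial_power_def ennreal_mult_less_top)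
    have "(\<lambda>n. f n z) \<longlonglongrightarrow> 0" for z
    proof (cases "l < norm z")
      case True
      then have "z \<noteq> 0" using l by auto
      then have "(\<lambda>n. kelvin g (ls n) v z) \<longlonglongrightarrow> kelvin g l v z" using ls(2) l by (intro kelvin_tendsto)
      then have "\<forall>\<^sub>F n in sequentially. kelvin g (ls n) v z < v z" by (rule order_tendstoD) (rule strict[OF True])
      then have "\<forall>\<^sub>F n in sequentially. f n z = 0" by eventually_elim (simp add: f_def)
      then show ?thesis by (rule tendsto_eventually)
    next
      case False
      then have "f n z = 0" for n using ls(1)[of n] by (simp add: f_def)
      then show ?thesis by simp
    qed
    then show "AE z in lborel. (\<lambda>n. f n z) \<longlonglongrightarrow> 0" by simp
  qed (use dom in auto)
  then have "(\<lambda>n. \<integral>\<^sup>+z. f n z \<partial>lborel) \<longlonglongrightarrow> 0" by simp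
  then have "\<forall>\<^sub>F n in sequentially. (\<integral>\<^sup>+z. f n z \<partial>lborel) < ennreal \<epsilon>"
    by (rule order_tendstoD) (use \<epsilon> in simp)
  then obtain n where n: "(\<integral>\<^sup>+z. f n z \<partial>lborel) < ennreal \<epsilon>" by (auto simp: eventually_sequentially)
  have "below (ls n)"
  proof (rule below_if, rule comp[OF riesz_solution_axioms])
    show "ls n > 0" using ls(1)[of n] l by linarith
    show "(\<integral>\<^sup>+z. ennreal (v z powr (p + 1)) * indicator {z. norm z < ls n} z \<partial>lborel) < \<infinity>"
      using exponents p_pos by (intro lower_power_loc) auto
    show "(\<integral>\<^sup>+z. ennreal (((ls n / norm z) powr \<tau> * kelvin g (ls n) v z powr (p - 1)) powr (d / (d - g)))
           * indicator {z. ls n < norm z \<and> v z < kelvin g (ls n) v z} z \<partial>lborel) \<le> ennreal \<epsilon>"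
      using n unfolding f_def by (rule less_imp_le)
  qed
  then show ?thesis by blast
qed

text \<open>A strong maximum principle. Contact at an exterior point kills the integral in
  \<open>potential_kelvin_diff\<close>; as the kernel difference is strictly positive, v^p equals
  the reflected density almost everywhere outside. That density is (l/|z|)^\<tau> times the p-th
  power of the Kelvin transform, which is at most v^p, so a positive \<tau> would contradict
  equality. With \<tau> = 0 continuity removes the exceptional set.\<close>

lemma touching_sphere:
  assumes l: "l > 0" and B: "below l" and y: "l < norm y" "kelvin g l v y = v y"
  shows "\<tau> = 0" and "\<And>z. z \<noteq> 0 \<Longrightarrow> kelvin g l v z = v z"
proof -
  have ratio: "(l / norm z) powr \<tau> \<le> 1" if "l < norm z" for z :: "real^'a"
    using that l tau_nonneg powr_mono2[of \<tau> "l / norm z" 1] by (simp add: divide_simps)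
  have kv: "kelvin g l v z powr p \<le> v z powr p" if "l < norm z" for z
    using B that p_pos by (intro powr_mono2) (auto simp: below_def kelvin_nonneg)
  have refl: "reflected l z \<le> kelvin g l v z powr p" if "l < norm z" for z
    using mult_right_mono[OF ratio[OF that], of "kelvin g l v z powr p"] by (simp add: reflected_def)
  have le: "reflected l z \<le> v z powr p" if "l < norm z" for z
    using refl[OF that] kv[OF that] by simp
  let ?I = "\<integral>\<^sup>+z. ennreal ((v z powr p - reflected l z) * (norm (y - z) powr - g - out_kernel l y z)) * indicator {z. l < norm z} z \<partial>lborel"
  have "ennreal (v y) = ennreal (kelvin g l v y) + ennreal c * ?I"
    using potential_kelvin_diff[OF l y(1) le] unfolding kelvin_potential v_eq_everywhere .
  then have "ennreal (v y) + 0 = ennreal (v y) + ennreal c * ?I" by (simp only: y(2) add_0_right)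
  then have "ennreal c * ?I = 0" unfolding ennreal_add_left_cancel by simp
  then have "?I = 0" using c_pos by simp
  then have "AE z in lborel. ennreal ((v z powr p - reflected l z) * (norm (y - z) powr - g - out_kernel l y z)) * indicator {z. l < norm z} z = 0"
    by (subst (asm) nn_integral_0_iff_AE) auto
  moreover have "AE z in lborel. z \<noteq> y" by (rule AE_lborel_singleton)
  ultimately have eq: "AE z in lborel. l < norm z \<longrightarrow> v z powr p = reflected l z"
  proof eventually_elim
    fix z assume 0: "ennreal ((v z powr p - reflected l z) * (norm (y - z) powr - g - out_kernel l y z)) * indicator {z. l < norm z} z = 0"
      and "z \<noteq> y"
    show "l < norm z \<longrightarrow> v z powr p = reflected l z"
    proof
      assume z: "l < norm z"
      have "norm (y - z) powr - g - out_kernel l y z > 0" using out_kernel_less[OF l y(1) z] \<open>z \<noteq> y\<close> by auto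
      moreover have "(v z powr p - reflected l z) * (norm (y - z) powr - g - out_kernel l y z) \<le> 0"
        using 0 z by (simp add: ennreal_eq_0_iff)
      ultimately have "v z powr p - reflected l z \<le> 0" by (simp add: mult_le_0_iff)
      with le[OF z] show "v z powr p = reflected l z" by simp
    qed
  qed
  show tau: "\<tau> = 0"
  proof (rule ccontr)
    assume "\<tau> \<noteq> 0"
    then have tau: "\<tau> > 0" using tau_nonneg by simp
    have "v z powr p \<noteq> reflected l z" if z: "l < norm z" for z
    proof -
      have "(l / norm z) powr \<tau> < 1" using z l tau powr_less_mono2[of \<tau> "l / norm z" 1] by (simp add: divide_simps)
      moreover have "kelvin g l v z powr p > 0" using z l v_pos[of "inversion l z"] by (auto simp: kelvin_def)
      ultimately have "reflected l z < kelvin g l v z powr p" by (simp add: reflected_def)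
      with kv[OF z] show ?thesis by simp
    qed
    then have "AE z in lborel. z \<notin> {z::real^'a. l < norm z}" using eq by (auto elim!: eventually_mono)
    then have "{z::real^'a. l < norm z} = {}"
      by (intro emeasure_zero_imp_empty) (auto intro!: open_Collect_less continuous_intros)
    with y show False by auto
  qed
  have out: "kelvin g l v z = v z" if z: "l < norm z" for z
  proof -
    let ?U = "{z \<in> {z. l < norm z}. kelvin g l v z < v z}"
    have "open {z::real^'a. l < norm z}" by (auto intro!: open_Collect_less continuous_intros)
    have "open ?U"
    proof -
      have "continuous_on {z. l < norm z} (\<lambda>z. v z - kelvin g l v z)"
        using l by (intro continuous_intros continuous_on_subset[OF v_continuous] continuous_on_subset[OF continuous_kelvin]) auto
      then have "open ((\<lambda>z. v z - kelvin g l v z) -` {0<..} \<inter> {z. l < norm z})"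
        using \<open>open {z. l < norm z}\<close> by (subst (asm) continuous_on_open_vimage) auto
      also have "(\<lambda>z. v z - kelvin g l v z) -` {0<..} \<inter> {z. l < norm z} = ?U" by auto
      finally show ?thesis .
    qed
    moreover have "AE z in lborel. z \<notin> ?U"
      using eq
    proof eventually_elim
      fix z assume "l < norm z \<longrightarrow> v z powr p = reflected l z"
      then show "z \<notin> ?U"
        using tau p_pos kelvin_nonneg[of l z] powr_less_mono2[of p "kelvin g l v z" "v z"] l
        by (auto simp: reflected_def split: if_splits)
    qed
    ultimately have "?U = {}" by (rule emeasure_zero_imp_empty)
    then show ?thesis using B z unfolding below_def by force
  qed
  fix z :: "real^'a" assume z: "z \<noteq> 0"
  consider "l < norm z" | "l = norm z" | "norm z < l" by linarith
  then show "kelvin g l v z = v z"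
  proof cases
    case 1 then show ?thesis by (rule out)
  next
    case 2
    then show ?thesis using l by (simp add: kelvin_def inversion_def)
  next
    case 3
    \<comment> \<open>Inside the sphere, the identity already proved is used at the image of z;
      inversion is an involution and the two weights are reciprocal.\<close>
    have n: "norm (inversion l z) = l\<^sup>2 / norm z" by (rule norm_inversion)
    also have "\<dots> > l" using 3 z l by (simp add: field_simps power2_eq_square)
    finally have "kelvin g l v (inversion l z) = v (inversion l z)" by (rule out)
    then have "v (inversion l z) = (l / (l\<^sup>2 / norm z)) powr g * v z"
      using l by (simp add: kelvin_def n)
    also have "l / (l\<^sup>2 / norm z) = norm z / l" using l by (simp add: power2_eq_square)
    finally have "kelvin g l v z = ((l / norm z) powr g * (norm z / l) powr g) * v z"
      by (simp add: kelvin_def mult.assoc)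
    also have "(l / norm z) powr g * (norm z / l) powr g = 1"
      using l z by (simp add: powr_mult[symmetric])
    finally show ?thesis by simp
  qed
qed

text \<open>Let l be the infimum of the radii at which the comparison fails. It is positive because
  small spheres succeed, and the comparison survives at l as a limit from below. Without contact the
  comparison at l is strict, so it holds again at some member of any sequence decreasing to l. The
  failing radii need not form an interval, but they do contain such a sequence, which is the
  contradiction.\<close>

lemma moving_spheres_dichotomy:
  "(\<forall>l>0. below l) \<or> (\<tau> = 0 \<and> (\<exists>l>0. \<forall>z. z \<noteq> 0 \<longrightarrow> kelvin g l v z = v z))"
proof (rule disjCI)
  assume "\<not> (\<tau> = 0 \<and> (\<exists>l>0. \<forall>z. z \<noteq> 0 \<longrightarrow> kelvin g l v z = v z))"
  then have no_touch: "kelvin g l v y < v y" if "l > 0" "below l" "l < norm y" for l y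
    using touching_sphere[OF that(1,2)] that unfolding below_def by (metis order_less_le)
  show "\<forall>l>0. below l"
  proof (rule ccontr)
    assume "\<not> (\<forall>l>0. below l)"
    define S where "S = {l. l > 0 \<and> \<not> below l}"
    have S: "S \<noteq> {}" using \<open>\<not> (\<forall>l>0. below l)\<close> by (auto simp: S_def)
    obtain l0 where l0: "l0 > 0" "\<And>l. 0 < l \<Longrightarrow> l \<le> l0 \<Longrightarrow> below l" using below_small by blast
    define l where "l = Inf S"
    have lbS: "l0 \<le> x" if "x \<in> S" for x using that l0(2)[of x] by (force simp: S_def)
    have bdd: "bdd_below S" using lbS by (auto simp: bdd_below_def)
    have l: "l > 0" unfolding l_def using cInf_greatest[OF S, of l0] lbS l0 by fastforce
    have bl: "below s" if "0 < s" "s < l" for s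
      using that cInf_lower[of s S] bdd unfolding l_def by (force simp: S_def)
    have B: "below l"
      unfolding below_def
    proof (intro allI impI)
      fix y :: "real^'a" assume y: "l < norm y"
      have y0: "y \<noteq> 0" using y l by auto
      have "((\<lambda>s. kelvin g s v y) \<longlongrightarrow> kelvin g l v y) (at_left l)"
        by (rule kelvin_tendsto) (use l y0 in \<open>auto intro: tendsto_ident_at\<close>)
      moreover have "\<forall>\<^sub>F s in at_left l. kelvin g s v y \<le> v y"
      proof -
        have "\<forall>\<^sub>F s in at_left l. s \<in> {0<..<l}" using l by (rule eventually_at_left_real)
        then show ?thesis by eventually_elim (use bl y in \<open>auto simp: below_def\<close>)
      qed
      ultimately show "kelvin g l v y \<le> v y" by (intro tendsto_upperbound) auto
    qed
    have "\<exists>s. s \<in> S \<and> l < s \<and> s < l + 1 / real (Suc n)" for n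
    proof -
      obtain s where s: "s \<in> S" "s < l + 1 / real (Suc n)"
        using cInf_lessD[OF S, of "l + 1 / real (Suc n)"] by (auto simp: l_def)
      moreover have "l \<le> s" unfolding l_def by (rule cInf_lower[OF s(1) bdd])
      moreover have "s \<noteq> l" using B s(1) by (auto simp: S_def)
      ultimately show ?thesis by force
    qed
    then obtain ls where ls: "\<And>n. ls n \<in> S \<and> l < ls n \<and> ls n < l + 1 / real (Suc n)" by metis
    have "ls \<longlonglongrightarrow> l"
    proof (rule tendsto_sandwich[of "\<lambda>_. l" _ _ "\<lambda>n. l + 1 / real (Suc n)"])
      have "(\<lambda>n. l + 1 / real (Suc n)) \<longlonglongrightarrow> l + 0" by (intro tendsto_add tendsto_const LIMSEQ_Suc lim_1_over_n)
      then show "(\<lambda>n. l + 1 / real (Suc n)) \<longlonglongrightarrow> l" by simp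
    qed (use ls in \<open>auto intro: always_eventually less_imp_le\<close>)
    then have "\<exists>n. below (ls n)"
      by (intro below_continue[OF l] no_touch[OF l B]) (use ls in auto)
    then show False using ls by (auto simp: S_def)
  qed
qed

end

section \<open>Classification\<close>

text \<open>Inverting about a minimum point \<open>x0\<close> gives \<open>G x \<ge> |x - x0|\<^sup>2\<close>; inverting about an arbitrary
  point turns this into \<open>G (x + h) \<ge> G x + 2 (x - x0) \<bullet> h\<close>, and exchanging the two points shows that
  \<open>G x - |x - x0|\<^sup>2\<close> has zero derivative.\<close>

lemma inversion_functional_equation:
  fixes G :: "'a::euclidean_space \<Rightarrow> real"
  assumes cont: "continuous_on UNIV G" and pos: "\<And>x. G x > 0"
    and eq: "\<And>x y. y \<noteq> 0 \<Longrightarrow> G (x + y) * G x = (norm y)\<^sup>2 * G (x + (G x / (norm y)\<^sup>2) *\<^sub>R y)"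
  obtains x0 m where "m > 0" "\<And>x. G x = (norm (x - x0))\<^sup>2 + m"
proof -
  obtain x0 where min: "\<And>x. G x0 \<le> G x"
  proof -
    have "isCont G 0" using cont by (simp add: continuous_on_eq_continuous_at)
    then have "\<forall>\<^sub>F x in at 0. G x > G 0 / 2"
      by (intro order_tendstoD) (auto simp: isCont_def pos)
    then obtain \<delta> where \<delta>: "\<delta> > 0" "\<And>x. x \<noteq> 0 \<Longrightarrow> norm x < \<delta> \<Longrightarrow> G x > G 0 / 2"
      by (auto simp: eventually_at)
    \<comment> \<open>Beyond \<open>G 0 / \<delta>\<close> the inversion about 0 brings y within
      \<delta> of the origin, where G > G(0)/2, so the equation yields G(y) \<ge> |y|^2/2; beyond
      \<open>G 0 + 2\<close> this exceeds G(0). Hence the minimum is attained in the ball of radius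
      \<open>R\<close>.\<close>
    define R where "R = max (G 0 + 2) (G 0 / \<delta> + 1)"
    have far: "G 0 \<le> G y" if y: "R < norm y" for y
    proof -
      have y2: "norm y > G 0 + 2" "norm y > G 0 / \<delta>" using y by (auto simp: R_def)
      then have y0: "y \<noteq> 0" using pos[of 0] by auto
      have "norm ((G 0 / (norm y)\<^sup>2) *\<^sub>R y) = G 0 / norm y"
        using y0 pos[of 0] by (simp add: power2_eq_square)
      also have "\<dots> < \<delta>" using y2 \<delta>(1) y0 by (simp add: field_simps)
      finally have "G 0 / 2 < G ((G 0 / (norm y)\<^sup>2) *\<^sub>R y)"
        using \<delta>(2) y0 pos[of 0] by (metis divide_eq_0_iff less_numeral_extra(3) norm_eq_zero power2_eq_square mult_eq_0_iff scaleR_eq_0_iff)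
      then have "(norm y)\<^sup>2 * (G 0 / 2) \<le> (norm y)\<^sup>2 * G ((G 0 / (norm y)\<^sup>2) *\<^sub>R y)"
        by (intro mult_left_mono) auto
      then have "(norm y)\<^sup>2 * (G 0 / 2) \<le> G y * G 0"
        using eq[OF y0, of 0] by simp
      then have "(norm y)\<^sup>2 \<le> 2 * G y" using pos[of 0] by simp
      moreover have "(G 0 + 2)\<^sup>2 \<le> (norm y)\<^sup>2" using y2 pos[of 0] by (intro power_mono) auto
      moreover have "2 * G 0 \<le> (G 0 + 2)\<^sup>2" using pos[of 0] by (simp add: power2_sum)
      ultimately show ?thesis by linarith
    qed
    have R0: "R \<ge> 0" using pos[of 0] by (simp add: R_def)
    obtain x0 where x0: "x0 \<in> cball 0 R" "\<And>x. x \<in> cball 0 R \<Longrightarrow> G x0 \<le> G x"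
      using continuous_attains_inf[of "cball 0 R" G] R0 continuous_on_subset[OF cont] by (auto simp: cball_eq_empty)
    have "G x0 \<le> G x" for x
    proof (cases "norm x \<le> R")
      case True then show ?thesis using x0(2) by simp
    next
      case False
      then have "G 0 \<le> G x" by (intro far) simp
      moreover have "G x0 \<le> G 0" using x0(2) R0 by simp
      ultimately show ?thesis by simp
    qed
    then show thesis by (rule that)
  qed
  have ge: "(norm (x - x0))\<^sup>2 \<le> G x" for x
  proof (cases "x = x0")
    case False
    then have y: "x - x0 \<noteq> 0" by simp
    have "(norm (x - x0))\<^sup>2 * G x0 \<le> G x * G x0"
      using eq[OF y, of x0] min by (simp add: mult_left_mono)
    then show ?thesis using pos[of x0] by simp
  qed (use pos in \<open>simp add: less_imp_le\<close>)
  have subgrad: "G x + 2 * ((x - x0) \<bullet> h) \<le> G (x + h)" for x h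
  proof (cases "h = 0")
    case False
    \<comment> \<open>y is the image of h under the inversion about x, so that the equation at y
      speaks of G(x + h). After division by |y|^2 the quadratic lower bound at x + y becomes affine
      in h.\<close>
    define y where "y = (G x / (norm h)\<^sup>2) *\<^sub>R h"
    have y0: "y \<noteq> 0" using False pos[of x] by (simp add: y_def)
    have "norm y = G x / norm h"
      using False pos[of x] by (simp add: y_def power2_eq_square)
    then have ny: "(norm y)\<^sup>2 = (G x)\<^sup>2 / (norm h)\<^sup>2"
      by (simp add: power_divide)
    have "(G x / (norm y)\<^sup>2) *\<^sub>R y = h"
      using False pos[of x] unfolding ny by (simp add: y_def power2_eq_square)
    then have e: "G (x + y) * G x = (norm y)\<^sup>2 * G (x + h)" using eq[OF y0, of x] by simp
    have "(norm y)\<^sup>2 + 2 * ((x - x0) \<bullet> y) \<le> (norm (x - x0 + y))\<^sup>2"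
    proof -
      have "(norm (x - x0 + y))\<^sup>2 = (norm (x - x0))\<^sup>2 + 2 * ((x - x0) \<bullet> y) + (norm y)\<^sup>2"
        by (simp add: power2_norm_eq_inner inner_add_left inner_add_right inner_commute)
      then show ?thesis using zero_le_power2[of "norm (x - x0)"] by linarith
    qed
    also have "\<dots> \<le> G (x + y)" using ge[of "x + y"] by (simp add: algebra_simps)
    finally have "((norm y)\<^sup>2 + 2 * ((x - x0) \<bullet> y)) * G x \<le> (norm y)\<^sup>2 * G (x + h)"
      unfolding e[symmetric] using pos[of x] by (intro mult_right_mono) auto
    also have "((norm y)\<^sup>2 + 2 * ((x - x0) \<bullet> y)) * G x = (norm y)\<^sup>2 * (G x + 2 * ((x - x0) \<bullet> h))"
      unfolding ny using False pos[of x] by (simp add: y_def field_simps power2_eq_square)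
    finally show ?thesis using y0 by simp
  qed simp
  define f where "f x = G x - (norm (x - x0))\<^sup>2" for x
  have lower: "- (norm h)\<^sup>2 \<le> f (x + h) - f x" for x h
    using subgrad[of x h] by (simp add: f_def power2_norm_eq_inner inner_simps inner_commute)
  \<comment> \<open>The lower bound is used from x to y and from y to x. A function whose increments
    are at most the square of the distance has zero derivative, hence is constant.\<close>
  have quad: "\<bar>f y - f x\<bar> \<le> (norm (y - x))\<^sup>2" for x y
    using lower[of "y - x" x] lower[of "x - y" y] by (simp add: norm_minus_commute abs_le_iff)
  have "(f has_derivative (\<lambda>_. 0)) (at x within UNIV)" for x
    unfolding has_derivative_within_alt
  proof (intro conjI allI impI)
    fix e :: real assume "e > 0"
    have "norm (f y - f x - 0) \<le> e * norm (y - x)" if "norm (y - x) < e" for y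
    proof -
      have "norm (f y - f x - 0) \<le> norm (y - x) * norm (y - x)"
        using quad[of y x] by (simp add: power2_eq_square)
      also have "\<dots> \<le> e * norm (y - x)" using that by (intro mult_right_mono) auto
      finally show ?thesis .
    qed
    with \<open>e > 0\<close> show "\<exists>d>0. \<forall>y\<in>UNIV. norm (y - x) < d \<longrightarrow> norm (f y - f x - 0) \<le> e * norm (y - x)" by blast
  qed (rule bounded_linear_zero)
  then have "\<exists>k. \<forall>x\<in>UNIV. f x = k"
    by (intro has_derivative_zero_constant) auto
  then obtain k where k: "\<And>x. f x = k" by auto
  show thesis
  proof (rule that[of k x0])
    show "0 < k" using k[of x0] pos[of x0] by (simp add: f_def)
    show "G x = (norm (x - x0))\<^sup>2 + k" for x using k[of x] by (simp add: f_def)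
  qed
qed

lemma filterlim_norm_diff_at_top:
  "filterlim (\<lambda>w::'a::real_normed_vector. norm (w - x)) at_top at_infinity"
proof (rule filterlim_at_top_mono)
  show "filterlim (\<lambda>w::'a. - norm x + norm w) at_top at_infinity"
    by (rule filterlim_tendsto_add_at_top[OF tendsto_const filterlim_norm_at_top])
  have "- norm x + norm w \<le> norm (w - x)" for w :: 'a
    using norm_triangle_ineq2[of w x] by simp
  then show "\<forall>\<^sub>F w in at_infinity. - norm x + norm w \<le> norm (w - x)"
    by (simp add: always_eventually)
qed

lemma norm_ratio_at_infinity:
  "((\<lambda>w::'a::real_normed_vector. norm w / norm (w - x)) \<longlongrightarrow> 1) at_infinity"
proof -
  have gt: "\<forall>\<^sub>F w::'a in at_infinity. norm (w - x) > 0"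
    using filterlim_norm_diff_at_top[of x, unfolded filterlim_at_top_dense] by blast
  have "((\<lambda>w::'a. (norm w - norm (w - x)) / norm (w - x)) \<longlongrightarrow> 0) at_infinity"
  proof (rule Lim_null_comparison)
    show "((\<lambda>w::'a. norm x / norm (w - x)) \<longlongrightarrow> 0) at_infinity"
      by (intro tendsto_divide_0[OF tendsto_const] filterlim_at_top_imp_at_infinity filterlim_norm_diff_at_top)
    have "\<bar>norm w - norm (w - x)\<bar> \<le> norm x" for w :: 'a
      using norm_triangle_ineq3[of w "w - x"] by simp
    then show "\<forall>\<^sub>F w::'a in at_infinity. norm ((norm w - norm (w - x)) / norm (w - x)) \<le> norm x / norm (w - x)"
      by (intro always_eventually allI) (simp add: divide_right_mono)
  qed
  then have "((\<lambda>w::'a. 1 + (norm w - norm (w - x)) / norm (w - x)) \<longlongrightarrow> 1 + 0) at_infinity"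
    by (intro tendsto_add tendsto_const)
  moreover have "\<forall>\<^sub>F w::'a in at_infinity. 1 + (norm w - norm (w - x)) / norm (w - x) = norm w / norm (w - x)"
    using gt by eventually_elim (simp add: diff_divide_distrib)
  ultimately show ?thesis by (simp add: tendsto_cong)
qed

context continuous_riesz_solution
begin

lemma below_translate:
  "continuous_riesz_solution.below g (\<lambda>z. v (x + z)) l \<longleftrightarrow>
     (\<forall>y. l < norm y \<longrightarrow> (l / norm y) powr g * v (x + inversion l y) \<le> v (x + y))"
  by (simp add: continuous_riesz_solution.below_def[OF translate_continuous] kelvin_def)

lemma dichotomy_at:
  "(\<forall>l>0. \<forall>y. l < norm y \<longrightarrow> (l / norm y) powr g * v (x + inversion l y) \<le> v (x + y)) \<or>
   (\<tau> = 0 \<and> (\<exists>l>0. \<forall>y. y \<noteq> 0 \<longrightarrow> (l / norm y) powr g * v (x + inversion l y) = v (x + y)))"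
  using continuous_riesz_solution.moving_spheres_dichotomy[OF translate_continuous[of x]]
  unfolding below_translate unfolding kelvin_def .

text \<open>Spheres through a pair of points, centred far away on the line joining them, are nearly planes
  exchanging the two points.\<close>

lemma not_all_below:
  "\<not> (\<forall>x. \<forall>l>0. \<forall>y. l < norm y \<longrightarrow> (l / norm y) powr g * v (x + inversion l y) \<le> v (x + y))"
proof
  assume all: "\<forall>x. \<forall>l>0. \<forall>y. l < norm y \<longrightarrow> (l / norm y) powr g * v (x + inversion l y) \<le> v (x + y)"
  have le: "v x \<le> v y" for x y
  proof (cases "x = y")
    case False
    define s where "s = norm (y - x)"
    have s: "s > 0" using False by (simp add: s_def)
    define e where "e = (1 / s) *\<^sub>R (y - x)"
    have e: "norm e = 1" "y = x + s *\<^sub>R e" using s by (auto simp: e_def s_def)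
    have step: "(a / (a + s)) powr (g / 2) * v x \<le> v y" if a: "a > 0" for a
    proof -
      define l where "l = sqrt (a * (a + s))"
      have l2: "l\<^sup>2 = a * (a + s)" using a s by (simp add: l_def)
      have l: "l > 0" using a s by (simp add: l_def)
      have "l\<^sup>2 < (a + s)\<^sup>2" unfolding l2 unfolding power2_eq_square using a s by (intro mult_strict_right_mono) auto
      then have las: "l < a + s" by (rule power2_less_imp_less) (use a s in simp)
      let ?c = "x - a *\<^sub>R e" and ?w = "(a + s) *\<^sub>R e"
      have nw: "norm ?w = a + s" using a s e(1) by simp
      have "(l / norm ?w) powr g * v (?c + inversion l ?w) \<le> v (?c + ?w)"
      proof -
        have "l < norm ?w \<longrightarrow> (l / norm ?w) powr g * v (?c + inversion l ?w) \<le> v (?c + ?w)"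
          using all l by blast
        then show ?thesis using las nw by simp
      qed
      moreover have "?c + ?w = y" unfolding e(2) by (simp add: algebra_simps)
      moreover have "inversion l ?w = a *\<^sub>R e"
        unfolding inversion_def nw l2 using a s by (simp add: power2_eq_square)
      ultimately have 1: "(l / (a + s)) powr g * v x \<le> v y" using nw by simp
      have "l / (a + s) = (l\<^sup>2 / (a + s)\<^sup>2) powr (1 / 2)"
        using l a s by (simp add: powr_half_sqrt real_sqrt_divide)
      also have "l\<^sup>2 / (a + s)\<^sup>2 = a / (a + s)" unfolding l2 using a s by (simp add: power2_eq_square)
      finally show ?thesis using 1 by (simp add: powr_powr)
    qed
    have "((\<lambda>a. (a / (a + s)) powr (g / 2) * v x) \<longlongrightarrow> 1 powr (g / 2) * v x) at_top"
    proof (intro tendsto_mult tendsto_powr tendsto_const)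
      have "((\<lambda>a. 1 - s / (s + a)) \<longlongrightarrow> 1 - 0) at_top"
        by (intro tendsto_diff tendsto_const tendsto_divide_0[OF tendsto_const] filterlim_at_top_imp_at_infinity
            filterlim_tendsto_add_at_top[OF tendsto_const filterlim_ident])
      moreover have "\<forall>\<^sub>F a in at_top. 1 - s / (s + a) = a / (a + s)"
        using eventually_gt_at_top[of 0] by eventually_elim (use s in \<open>simp add: field_simps\<close>)
      ultimately show "((\<lambda>a. a / (a + s)) \<longlongrightarrow> 1) at_top" by (simp add: tendsto_cong)
    qed simp
    moreover have "\<forall>\<^sub>F a in at_top. (a / (a + s)) powr (g / 2) * v x \<le> v y"
      using eventually_gt_at_top[of 0] by eventually_elim (rule step)
    ultimately have "1 powr (g / 2) * v x \<le> v y" by (intro tendsto_upperbound) auto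
    then show ?thesis by simp
  qed simp
  \<comment> \<open>v is now constant, and the potential of a positive constant diverges because g <
    d.\<close>
  define k where "k = v 0"
  have const: "v x = k" for x unfolding k_def by (intro antisym le)
  have k: "k > 0" using v_pos by (simp add: k_def)
  have "(\<integral>\<^sup>+z. ennreal (v z powr p * norm (0 - z) powr - g) \<partial>lborel) = \<infinity>"
    by (rule nn_integral_infinite_if_slow_decay[of 1 "k powr p" g])
       (use g_less k in \<open>auto simp: const d_eq\<close>)
  then have "V 0 = \<infinity>" using c_pos by (simp add: potential_def ennreal_mult_top)
  then show False using v_eq_everywhere[of 0] by (metis ennreal_neq_top infinity_ennreal_def)
qed

text \<open>Inversion about x takes infinity to x, so the leading coefficient of the Kelvin
  transform at infinity is a value of v. This reads off the radius of a sphere of symmetry from the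
  behaviour of v at infinity.\<close>

lemma weighted_kelvin_at_infinity:
  assumes l: "l > 0"
  shows "((\<lambda>w. norm w powr g * ((l / norm (w - x)) powr g * v (x + inversion l (w - x)))) \<longlongrightarrow> l powr g * v x) at_infinity"
proof -
  have "((\<lambda>w. inversion l (w - x)) \<longlongrightarrow> 0) at_infinity"
  proof (rule tendsto_norm_zero_cancel)
    show "((\<lambda>w. norm (inversion l (w - x))) \<longlongrightarrow> 0) at_infinity"
      unfolding norm_inversion
      by (intro tendsto_divide_0[OF tendsto_const] filterlim_at_top_imp_at_infinity filterlim_norm_diff_at_top)
  qed
  then have "((\<lambda>w. x + inversion l (w - x)) \<longlongrightarrow> x + 0) at_infinity" by (intro tendsto_add tendsto_const)
  then have "((\<lambda>w. v (x + inversion l (w - x))) \<longlongrightarrow> v x) at_infinity" using v_tendsto by fastforce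
  then have "((\<lambda>w. (norm w / norm (w - x)) powr g * (l powr g * v (x + inversion l (w - x)))) \<longlongrightarrow> 1 powr g * (l powr g * v x)) at_infinity"
    by (intro tendsto_mult tendsto_powr norm_ratio_at_infinity tendsto_const) auto
  moreover have "\<forall>\<^sub>F w in at_infinity. (norm w / norm (w - x)) powr g * (l powr g * v (x + inversion l (w - x))) =
     norm w powr g * ((l / norm (w - x)) powr g * v (x + inversion l (w - x)))"
    by (intro always_eventually allI) (use l in \<open>simp add: powr_divide\<close>)
  ultimately show ?thesis by (simp add: tendsto_cong)
qed

lemma at_infinity_nontrivial: "(at_infinity :: (real^'a) filter) \<noteq> bot"
  by (rule trivial_limit_at_infinity)

text \<open>One centre x1 has a sphere of symmetry, since otherwise every centre would allow all
  spheres. That symmetry gives |w|^g v(w) a finite limit at infinity. At a centre where all spheres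
  are allowed the same quantity would have to exceed l^g v(x) for every l.\<close>

lemma kelvin_symmetric_at:
  shows "\<tau> = 0" and "\<exists>l>0. \<forall>y. y \<noteq> 0 \<longrightarrow> (l / norm y) powr g * v (x + inversion l y) = v (x + y)"
proof -
  obtain x1 where "\<not> (\<forall>l>0. \<forall>y. l < norm y \<longrightarrow> (l / norm y) powr g * v (x1 + inversion l y) \<le> v (x1 + y))"
    using not_all_below by blast
  then obtain l1 where tau: "\<tau> = 0" and l1: "l1 > 0" "\<And>y. y \<noteq> 0 \<Longrightarrow> (l1 / norm y) powr g * v (x1 + inversion l1 y) = v (x1 + y)"
    using dichotomy_at[of x1] by blast
  show "\<tau> = 0" by (rule tau)
  have lim1: "((\<lambda>w. norm w powr g * v w) \<longlongrightarrow> l1 powr g * v x1) at_infinity"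
  proof -
    have "\<forall>\<^sub>F w::real^'a in at_infinity. norm w > norm x1" unfolding eventually_at_infinity by (rule exI[of _ "norm x1 + 1"]) auto
    then have "\<forall>\<^sub>F w in at_infinity. norm w powr g * ((l1 / norm (w - x1)) powr g * v (x1 + inversion l1 (w - x1))) = norm w powr g * v w"
    proof eventually_elim
      fix w :: "real^'a" assume "norm x1 < norm w"
      then have "w - x1 \<noteq> 0" by auto
      from l1(2)[OF this] show "norm w powr g * ((l1 / norm (w - x1)) powr g * v (x1 + inversion l1 (w - x1))) = norm w powr g * v w" by simp
    qed
    with weighted_kelvin_at_infinity[OF l1(1), of x1] show ?thesis by (rule Lim_transform_eventually)
  qed
  show "\<exists>l>0. \<forall>y. y \<noteq> 0 \<longrightarrow> (l / norm y) powr g * v (x + inversion l y) = v (x + y)"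
  proof (rule ccontr)
    assume "\<not> ?thesis"
    then have below: "\<And>l y. l > 0 \<Longrightarrow> l < norm y \<Longrightarrow> (l / norm y) powr g * v (x + inversion l y) \<le> v (x + y)"
      using dichotomy_at[of x] by blast
    \<comment> \<open>Both sides are limits at infinity, of the Kelvin transform about x and of v,
      weighted by |w|^g; the comparison holds as soon as w lies outside the sphere.\<close>
    have bound: "l powr g * v x \<le> l1 powr g * v x1" if l: "l > 0" for l
    proof (rule tendsto_le[OF at_infinity_nontrivial lim1 weighted_kelvin_at_infinity[OF l, of x]])
      have "\<forall>\<^sub>F w::real^'a in at_infinity. norm w > norm x + l" unfolding eventually_at_infinity by (rule exI[of _ "norm x + l + 1"]) auto
      then show "\<forall>\<^sub>F w in at_infinity. norm w powr g * ((l / norm (w - x)) powr g * v (x + inversion l (w - x))) \<le> norm w powr g * v w"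
      proof eventually_elim
        fix w :: "real^'a" assume "norm x + l < norm w"
        then have "l < norm (w - x)" using norm_triangle_ineq2[of w x] by linarith
        from below[OF l this] show "norm w powr g * ((l / norm (w - x)) powr g * v (x + inversion l (w - x))) \<le> norm w powr g * v w"
          by (simp add: mult_left_mono)
      qed
    qed
    define K where "K = l1 powr g * v x1 / v x"
    have K: "K > 0" using l1 v_pos by (simp add: K_def)
    have "(K + 1) * v x \<le> l1 powr g * v x1"
      using bound[of "(K + 1) powr (1 / g)"] K g_pos by (simp add: powr_powr)
    also have "l1 powr g * v x1 = K * v x" using v_pos[of x] by (simp add: K_def)
    finally show False using v_pos[of x] by (simp add: distrib_right)
  qed
qed

text \<open>L(x)^g v(x) is the limit of |w|^g v(w) at infinity and so does not depend on the centre
  x. Therefore v is a constant times L^-g, and the symmetry of v becomes an equation for G = L^2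
  alone, which determines G.\<close>

lemma bubble_form:
  obtains \<zeta> t B where "t > 0" "B > 0" "\<And>x. v x = B * (t / (t\<^sup>2 + (norm (x - \<zeta>))\<^sup>2)) powr (g / 2)"
proof -
  obtain L where L: "\<And>x. L x > 0" "\<And>x y. y \<noteq> 0 \<Longrightarrow> (L x / norm y) powr g * v (x + inversion (L x) y) = v (x + y)"
    using kelvin_symmetric_at(2) by metis
  have lim: "((\<lambda>w. norm w powr g * v w) \<longlongrightarrow> L x powr g * v x) at_infinity" for x
  proof -
    have "\<forall>\<^sub>F w::real^'a in at_infinity. norm w > norm x" unfolding eventually_at_infinity by (rule exI[of _ "norm x + 1"]) auto
    then have "\<forall>\<^sub>F w in at_infinity. norm w powr g * ((L x / norm (w - x)) powr g * v (x + inversion (L x) (w - x))) = norm w powr g * v w"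
    proof eventually_elim
      fix w :: "real^'a" assume "norm x < norm w"
      then have "w - x \<noteq> 0" by auto
      from L(2)[OF this, of x] show "norm w powr g * ((L x / norm (w - x)) powr g * v (x + inversion (L x) (w - x))) = norm w powr g * v w" by simp
    qed
    with weighted_kelvin_at_infinity[OF L(1), of x x] show ?thesis by (rule Lim_transform_eventually)
  qed
  define A where "A = L 0 powr g * v 0"
  have A: "A > 0" unfolding A_def using L(1)[of 0] v_pos[of 0] by (intro mult_pos_pos) auto
  have LA: "L x powr g * v x = A" for x
    unfolding A_def by (rule tendsto_unique[OF at_infinity_nontrivial lim lim])
  have vL: "v x = A * (L x) powr - g" for x
    using LA[of x] L(1)[of x] by (simp add: powr_minus field_simps)
  have L_eq: "L x = (A / v x) powr (1 / g)" for x
  proof -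
    have "A / v x = L x powr g" unfolding LA[of x, symmetric] using v_pos[of x] by simp
    then show ?thesis using L(1)[of x] g_pos by (simp add: powr_powr)
  qed
  define G where "G x = (L x)\<^sup>2" for x
  obtain x0 m where m: "m > 0" and G: "\<And>x. G x = (norm (x - x0))\<^sup>2 + m"
  proof (rule inversion_functional_equation[of G])
    show "continuous_on UNIV G"
      unfolding G_def L_eq using v_pos A by (intro continuous_intros v_continuous) (auto simp: less_imp_neq[symmetric])
    show "G x > 0" for x using L(1)[of x] by (simp add: G_def)
    fix x y :: "real^'a" assume y: "y \<noteq> 0"
    let ?w = "x + inversion (L x) y"
    have "(L x / norm y) powr g * (A * L ?w powr - g) = A * L (x + y) powr - g"
      using L(2)[OF y, of x] unfolding vL .
    then have "(L x / norm y) powr g * L ?w powr - g = L (x + y) powr - g" using A by simp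
    then have "((L x / norm y) powr g * L ?w powr - g) powr (- 1 / g) = (L (x + y) powr - g) powr (- 1 / g)" by simp
    then have "(L x / norm y) powr - 1 * L ?w = L (x + y)"
      using g_pos y abs_of_pos[OF L(1)] by (simp add: powr_mult powr_powr)
    then have "norm y * L ?w = L (x + y) * L x"
      using L(1)[of x] y by (simp add: powr_minus field_simps)
    then have "(norm y * L ?w)\<^sup>2 = (L (x + y) * L x)\<^sup>2" by simp
    then show "G (x + y) * G x = (norm y)\<^sup>2 * G (x + (G x / (norm y)\<^sup>2) *\<^sub>R y)"
      by (simp add: G_def power_mult_distrib inversion_def)
  qed (rule that)
  \<comment> \<open>The scale of the bubble is t = \<open>sqrt m\<close>; the power of
    \<open>sqrt m\<close> in front compensates for the t in the numerator.\<close>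
  have "v x = A * sqrt m powr - (g / 2) * (sqrt m / ((sqrt m)\<^sup>2 + (norm (x - x0))\<^sup>2)) powr (g / 2)" for x
  proof -
    have "L x = G x powr (1 / 2)" using L(1)[of x] by (simp add: G_def powr_half_sqrt)
    then have "v x = A * G x powr - (g / 2)" by (simp add: vL powr_powr)
    also have "G x = (sqrt m)\<^sup>2 + (norm (x - x0))\<^sup>2" using m by (simp add: G)
    finally show ?thesis using m by (simp add: powr_divide powr_minus field_simps)
  qed
  moreover have "A * sqrt m powr - (g / 2) > 0" using A m by simp
  ultimately show thesis using m by (intro that[of "sqrt m"]) auto
qed

text \<open>Evaluating the equation at the centre determines the amplitude.\<close>

lemma bubble_amplitude:
  assumes t: "t > 0" and B: "B > 0" and form: "\<And>x. v x = B * (t / (t\<^sup>2 + (norm (x - \<zeta>))\<^sup>2)) powr (g / 2)"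
  shows "ennreal B = ennreal (c * B powr p) *
    (\<integral>\<^sup>+z. ennreal ((1 / (1 + (norm (z::real^'a))\<^sup>2)) powr (d - g / 2) * norm z powr - g) \<partial>lborel)"
proof -
  have tau: "p * g = 2 * d - g" using kelvin_symmetric_at(1) by simp
  define J where "J z = (1 / (1 + (norm z)\<^sup>2)) powr (d - g / 2) * norm z powr - g" for z :: "real^'a"
  have [measurable]: "J \<in> borel_measurable borel" unfolding J_def by measurable
  have vp: "v (\<zeta> + t *\<^sub>R z) powr p * norm (\<zeta> - (\<zeta> + t *\<^sub>R z)) powr - g = B powr p * t powr (- d - g / 2) * J z" for z
  proof -
    have "t\<^sup>2 + (norm (t *\<^sub>R z))\<^sup>2 = t * (t * (1 + (norm z)\<^sup>2))"
      by (simp add: power_mult_distrib algebra_simps power2_eq_square)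
    then have "t / (t\<^sup>2 + (norm (\<zeta> + t *\<^sub>R z - \<zeta>))\<^sup>2) = (1 / t) * (1 / (1 + (norm z)\<^sup>2))"
      using t by simp
    then have "v (\<zeta> + t *\<^sub>R z) = B * ((1 / t) * (1 / (1 + (norm z)\<^sup>2))) powr (g / 2)" unfolding form by simp
    then have "v (\<zeta> + t *\<^sub>R z) powr p = B powr p * ((1 / t) * (1 / (1 + (norm z)\<^sup>2))) powr (p * g / 2)"
      using B by (simp add: powr_mult powr_powr mult.commute)
    also have "p * g / 2 = d - g / 2" using tau by simp
    also have "((1 / t) * (1 / (1 + (norm z)\<^sup>2))) powr (d - g / 2) = t powr - (d - g / 2) * (1 / (1 + (norm z)\<^sup>2)) powr (d - g / 2)"
    proof -
      have "(1 / t) powr (d - g / 2) = t powr - (d - g / 2)" using t by (simp only: powr_minus_divide powr_divide powr_one_eq_one)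
      then show ?thesis by (simp only: powr_mult)
    qed
    finally have 1: "v (\<zeta> + t *\<^sub>R z) powr p = B powr p * (t powr - (d - g / 2) * (1 / (1 + (norm z)\<^sup>2)) powr (d - g / 2))" .
    have 2: "norm (\<zeta> - (\<zeta> + t *\<^sub>R z)) powr - g = t powr - g * norm z powr - g"
      using t by (simp add: powr_mult)
    have 3: "t powr - (d - g / 2) * t powr - g = t powr (- d - g / 2)"
    proof -
      have "- (d - g / 2) + - g = - d - g / 2" by simp
      then show ?thesis by (simp only: powr_add[symmetric])
    qed
    show ?thesis unfolding 1 2 J_def by (simp add: 3[symmetric] mult_ac)
  qed
  have "ennreal (v \<zeta>) = ennreal c * (\<integral>\<^sup>+z. ennreal (v z powr p * norm (\<zeta> - z) powr - g) \<partial>lborel)"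
    using v_eq_everywhere[of \<zeta>] by (simp add: potential_def)
  also have "(\<integral>\<^sup>+z. ennreal (v z powr p * norm (\<zeta> - z) powr - g) \<partial>lborel) =
     ennreal (t ^ CARD('a)) * (\<integral>\<^sup>+z. ennreal (v (\<zeta> + t *\<^sub>R z) powr p * norm (\<zeta> - (\<zeta> + t *\<^sub>R z)) powr - g) \<partial>lborel)"
    using nn_integral_lborel_affine[of "\<lambda>z. ennreal (v z powr p * norm (\<zeta> - z) powr - g)" t \<zeta>] t by simp
  also have "(\<integral>\<^sup>+z. ennreal (v (\<zeta> + t *\<^sub>R z) powr p * norm (\<zeta> - (\<zeta> + t *\<^sub>R z)) powr - g) \<partial>lborel) =
     ennreal (B powr p * t powr (- d - g / 2)) * (\<integral>\<^sup>+z. ennreal (J z) \<partial>lborel)"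
    unfolding vp by (subst nn_integral_cmult[symmetric], simp) (intro nn_integral_cong ennreal_mult', simp)
  also have "v \<zeta> = B * t powr - (g / 2)"
    using t by (simp add: form powr_divide powr_minus power2_eq_square field_simps)
  finally have "ennreal (B * t powr - (g / 2)) = ennreal c * (ennreal (t ^ CARD('a)) * (ennreal (B powr p * t powr (- d - g / 2)) * (\<integral>\<^sup>+z. ennreal (J z) \<partial>lborel)))" .
  also have "\<dots> = ennreal (c * B powr p * t powr - (g / 2)) * (\<integral>\<^sup>+z. ennreal (J z) \<partial>lborel)"
  proof -
    \<comment> \<open>The volume factor leaves the same power of t as on the other side of the
      equation, so the amplitude does not depend on the scale.\<close>
    have "t ^ CARD('a) * t powr (- d - g / 2) = t powr - (g / 2)"
      using t by (simp add: powr_realpow[symmetric] powr_add[symmetric] d_eq)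
    then have e: "c * B powr p * t powr - (g / 2) = c * (t ^ CARD('a) * (B powr p * t powr (- d - g / 2)))"
      by (simp only: mult_ac)
    define K where "K = B powr p * t powr (- d - g / 2)"
    have "K \<ge> 0" by (simp add: K_def)
    then show ?thesis using c_pos t unfolding e K_def[symmetric] by (simp add: ennreal_mult mult.assoc)
  qed
  finally have eq: "ennreal (B * t powr - (g / 2)) = ennreal (c * B powr p * t powr - (g / 2)) * (\<integral>\<^sup>+z. ennreal (J z) \<partial>lborel)" .
  define T where "T = t powr - (g / 2)"
  have T: "T > 0" using t by (simp add: T_def)
  have "ennreal B = ennreal (1 / T) * ennreal (B * T)"
    using B T by (simp add: ennreal_mult[symmetric])
  also have "\<dots> = ennreal (1 / T) * (ennreal (c * B powr p * T) * (\<integral>\<^sup>+z. ennreal (J z) \<partial>lborel))"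
    unfolding T_def eq ..
  also have "\<dots> = ennreal (c * B powr p) * (\<integral>\<^sup>+z. ennreal (J z) \<partial>lborel)"
    using T c_pos by (simp add: mult.assoc[symmetric] ennreal_mult[symmetric])
  finally show ?thesis by (simp only: J_def)
qed

end

lemma (in regular_riesz_solution) continuous_representative:
  assumes "p > 1"
  shows "continuous_riesz_solution d c g p v_cont"
proof
  show "\<not> (AE z in lborel. v_cont z = 0)"
  proof
    assume "AE z in lborel. v_cont z = 0"
    with v_cont_AE have "AE z in lborel. v z = 0" by eventually_elim simp
    with v_nontrivial show False by simp
  qed
  show "v_cont \<in> borel_measurable borel"
    by (rule borel_measurable_continuous_onI[OF continuous_v_cont])
  show "(\<integral>\<^sup>+z. ennreal (v_cont z powr (2 * d / g)) * indicator {z. norm z < R} z \<partial>lborel) < \<infinity>" for R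
  proof -
    have "(\<integral>\<^sup>+z. ennreal (v_cont z powr (2 * d / g)) * indicator {z. norm z < R} z \<partial>lborel) =
      (\<integral>\<^sup>+z. ennreal (v z powr (2 * d / g)) * indicator {z. norm z < R} z \<partial>lborel)"
      using v_cont_AE by (intro nn_integral_cong_AE) (auto elim!: eventually_mono)
    with v_loc[of R] show ?thesis by simp
  qed
  show "AE y in lborel. ennreal (v_cont y) = potential c g p v_cont y"
    by (simp add: v_cont_potential)
  show "0 \<le> \<tau>" by (rule tau_nonneg)
  show "d = real CARD('a)" by (rule d_eq)
qed (use assms c_pos g_pos g_less p_ge v_cont_pos v_cont_potential continuous_v_cont less_imp_le[OF v_cont_pos] in auto)

text \<open>To be read with \<open>tau_nonneg\<close>: strictly below the critical exponent \<tau>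
  would be positive, which the sphere of symmetry excludes.\<close>

lemma (in regular_riesz_solution) no_subcritical_solution:
  assumes "p > 1" shows "\<tau> = 0"
  by (rule continuous_riesz_solution.kelvin_symmetric_at(1)[OF continuous_representative[OF assms]])

lemma (in regular_riesz_solution) critical_solution:
  assumes "p > 1"
  obtains \<zeta> t B where "t > 0" "B > 0"
    "AE x in lborel. v x = B * (t / (t\<^sup>2 + (norm (x - \<zeta>))\<^sup>2)) powr (g / 2)"
    "ennreal B = ennreal (c * B powr p) *
      (\<integral>\<^sup>+z. ennreal ((1 / (1 + (norm (z::real^'a))\<^sup>2)) powr (d - g / 2) * norm z powr - g) \<partial>lborel)"
proof -
  interpret C: continuous_riesz_solution d c g p v_cont by (rule continuous_representative[OF assms])
  obtain \<zeta> t B where *: "t > 0" "B > 0" "\<And>x. v_cont x = B * (t / (t\<^sup>2 + (norm (x - \<zeta>))\<^sup>2)) powr (g / 2)"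
    by (rule C.bubble_form) (rule that)
  show thesis
  proof (rule that[OF *(1,2) _ C.bubble_amplitude[OF *]])
    show "AE x in lborel. v x = B * (t / (t\<^sup>2 + (norm (x - \<zeta>))\<^sup>2)) powr (g / 2)"
      using v_cont_AE by eventually_elim (simp add: *(3))
  qed
qed

section \<open>Nonexistence for small exponents\<close>

lemma powr_exceeds:
  fixes e C R1 :: real
  assumes "e > 0"
  obtains R where "R \<ge> R1" "R > 0" "R powr e > C"
proof (rule that[of "max (max R1 1) ((\<bar>C\<bar> + 1) powr (1 / e))"])
  let ?R = "max (max R1 1) ((\<bar>C\<bar> + 1) powr (1 / e))"
  have "C < ((\<bar>C\<bar> + 1) powr (1 / e)) powr e" using assms by (simp add: powr_powr)
  also have "\<dots> \<le> ?R powr e" using assms by (intro powr_mono2) auto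
  finally show "?R powr e > C" .
qed auto

context riesz_solution
begin

definition mass :: "real \<Rightarrow> ennreal" where
  "mass R = (\<integral>\<^sup>+z. ennreal (v z powr p) * indicator {z. norm z < R} z \<partial>lborel)"

lemma mass_mono: "R \<le> S \<Longrightarrow> mass R \<le> mass S"
  unfolding mass_def by (intro nn_integral_mono) (auto simp: indicator_def)

lemma potential_ge_mass:
  assumes "norm x \<le> S" "R \<le> S" "S > 0"
  shows "ennreal (c * (2 * S) powr - g) * mass R \<le> V x"
proof -
  have "ennreal ((2 * S) powr - g) * mass R = (\<integral>\<^sup>+z. ennreal ((2 * S) powr - g) * (ennreal (v z powr p) * indicator {z. norm z < R} z) \<partial>lborel)"
    unfolding mass_def by (rule nn_integral_cmult[symmetric]) measurable
  also have "\<dots> \<le> (\<integral>\<^sup>+z. ennreal (v z powr p * norm (x - z) powr - g) \<partial>lborel)"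
  proof (rule nn_integral_mono_AE)
    have "AE z in lborel. z \<noteq> x" by (rule AE_lborel_singleton)
    then show "AE z in lborel. ennreal ((2 * S) powr - g) * (ennreal (v z powr p) * indicator {z. norm z < R} z) \<le> ennreal (v z powr p * norm (x - z) powr - g)"
    proof eventually_elim
      fix z assume "z \<noteq> x"
      have "(2 * S) powr - g \<le> norm (x - z) powr - g" if "norm z < R"
        using that assms norm_triangle_ineq4[of x z] g_pos \<open>z \<noteq> x\<close> by (intro powr_mono2') auto
      then show "ennreal ((2 * S) powr - g) * (ennreal (v z powr p) * indicator {z. norm z < R} z) \<le> ennreal (v z powr p * norm (x - z) powr - g)"
        by (auto simp: indicator_def ennreal_mult[symmetric] mult.commute intro!: ennreal_leI mult_left_mono)
    qed
  qed
  finally show ?thesis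
    unfolding potential_def using c_pos by (simp add: ennreal_mult mult.assoc mult_left_mono)
qed

lemma ex_finite_potential: obtains x where "V x < \<infinity>"
proof -
  have "\<exists>x. ennreal (v x) = V x"
  proof (rule ccontr)
    assume "\<not> ?thesis"
    then have "AE x in lborel. x \<notin> (UNIV :: (real^'n) set)" using v_eq by (auto elim!: eventually_mono)
    then have "(UNIV :: (real^'n) set) = {}" by (rule emeasure_zero_imp_empty[OF open_UNIV])
    then show False by simp
  qed
  then show thesis using that by (metis ennreal_less_top infinity_ennreal_def)
qed

text \<open>The potential is finite at some x, and for large R the whole ball of radius R is within
  2R of x. The bound makes all masses finite, and for p < 1 it provides the growth rate to be
  contradicted.\<close>

lemma mass_bound:
  obtains K R1 where "K > 0" "R1 > 0" "\<And>R. R \<ge> R1 \<Longrightarrow> mass R \<le> ennreal (K * R powr g)"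
proof -
  obtain x where x: "V x < \<infinity>" by (rule ex_finite_potential)
  obtain w where w: "V x = ennreal w" "w \<ge> 0" using x by (cases "V x") auto
  show thesis
  proof (rule that[of "(w + 1) * 2 powr g / c" "norm x + 1"])
    fix R assume R: "R \<ge> norm x + 1"
    then have R0: "R > 0" using norm_ge_zero[of x] by linarith
    have "ennreal (c * (2 * R) powr - g) * mass R \<le> ennreal w"
      using potential_ge_mass[of x R R] R R0 unfolding w(1) by simp
    then have "ennreal ((2 * R) powr g / c) * (ennreal (c * (2 * R) powr - g) * mass R) \<le> ennreal ((2 * R) powr g / c) * ennreal w"
      by (rule mult_left_mono) simp
    also have "ennreal ((2 * R) powr g / c) * (ennreal (c * (2 * R) powr - g) * mass R) = mass R"
      using c_pos R0 by (simp add: mult.assoc[symmetric] ennreal_mult[symmetric] powr_minus)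
    also have "ennreal ((2 * R) powr g / c) * ennreal w = ennreal ((2 * R) powr g / c * w)"
      by (rule ennreal_mult[symmetric]) (use c_pos w in auto)
    also have "\<dots> \<le> ennreal ((w + 1) * 2 powr g / c * R powr g)"
      using c_pos w R0 by (intro ennreal_leI) (simp add: powr_mult field_simps)
    finally show "mass R \<le> ennreal ((w + 1) * 2 powr g / c * R powr g)" .
  qed (use c_pos w in \<open>auto intro: add_nonneg_pos\<close>)
qed

lemma mass_pos: obtains R0 where "R0 > 0" "mass R0 > 0"
proof -
  have "\<exists>n::nat. mass (real (Suc n)) > 0"
  proof (rule ccontr)
    assume "\<not> ?thesis"
    then have 0: "mass (real (Suc n)) = 0" for n by (simp add: not_less)
    have "AE z in lborel. ennreal (v z powr p) * indicator {z. norm z < real (Suc n)} z = 0" for n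
      using 0[of n] unfolding mass_def by (subst (asm) nn_integral_0_iff_AE) auto
    then have "AE z in lborel. \<forall>n. ennreal (v z powr p) * indicator {z. norm z < real (Suc n)} z = 0"
      unfolding AE_all_countable by blast
    then have "AE z in lborel. v z = 0"
    proof eventually_elim
      fix z assume *: "\<forall>n. ennreal (v z powr p) * indicator {z. norm z < real (Suc n)} z = 0"
      obtain n :: nat where "norm z < real n" using reals_Archimedean2 by blast
      then have "norm z < real (Suc n)" by simp
      with *[rule_format, of n] show "v z = 0" by (simp add: ennreal_eq_0_iff powr_def split: if_splits)
    qed
    with v_nontrivial show False by simp
  qed
  then show thesis using that by (metis of_nat_0_less_iff zero_less_Suc)
qed

text \<open>Inside the ball of radius R every point is within 2R of the mass, so v \<ge> c (2R)^-g
  m(R) there; the p-th power of this is integrated over the ball.\<close>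

lemma mass_superlinear:
  assumes R: "R > 0" and M: "mass R = ennreal M" "M \<ge> 0"
  shows "unit_ball_vol d * (c * 2 powr - g) powr p * R powr (d - g * p) * M powr p \<le> M"
proof -
  let ?b = "c * (2 * R) powr - g * M"
  have "ennreal (?b powr p) * emeasure lborel (ball (0::real^'n) R) = (\<integral>\<^sup>+z. ennreal (?b powr p) * indicator (ball (0::real^'n) R) z \<partial>lborel)"
    by (simp add: nn_integral_cmult_indicator)
  also have "\<dots> \<le> mass R"
    unfolding mass_def
  proof (rule nn_integral_mono_AE)
    show "AE z in lborel. ennreal (?b powr p) * indicator (ball 0 R) z \<le> ennreal (v z powr p) * indicator {z. norm z < R} z"
      using v_eq
    proof eventually_elim
      fix z assume z: "ennreal (v z) = V z"
      have "?b \<le> v z" if "norm z < R"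
      proof -
        have "ennreal (c * (2 * R) powr - g) * mass R \<le> ennreal (v z)"
          unfolding z using that R by (intro potential_ge_mass) auto
        then show ?thesis
          unfolding M(1) using c_pos M(2) v_nonneg[of z] by (simp add: ennreal_mult[symmetric] ennreal_le_iff)
      qed
      then have "?b powr p \<le> v z powr p" if "norm z < R"
        using that p_pos c_pos M(2) by (intro powr_mono2) auto
      then show "ennreal (?b powr p) * indicator (ball 0 R) z \<le> ennreal (v z powr p) * indicator {z. norm z < R} z"
        by (auto simp: indicator_def intro: ennreal_leI)
    qed
  qed
  finally have "ennreal (?b powr p * (unit_ball_vol d * R ^ CARD('n))) \<le> ennreal M"
    using R unfolding M(1) by (simp add: emeasure_ball d_eq ennreal_mult)
  then have "?b powr p * (unit_ball_vol d * R ^ CARD('n)) \<le> M"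
    using M(2) by (simp add: ennreal_le_iff)
  moreover have b: "?b powr p = (c * 2 powr - g) powr p * (R powr (- g * p) * M powr p)"
    by (simp only: powr_mult powr_powr mult.assoc)
  have "R ^ CARD('n) * R powr (- g * p) = R powr (d - g * p)"
    using R by (simp add: powr_realpow[symmetric] powr_add[symmetric] d_eq)
  then have "?b powr p * (unit_ball_vol d * R ^ CARD('n)) =
      unit_ball_vol d * (c * 2 powr - g) powr p * R powr (d - g * p) * M powr p"
    unfolding b by (metis mult.assoc mult.commute)
  ultimately show ?thesis by simp
qed

lemma no_solution_small_exponent: "p * g > d"
proof (rule ccontr)
  assume "\<not> ?thesis"
  then have pg: "g * p \<le> d" by (simp add: mult.commute)
  obtain R0 where R0: "R0 > 0" "mass R0 > 0" by (rule mass_pos)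
  obtain K2 R1 where K2: "K2 > 0" "R1 > 0" and upper: "\<And>R. R \<ge> R1 \<Longrightarrow> mass R \<le> ennreal (K2 * R powr g)"
    by (rule mass_bound) blast
  define M where "M R = enn2real (mass R)" for R
  have M: "mass R = ennreal (M R)" "M R \<ge> 0" for R
  proof -
    have "mass R \<le> mass (max R R1)" by (rule mass_mono) simp
    also have "\<dots> < \<infinity>" using upper[of "max R R1"] by (simp add: le_less_trans[OF _ ennreal_less_top])
    finally show "mass R = ennreal (M R)" by (simp add: M_def)
  qed (simp add: M_def)
  define \<mu> where "\<mu> = M R0"
  have \<mu>: "\<mu> > 0" using R0(2) unfolding M(1) by (simp add: \<mu>_def ennreal_less_zero_iff)
  have M_ge: "\<mu> \<le> M R" if "R0 \<le> R" for R
    using mass_mono[OF that] unfolding M(1) \<mu>_def by (simp add: M(2))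
  define K where "K = unit_ball_vol d * (c * 2 powr - g) powr p"
  have K: "K > 0" using c_pos by (simp add: K_def d_eq)
  have super: "K * R powr (d - g * p) * M R powr p \<le> M R" if "R > 0" for R
    unfolding K_def by (rule mass_superlinear[OF that M])
  have growth: "K * R powr (d - g * p) * M R powr (p - 1) \<le> 1" if "R0 \<le> R" for R
  proof -
    have MR: "M R > 0" "R > 0" using M_ge[OF that] \<mu> R0 that by linarith+
    have "K * R powr (d - g * p) * M R powr p = (K * R powr (d - g * p) * M R powr (p - 1)) * M R"
      using MR by (simp add: powr_diff)
    with super[OF MR(2)] have "(K * R powr (d - g * p) * M R powr (p - 1)) * M R \<le> 1 * M R" by (simp only: mult_1)
    then show ?thesis using MR(1) by (rule mult_right_le_imp_le)
  qed
  consider "p < 1" | "p \<ge> 1" "g * p < d" | "p \<ge> 1" "g * p = d" using pg by linarith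
  then show False
  proof cases
    \<comment> \<open>For p < 1 the lower bound on the mass is of no use; with m(R) \<le> K2 R^g the
      powers of R combine to d - gp - g(1-p) = d - g > 0.\<close>
    case 1
    obtain R where R: "R \<ge> max R0 R1" "R > 0" "R powr (d - g) > K2 powr (1 - p) / K"
    proof (rule powr_exceeds[where e="d - g"])
      show "d - g > 0" using g_less by simp
    qed (rule that)
    have MR: "M R > 0" using M_ge[of R] R \<mu> by simp
    have "M R \<le> K2 * R powr g" using upper[of R] R K2 unfolding M(1) by simp
    then have "M R powr (1 - p) \<le> (K2 * R powr g) powr (1 - p)" using 1 MR by (intro powr_mono2) auto
    also have "\<dots> = K2 powr (1 - p) * R powr (g * (1 - p))" by (simp add: powr_mult powr_powr)
    finally have a: "M R powr (1 - p) \<le> K2 powr (1 - p) * R powr (g * (1 - p))" .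
    have "K * R powr (d - g * p) = (K * R powr (d - g * p) * M R powr (p - 1)) * M R powr (1 - p)"
      using MR by (simp add: mult.assoc powr_add[symmetric])
    also have "\<dots> \<le> 1 * M R powr (1 - p)" using R by (intro mult_right_mono growth) auto
    finally have "K * R powr (d - g * p) \<le> K2 powr (1 - p) * R powr (g * (1 - p))" using a by simp
    moreover have "R powr (d - g * p) = R powr (d - g) * R powr (g * (1 - p))"
      by (simp add: powr_add[symmetric] algebra_simps)
    ultimately have "K * R powr (d - g) \<le> K2 powr (1 - p)" using R(2) by simp
    then show False using R(3) K by (simp add: field_simps)
  next
    \<comment> \<open>Here m(R)^(p-1) stays above a positive constant, while R^(d-gp) is
      unbounded.\<close>
    case 2
    obtain R where R: "R \<ge> R0" "R > 0" "R powr (d - g * p) > 1 / (K * \<mu> powr (p - 1))"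
    proof (rule powr_exceeds[where e="d - g * p"])
      show "d - g * p > 0" using 2 by simp
    qed (rule that)
    have "\<mu> powr (p - 1) \<le> M R powr (p - 1)" using M_ge[OF R(1)] \<mu> 2 by (intro powr_mono2) auto
    then have "K * R powr (d - g * p) * \<mu> powr (p - 1) \<le> K * R powr (d - g * p) * M R powr (p - 1)"
      using K by (intro mult_left_mono) auto
    also have "\<dots> \<le> 1" by (rule growth[OF R(1)])
    finally show False using R(3) K \<mu> by (simp add: field_simps)
  next
    \<comment> \<open>With gp = d the power of R disappears and the inequality only bounds the mass.
      The contradiction comes from infinity: v is at least a multiple of |z|^-g there, so v^p is at
      least a multiple of |z|^-d, which is not integrable.\<close>
    case 3
    then have p1: "p > 1" using g_less g_pos by (metis less_le mult.right_neutral order.strict_iff_order)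
    have bounded: "M R \<le> (1 / K) powr (1 / (p - 1))" if "R0 \<le> R" for R
    proof -
      have "M R powr (p - 1) \<le> 1 / K" using growth[OF that] 3 K R0 that by (simp add: field_simps)
      then have "(M R powr (p - 1)) powr (1 / (p - 1)) \<le> (1 / K) powr (1 / (p - 1))"
        using p1 by (intro powr_mono2) auto
      then show ?thesis using p1 M(2)[of R] by (simp add: powr_powr)
    qed
    have "(\<integral>\<^sup>+z. ennreal (v z powr p) \<partial>lborel) = (\<integral>\<^sup>+z. (SUP n. ennreal (v z powr p) * indicator {z. norm z < real n} z) \<partial>lborel)"
    proof (intro nn_integral_cong antisym)
      fix z :: "real^'n"
      obtain n :: nat where "norm z < real n" using reals_Archimedean2 by blast
      then show "ennreal (v z powr p) \<le> (SUP n. ennreal (v z powr p) * indicator {z. norm z < real n} z)"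
        by (intro SUP_upper2[of n]) auto
      show "(SUP n. ennreal (v z powr p) * indicator {z. norm z < real n} z) \<le> ennreal (v z powr p)"
        by (rule SUP_least) (auto simp: indicator_def)
    qed
    also have "\<dots> = (SUP n. mass (real n))"
      unfolding mass_def
      by (rule nn_integral_monotone_convergence_SUP) (auto simp: incseq_def le_fun_def indicator_def)
    also have "\<dots> \<le> ennreal ((1 / K) powr (1 / (p - 1)))"
    proof (rule SUP_least)
      fix n :: nat
      have "mass (real n) \<le> mass (max (real n) R0)" by (rule mass_mono) simp
      also have "\<dots> \<le> ennreal ((1 / K) powr (1 / (p - 1)))" unfolding M(1) by (intro ennreal_leI bounded) simp
      finally show "mass (real n) \<le> ennreal ((1 / K) powr (1 / (p - 1)))" .
    qed
    finally have fin: "(\<integral>\<^sup>+z. ennreal (v z powr p) \<partial>lborel) < \<infinity>" by (rule le_less_trans) simp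
    define b where "b = (c * 2 powr - g * \<mu>) powr p"
    have b: "b > 0" using c_pos \<mu> by (simp add: b_def)
    have "(\<integral>\<^sup>+z. ennreal (b * norm z powr - d) * indicator {z::real^'n. R0 \<le> norm z} z \<partial>lborel) = \<infinity>"
      by (rule nn_integral_infinite_if_slow_decay[of R0 b d]) (use R0 b in \<open>auto simp: d_eq\<close>)
    moreover have "(\<integral>\<^sup>+z. ennreal (b * norm z powr - d) * indicator {z::real^'n. R0 \<le> norm z} z \<partial>lborel) \<le> (\<integral>\<^sup>+z. ennreal (v z powr p) \<partial>lborel)"
    proof (rule nn_integral_mono_AE)
      show "AE z in lborel. ennreal (b * norm z powr - d) * indicator {z::real^'n. R0 \<le> norm z} z \<le> ennreal (v z powr p)"
        using v_eq
      proof eventually_elim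
        fix z :: "real^'n" assume z: "ennreal (v z) = V z"
        have "b * norm z powr - d \<le> v z powr p" if Rz: "R0 \<le> norm z"
        proof -
          have "ennreal (c * (2 * norm z) powr - g) * mass R0 \<le> ennreal (v z)"
            unfolding z using Rz R0 by (intro potential_ge_mass) auto
          then have "c * (2 * norm z) powr - g * \<mu> \<le> v z"
            unfolding M(1) \<mu>_def using c_pos M(2) v_nonneg[of z] by (simp add: ennreal_mult[symmetric] ennreal_le_iff)
          then have "(c * (2 * norm z) powr - g * \<mu>) powr p \<le> v z powr p"
            using p_pos c_pos \<mu> by (intro powr_mono2) auto
          moreover have "(c * (2 * norm z) powr - g * \<mu>) powr p = b * norm z powr (- g * p)"
            unfolding b_def by (simp only: powr_mult powr_powr mult_ac)
          ultimately show ?thesis using 3 by simp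
        qed
        then show "ennreal (b * norm z powr - d) * indicator {z::real^'n. R0 \<le> norm z} z \<le> ennreal (v z powr p)"
          by (auto simp: indicator_def intro: ennreal_leI)
      qed
    qed
    ultimately show False using fin by simp
  qed
qed

end

section \<open>Boundary traces\<close>

text \<open>The potential of a density on the boundary hyperplane, evaluated in the whole space. As
  d = N - 1, the case a = d - 1 is the harmonic single layer kernel of exponent N - 2.\<close>

definition layer :: "real \<Rightarrow> (real^'n \<Rightarrow> ennreal) \<Rightarrow> (real^'n) \<times> real \<Rightarrow> ennreal" where
  "layer a h X = (\<integral>\<^sup>+y. ennreal (norm (X - (y, 0)) powr - a) * h y \<partial>lborel)"

lemma norm_diff_boundary: "norm ((x, t) - (y, 0 :: real)) = sqrt ((norm (x - y))\<^sup>2 + t\<^sup>2)"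
  by (simp add: norm_Pair)

lemma layer_le_boundary:
  assumes "a \<ge> 0"
  shows "layer a h (x, t) \<le> layer a h (x :: real^'n, 0)"
  unfolding layer_def
proof (rule nn_integral_mono_AE)
  \<comment> \<open>At y = x the boundary kernel is \<open>0 powr - a = 0\<close> instead of
    infinite, so the inequality fails there and the point has to be discarded.\<close>
  have "AE y in lborel. y \<noteq> x" by (rule AE_lborel_singleton)
  then show "AE y in lborel. ennreal (norm ((x, t) - (y, 0)) powr - a) * h y \<le> ennreal (norm ((x, 0 :: real) - (y, 0)) powr - a) * h y"
  proof eventually_elim
    fix y assume "y \<noteq> x"
    then have "0 < norm (x - y)" by simp
    moreover have "norm (x - y) \<le> sqrt ((norm (x - y))\<^sup>2 + t\<^sup>2)" by (simp add: real_le_rsqrt)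
    ultimately have "norm ((x, t) - (y, 0)) powr - a \<le> norm ((x, 0 :: real) - (y, 0)) powr - a"
      unfolding norm_diff_boundary using assms by (intro powr_mono2') auto
    then show "ennreal (norm ((x, t) - (y, 0)) powr - a) * h y \<le> ennreal (norm ((x, 0 :: real) - (y, 0)) powr - a) * h y"
      by (intro mult_right_mono ennreal_leI) auto
  qed
qed

lemma borel_measurable_layer [measurable]:
  fixes h :: "real^'n \<Rightarrow> ennreal"
  assumes [measurable]: "h \<in> borel_measurable borel"
  shows "layer a h \<in> borel_measurable borel"
proof -
  have "(\<lambda>X. \<integral>\<^sup>+y. ennreal (norm (X - (y, 0 :: real)) powr - a) * h y \<partial>lborel) \<in> borel_measurable borel"
  proof (rule lborel.borel_measurable_nn_integral)
    define G where "G Z = fst Z - (snd Z, 0)" for Z :: "((real^'n) \<times> real) \<times> (real^'n)"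
    have [measurable]: "G \<in> borel_measurable (borel \<Otimes>\<^sub>M borel)"
      unfolding borel_prod G_def by (intro borel_measurable_continuous_onI continuous_intros)
    have "(\<lambda>Z. ennreal (norm (G Z) powr - a) * h (snd Z)) \<in> borel_measurable (borel \<Otimes>\<^sub>M borel)"
      by measurable
    then have "(\<lambda>(X, y). ennreal (norm (X - (y, 0 :: real)) powr - a) * h y) \<in> borel_measurable (borel \<Otimes>\<^sub>M borel)"
      unfolding case_prod_beta' G_def .
    then show "(\<lambda>(X, y). ennreal (norm (X - (y, 0 :: real)) powr - a) * h y) \<in> borel_measurable (borel \<Otimes>\<^sub>M lborel)"
      by (subst measurable_cong_sets[OF sets_pair_measure_cong[OF refl sets_lborel] refl])
  qed
  then show ?thesis unfolding layer_def by measurable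
qed

text \<open>Fatou's lemma, along an arbitrary approach to the boundary. Finiteness of h almost
  everywhere makes multiplication by h continuous in \<open>ennreal\<close>.\<close>

lemma layer_liminf:
  fixes x :: "real^'n"
  assumes [measurable]: "h \<in> borel_measurable borel" and fin: "AE y in lborel. h y < \<infinity>"
    and X: "X \<longlonglongrightarrow> (x, 0)"
  shows "layer a h (x, 0) \<le> liminf (\<lambda>n. layer a h (X n))"
proof -
  have meas: "(\<lambda>y. ennreal (norm (Z - (y, 0)) powr - a) * h y) \<in> borel_measurable lborel" for Z :: "(real^'n) \<times> real"
  proof -
    have [measurable]: "(\<lambda>y. Z - (y, 0)) \<in> borel_measurable borel"
      by (intro borel_measurable_continuous_onI continuous_intros)
    show ?thesis by measurable
  qed
  have "layer a h (x, 0) \<le> (\<integral>\<^sup>+y. liminf (\<lambda>n. ennreal (norm (X n - (y, 0)) powr - a) * h y) \<partial>lborel)"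
    unfolding layer_def
  proof (rule nn_integral_mono_AE)
    have "AE y in lborel. y \<noteq> x" by (rule AE_lborel_singleton)
    then show "AE y in lborel. ennreal (norm ((x, 0 :: real) - (y, 0)) powr - a) * h y \<le> liminf (\<lambda>n. ennreal (norm (X n - (y, 0)) powr - a) * h y)"
      using fin
    proof eventually_elim
      fix y assume "y \<noteq> x" and h: "h y < \<infinity>"
      have "(\<lambda>n. norm (X n - (y, 0))) \<longlonglongrightarrow> norm ((x, 0 :: real) - (y, 0))"
        by (intro tendsto_norm tendsto_diff X tendsto_const)
      then have "(\<lambda>n. norm (X n - (y, 0)) powr - a) \<longlonglongrightarrow> norm ((x, 0 :: real) - (y, 0)) powr - a"
        by (rule tendsto_powr[OF _ tendsto_const]) (use \<open>y \<noteq> x\<close> in auto)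
      then have "(\<lambda>n. ennreal (norm (X n - (y, 0)) powr - a) * h y) \<longlonglongrightarrow> ennreal (norm ((x, 0 :: real) - (y, 0)) powr - a) * h y"
        using h by (intro tendsto_mult_ennreal tendsto_ennrealI tendsto_const) auto
      then show "ennreal (norm ((x, 0 :: real) - (y, 0)) powr - a) * h y \<le> liminf (\<lambda>n. ennreal (norm (X n - (y, 0)) powr - a) * h y)"
        by (simp add: lim_imp_Liminf)
    qed
  qed
  also have "\<dots> \<le> liminf (\<lambda>n. layer a h (X n))"
    unfolding layer_def by (rule nn_integral_liminf[OF meas])
  finally show ?thesis .
qed

text \<open>Limits from the half space are therefore unique, so that \<open>Lim\<close> in the
  definition of \<open>btrace\<close> picks the limit.\<close>

lemma at_boundary_nontrivial: "at (y :: real^'n, 0) within halfspace \<noteq> bot"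
proof -
  have "(y, 0) islimpt (halfspace :: ((real^'n) \<times> real) set)"
    unfolding islimpt_approachable
  proof (intro allI impI)
    fix e :: real assume "e > 0"
    then show "\<exists>X'\<in>halfspace. X' \<noteq> (y, 0) \<and> dist X' (y, 0) < e"
      by (intro bexI[of _ "(y, e / 2)"]) (auto simp: halfspace_def dist_Pair_Pair)
  qed
  then show ?thesis by (simp add: trivial_limit_within)
qed

lemma open_halfspace: "open (halfspace :: ((real^'n) \<times> real) set)"
  unfolding halfspace_def by (intro open_Collect_less continuous_intros)

lemma btrace_eq:
  assumes "(u \<longlongrightarrow> L) (at (y :: real^'n, 0) within halfspace)"
  shows "btrace u y = L"
  unfolding btrace_def by (rule tendsto_Lim[OF at_boundary_nontrivial assms])

text \<open>Positivity is known only almost everywhere; a negative limit would make u negative on a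
  half ball, which has positive measure.\<close>

lemma boundary_limit_nonneg:
  fixes u :: "(real^'n) \<times> real \<Rightarrow> real"
  assumes pos: "AE X in lborel. X \<in> halfspace \<longrightarrow> u X > 0"
    and L: "(u \<longlongrightarrow> L) (at (y :: real^'n, 0) within halfspace)"
  shows "L \<ge> 0"
proof (rule ccontr)
  assume "\<not> L \<ge> 0"
  then have "\<forall>\<^sub>F X in at (y, 0) within halfspace. u X < 0"
    using L by (intro order_tendstoD(2)) auto
  then obtain r where r: "r > 0" "\<And>X. X \<in> halfspace \<Longrightarrow> X \<noteq> (y, 0) \<Longrightarrow> dist X (y, 0) < r \<Longrightarrow> u X < 0"
    by (auto simp: eventually_at)
  have "AE X in lborel. X \<notin> halfspace \<inter> ball (y, 0) r"
    using pos
  proof eventually_elim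
    fix X assume "X \<in> halfspace \<longrightarrow> u X > 0"
    moreover have "X \<noteq> (y, 0)" if "X \<in> halfspace" using that by (auto simp: halfspace_def)
    ultimately show "X \<notin> halfspace \<inter> ball (y, 0) r"
      using r(2)[of X] by (auto simp: dist_commute)
  qed
  then have "halfspace \<inter> ball (y, 0) r = {}"
    by (rule emeasure_zero_imp_empty[rotated]) (intro open_Int open_halfspace open_ball)
  moreover have "(y, r / 2) \<in> halfspace \<inter> ball (y, 0) r" using r(1) by (auto simp: halfspace_def dist_Pair_Pair)
  ultimately show False by blast
qed

text \<open>The upper limit at the boundary is an infimum of suprema over balls, hence Borel whatever \<open>u\<close> is.\<close>

lemma borel_trace:
  fixes u :: "(real^'n) \<times> real \<Rightarrow> real"
  assumes pos: "AE X in lborel. X \<in> halfspace \<longrightarrow> u X > 0"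
    and lim: "AE y in lborel. \<exists>L. (u \<longlongrightarrow> L) (at (y, 0) within halfspace)"
  obtains v where "v \<in> borel_measurable borel" "\<And>y. 0 \<le> v y"
    "AE y in lborel. (u \<longlongrightarrow> v y) (at (y, 0) within halfspace)"
proof -
  define S where "S n y = {X \<in> halfspace. dist X (y :: real^'n, 0) < 1 / real (Suc n)}" for n y
  define s where "s n y = (SUP X\<in>S n y. ereal (u X))" for n y
  have s_meas[measurable]: "s n \<in> borel_measurable borel" for n
  proof (rule borel_measurableI_greater)
    fix a
    have "{y \<in> space borel. a < s n y} = (\<Union>X\<in>{X \<in> halfspace. a < ereal (u X)}. {y. dist X (y, 0) < 1 / real (Suc n)})"
      by (auto simp: s_def S_def less_SUP_iff)
    also have "open \<dots>"
      by (intro open_UN ballI open_Collect_less continuous_intros)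
    finally show "{y \<in> space borel. a < s n y} \<in> sets borel" by simp
  qed
  \<comment> \<open>The maximum with 0 keeps v nonnegative also at the exceptional points without a
    limit, where the infimum is unrelated to u.\<close>
  define v where "v y = max 0 (real_of_ereal (INF n. s n y))" for y
  show thesis
  proof (rule that[of v])
    show "v \<in> borel_measurable borel" unfolding v_def by measurable
    show "0 \<le> v y" for y by (simp add: v_def)
    show "AE y in lborel. (u \<longlongrightarrow> v y) (at (y, 0) within halfspace)"
      using lim
    proof eventually_elim
      fix y assume "\<exists>L. (u \<longlongrightarrow> L) (at (y, 0) within halfspace)"
      then obtain L where L: "(u \<longlongrightarrow> L) (at (y, 0) within halfspace)" by blast
      have near: "\<exists>r>0. \<forall>X\<in>halfspace. dist X (y, 0) < r \<longrightarrow> \<bar>u X - L\<bar> < e" if e: "e > 0" for e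
      proof -
        obtain r where r: "r > 0" "\<forall>X\<in>halfspace. X \<noteq> (y, 0) \<and> dist X (y, 0) < r \<longrightarrow> dist (u X) L < e"
          using tendstoD[OF L e] by (auto simp: eventually_at)
        then show ?thesis
          by (intro exI[of _ r]) (auto simp: dist_real_def halfspace_def)
      qed
      have "(INF n. s n y) \<le> ereal L"
      proof (rule ereal_le_epsilon2)
        fix e :: real assume "0 < e"
        then obtain r where r: "r > 0" "\<And>X. X \<in> halfspace \<Longrightarrow> dist X (y, 0) < r \<Longrightarrow> \<bar>u X - L\<bar> < e" using near by blast
        obtain n where n: "1 / real (Suc n) < r" using r(1) nat_approx_posE by blast
        have "(INF n. s n y) \<le> s n y" by (rule INF_lower) simp
        also have "\<dots> \<le> ereal L + ereal e"
          unfolding s_def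
        proof (rule SUP_least)
          fix X assume "X \<in> S n y"
          then have "\<bar>u X - L\<bar> < e" using n by (intro r(2)) (auto simp: S_def)
          then show "ereal (u X) \<le> ereal L + ereal e" by simp
        qed
        finally show "(INF n. s n y) \<le> ereal L + ereal e" .
      qed
      moreover have "ereal L \<le> (INF n. s n y)"
      proof (rule INF_greatest, rule ereal_le_epsilon2)
        fix n and e :: real assume "0 < e"
        then obtain r where r: "r > 0" "\<And>X. X \<in> halfspace \<Longrightarrow> dist X (y, 0) < r \<Longrightarrow> \<bar>u X - L\<bar> < e" using near by blast
        define t where "t = min r (1 / real (Suc n)) / 2"
        have t: "t > 0" "t < r" "t < 1 / real (Suc n)" using r(1) by (auto simp: t_def min_def field_simps)
        have d: "dist (y, t) (y, 0) = t" using t by (simp add: dist_Pair_Pair dist_real_def)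
        have H: "(y, t) \<in> halfspace" using t by (simp add: halfspace_def)
        have "\<bar>u (y, t) - L\<bar> < e" using H d t by (intro r(2)) auto
        then have "ereal L \<le> ereal (u (y, t)) + ereal e" by simp
        also have "ereal (u (y, t)) \<le> s n y"
          unfolding s_def by (rule SUP_upper) (use H d t in \<open>auto simp: S_def\<close>)
        finally show "ereal L \<le> s n y + ereal e" by (simp add: add_right_mono)
      qed
      ultimately have "(INF n. s n y) = ereal L" by (rule antisym)
      then have "v y = L" using boundary_limit_nonneg[OF pos L] by (simp add: v_def)
      with L show "(u \<longlongrightarrow> v y) (at (y, 0) within halfspace)" by simp
    qed
  qed
qed

lemma AE_lebesgue_iff: "(AE x in lebesgue. P x) \<longleftrightarrow> (AE x in lborel. P x)"
  by (rule AE_completion_iff)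

lemma sphere_area_pos: "N > 0 \<Longrightarrow> sphere_area N > 0"
  by (simp add: sphere_area_def Gamma_real_pos)

text \<open>The equation in the half space passes to the boundary along vertical lines. Fatou's
  lemma bounds the boundary potential by the trace; the other inequality holds because the kernel
  only grows when t decreases to 0.\<close>

lemma positive_solution_trace:
  fixes u :: "(real^'n) \<times> real \<Rightarrow> real"
  defines "d \<equiv> real CARD('n)"
  defines "c0 lam \<equiv> 2 * lam / ((d - 1) * sphere_area (CARD('n) + 1))"
  assumes N: "CARD('n) \<ge> 2" and lam: "lam > 0" and sol: "pos_solution lam p k u"
  obtains v where "v \<in> borel_measurable borel" "\<And>y. 0 \<le> v y" "AE y in lborel. btrace u y = v y"
    "\<not> (AE y in lborel. v y = 0)"
    "AE y in lborel. ennreal (v y) = ennreal (c0 lam) * layer (d - 1) (\<lambda>y. \<integral>\<^sup>+z. ennreal (v z powr p * norm (y - z) powr - k) \<partial>lborel) (y, 0)"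
    "AE X in lborel. X \<in> halfspace \<longrightarrow> ennreal (u X) = ennreal (c0 lam) * layer (d - 1) (\<lambda>y. \<integral>\<^sup>+z. ennreal (v z powr p * norm (y - z) powr - k) \<partial>lborel) X"
proof -
  have c0: "c0 lam > 0" using N lam sphere_area_pos[of "CARD('n) + 1"] by (simp add: c0_def d_def)
  have pos: "AE X in lborel. X \<in> halfspace \<longrightarrow> u X > 0"
    and lim: "AE y in lborel. \<exists>L. (u \<longlongrightarrow> L) (at (y, 0) within halfspace)"
    and finH: "AE y in lborel. Hu p k u y < \<infinity>"
    and eq: "AE x in lborel. x \<in> halfspace \<longrightarrow>
        ennreal (u x) = ennreal (c0 lam) *
          (\<integral>\<^sup>+ y. \<integral>\<^sup>+ z. ennreal (btrace u z powr p /
               (norm (x - (y, 0)) powr (d - 1) * norm (y - z) powr k)) \<partial>lborel \<partial>lborel)"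
    using sol unfolding pos_solution_def AE_lebesgue_iff nn_integral_completion c0_def d_def by auto
  obtain v where v[measurable]: "v \<in> borel_measurable borel" and v0: "\<And>y. 0 \<le> v y"
    and vlim: "AE y in lborel. (u \<longlongrightarrow> v y) (at (y, 0) within halfspace)"
    using borel_trace[OF pos lim] by blast
  have bv: "AE y in lborel. btrace u y = v y"
    using vlim by eventually_elim (rule btrace_eq)
  define h where "h y = (\<integral>\<^sup>+z. ennreal (v z powr p * norm (y - z) powr - k) \<partial>lborel)" for y :: "real^'n"
  have [measurable]: "h \<in> borel_measurable borel"
    unfolding h_def by (rule lborel.borel_measurable_nn_integral) (simp add: case_prod_unfold)
  have hH: "Hu p k u y = h y" for y
    unfolding Hu_def h_def nn_integral_completion
    using bv by (intro nn_integral_cong_AE) (auto elim!: eventually_mono simp: powr_minus divide_inverse)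
  have hfin: "AE y in lborel. h y < \<infinity>" using finH unfolding hH .
  have "(\<integral>\<^sup>+ z. ennreal (btrace u z powr p / (norm (x - (y, 0)) powr (d - 1) * norm (y - z) powr k)) \<partial>lborel) =
      ennreal (norm (x - (y, 0)) powr - (d - 1)) * h y" for x :: "(real^'n) \<times> real" and y
  proof -
    have "(\<integral>\<^sup>+ z. ennreal (btrace u z powr p / (norm (x - (y, 0)) powr (d - 1) * norm (y - z) powr k)) \<partial>lborel) =
       (\<integral>\<^sup>+ z. ennreal (norm (x - (y, 0)) powr - (d - 1)) * ennreal (v z powr p * norm (y - z) powr - k) \<partial>lborel)"
      using bv by (intro nn_integral_cong_AE)
        (auto elim!: eventually_mono simp: ennreal_mult'[symmetric] powr_minus[of _ "d - 1"] powr_minus[of _ k] field_simps simp del: minus_diff_eq)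
    also have "\<dots> = ennreal (norm (x - (y, 0)) powr - (d - 1)) * h y"
      unfolding h_def by (rule nn_integral_cmult) measurable
    finally show ?thesis .
  qed
  then have eq': "AE X in lborel. X \<in> halfspace \<longrightarrow> ennreal (u X) = ennreal (c0 lam) * layer (d - 1) h X"
    using eq by (simp add: layer_def)
  \<comment> \<open>The equation holds almost everywhere in space, so by Fubini almost every
    vertical line contains points arbitrarily close to the boundary where it holds.\<close>
  have "AE x in lborel. AE t in lborel. (x, t) \<in> halfspace \<longrightarrow> ennreal (u (x, t)) = ennreal (c0 lam) * layer (d - 1) h (x, t)"
    by (rule lborel_pair.AE_pair) (unfold lborel_prod, rule eq')
  then have veq: "AE y in lborel. ennreal (v y) = ennreal (c0 lam) * layer (d - 1) h (y, 0)"
    using vlim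
  proof eventually_elim
    fix x :: "real^'n"
    assume ae: "AE t in lborel. (x, t) \<in> halfspace \<longrightarrow> ennreal (u (x, t)) = ennreal (c0 lam) * layer (d - 1) h (x, t)"
      and L: "(u \<longlongrightarrow> v x) (at (x, 0) within halfspace)"
    have "\<exists>t. 0 < t \<and> t < 1 / real (Suc n) \<and> ennreal (u (x, t)) = ennreal (c0 lam) * layer (d - 1) h (x, t)" for n
    proof (rule ccontr)
      assume "\<not> ?thesis"
      then have "AE t in lborel. t \<notin> {0<..<1 / real (Suc n)}"
        using ae by (auto elim!: eventually_mono simp: halfspace_def)
      then have "{0<..<1 / real (Suc n)} = {}" by (rule emeasure_zero_imp_empty[rotated]) simp
      moreover have "1 / (2 * real (Suc n)) \<in> {0<..<1 / real (Suc n)}" by (simp add: field_simps)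
      ultimately show False by blast
    qed
    then obtain t where t: "\<And>n. 0 < t n" "\<And>n. t n < 1 / real (Suc n)"
      "\<And>n. ennreal (u (x, t n)) = ennreal (c0 lam) * layer (d - 1) h (x, t n)" by metis
    have "t \<longlonglongrightarrow> 0"
      by (rule tendsto_sandwich[OF _ _ tendsto_const LIMSEQ_Suc[OF lim_1_over_n]])
         (use t in \<open>auto intro!: always_eventually less_imp_le\<close>)
    then have X: "(\<lambda>n. (x, t n)) \<longlonglongrightarrow> (x, 0)" by (intro tendsto_Pair tendsto_const)
    have "filterlim (\<lambda>n. (x, t n)) (at (x, 0) within halfspace) sequentially"
      unfolding filterlim_at using X t(1) by (auto simp: halfspace_def less_imp_neq[symmetric])
    then have "(\<lambda>n. u (x, t n)) \<longlonglongrightarrow> v x" by (rule filterlim_compose[OF L])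
    then have ul: "(\<lambda>n. ennreal (u (x, t n))) \<longlonglongrightarrow> ennreal (v x)" by (rule tendsto_ennrealI)
    have "(\<lambda>n. ennreal (1 / c0 lam) * ennreal (u (x, t n))) \<longlonglongrightarrow> ennreal (1 / c0 lam) * ennreal (v x)"
      by (intro tendsto_mult_ennreal ul tendsto_const) auto
    moreover have "ennreal (1 / c0 lam) * ennreal (u (x, t n)) = layer (d - 1) h (x, t n)" for n
      unfolding t(3) using c0 by (simp add: mult.assoc[symmetric] ennreal_mult[symmetric])
    ultimately have "(\<lambda>n. layer (d - 1) h (x, t n)) \<longlonglongrightarrow> ennreal (1 / c0 lam) * ennreal (v x)" by simp
    then have "layer (d - 1) h (x, 0) \<le> ennreal (1 / c0 lam) * ennreal (v x)"
      using layer_liminf[OF _ hfin X, of "d - 1"] by (simp add: lim_imp_Liminf)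
    then have "ennreal (c0 lam) * layer (d - 1) h (x, 0) \<le> ennreal (c0 lam) * (ennreal (1 / c0 lam) * ennreal (v x))"
      by (rule mult_left_mono) simp
    also have "\<dots> = ennreal (v x)" using c0 by (simp add: mult.assoc[symmetric] ennreal_mult[symmetric])
    finally have "ennreal (c0 lam) * layer (d - 1) h (x, 0) \<le> ennreal (v x)" .
    moreover have "ennreal (v x) \<le> ennreal (c0 lam) * layer (d - 1) h (x, 0)"
    proof (rule tendsto_upperbound[OF ul])
      show "\<forall>\<^sub>F n in sequentially. ennreal (u (x, t n)) \<le> ennreal (c0 lam) * layer (d - 1) h (x, 0)"
        unfolding t(3) by (intro always_eventually allI mult_left_mono layer_le_boundary) (use N in \<open>auto simp: d_def\<close>)
    qed simp
    ultimately show "ennreal (v x) = ennreal (c0 lam) * layer (d - 1) h (x, 0)" by (intro antisym)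
  qed
  have "\<not> (AE y in lborel. v y = 0)"
  proof
    assume "AE y in lborel. v y = 0"
    then have "h y = (\<integral>\<^sup>+z. 0 \<partial>(lborel :: (real^'n) measure))" for y
      unfolding h_def by (intro nn_integral_cong_AE) (auto elim!: eventually_mono)
    then have layer_0: "layer (d - 1) h X = 0" for X by (simp add: layer_def)
    have "AE X in lborel. X \<notin> (halfspace :: ((real^'n) \<times> real) set)"
      using eq' pos by eventually_elim (auto simp: ennreal_eq_0_iff layer_0)
    then have "(halfspace :: ((real^'n) \<times> real) set) = {}" by (rule emeasure_zero_imp_empty[OF open_halfspace])
    moreover have "(0, 1) \<in> (halfspace :: ((real^'n) \<times> real) set)" by (simp add: halfspace_def)
    ultimately show False by blast
  qed
  then show thesis by (rule that[OF v v0 bv _ veq[unfolded h_def] eq'[unfolded h_def]])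
qed

section \<open>Reduction to the integral equation on the boundary\<close>

lemma layer_boundary_composition:
  fixes v :: "real^'n \<Rightarrow> real" and a k p :: real
  assumes [measurable]: "v \<in> borel_measurable borel"
  shows "layer a (\<lambda>y. \<integral>\<^sup>+z. ennreal (v z powr p * norm (y - z) powr - k) \<partial>lborel) (x, 0) =
    (\<integral>\<^sup>+z. ennreal (v z powr p) * (\<integral>\<^sup>+y. ennreal (norm (x - y) powr - a * norm (y - z) powr - k) \<partial>lborel) \<partial>lborel)"
proof -
  have "layer a (\<lambda>y. \<integral>\<^sup>+z. ennreal (v z powr p * norm (y - z) powr - k) \<partial>lborel) (x, 0) =
    (\<integral>\<^sup>+y. \<integral>\<^sup>+z. ennreal (v z powr p) * ennreal (norm (x - y) powr - a * norm (y - z) powr - k) \<partial>lborel \<partial>lborel)"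
    unfolding layer_def
  proof (intro nn_integral_cong)
    fix y
    have "(\<integral>\<^sup>+z. ennreal (v z powr p) * ennreal (norm (x - y) powr - a * norm (y - z) powr - k) \<partial>lborel) =
       (\<integral>\<^sup>+z. ennreal (norm (x - y) powr - a) * ennreal (v z powr p * norm (y - z) powr - k) \<partial>lborel)"
      by (intro nn_integral_cong) (simp add: ennreal_mult mult_ac)
    also have "\<dots> = ennreal (norm (x - y) powr - a) * (\<integral>\<^sup>+z. ennreal (v z powr p * norm (y - z) powr - k) \<partial>lborel)"
      by (rule nn_integral_cmult) measurable
    finally show "ennreal (norm ((x, 0 :: real) - (y, 0)) powr - a) * (\<integral>\<^sup>+z. ennreal (v z powr p * norm (y - z) powr - k) \<partial>lborel) =
       (\<integral>\<^sup>+z. ennreal (v z powr p) * ennreal (norm (x - y) powr - a * norm (y - z) powr - k) \<partial>lborel)"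
      by simp
  qed
  also have "\<dots> = (\<integral>\<^sup>+z. \<integral>\<^sup>+y. ennreal (v z powr p) * ennreal (norm (x - y) powr - a * norm (y - z) powr - k) \<partial>lborel \<partial>lborel)"
    by (rule lborel_pair.Fubini'[symmetric]) (simp add: case_prod_unfold)
  also have "\<dots> = (\<integral>\<^sup>+z. ennreal (v z powr p) * (\<integral>\<^sup>+y. ennreal (norm (x - y) powr - a * norm (y - z) powr - k) \<partial>lborel) \<partial>lborel)"
    by (intro nn_integral_cong nn_integral_cmult) measurable
  finally show ?thesis .
qed

lemma riesz_composition_points:
  assumes a: "0 < a" "a < real CARD('n)" and b: "0 < b" "b < real CARD('n)" and ab: "a + b > real CARD('n)"
  obtains \<kappa> where "\<kappa> > 0"
    "\<And>x z :: real^'n::finite. x \<noteq> z \<Longrightarrow>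
      (\<integral>\<^sup>+y. ennreal (norm (x - y) powr - a * norm (y - z) powr - b) \<partial>lborel) = ennreal (\<kappa> * norm (x - z) powr (real CARD('n) - a - b))"
proof -
  obtain \<kappa> where \<kappa>: "\<kappa> > 0" "\<And>x :: real^'n. x \<noteq> 0 \<Longrightarrow>
      (\<integral>\<^sup>+y. ennreal (norm (x - y) powr - a * norm y powr - b) \<partial>lborel) = ennreal (\<kappa> * norm x powr (real CARD('n) - a - b))"
    by (rule riesz_composition[OF a b ab]) (rule that)
  show thesis
  proof (rule that[OF \<kappa>(1)])
    fix x z :: "real^'n" assume "x \<noteq> z"
    then have "x - z \<noteq> 0" by simp
    have "(\<integral>\<^sup>+y. ennreal (norm (x - y) powr - a * norm (y - z) powr - b) \<partial>lborel) =
       (\<integral>\<^sup>+y. ennreal (norm (x - (z + y)) powr - a * norm (z + y - z) powr - b) \<partial>lborel)"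
      by (rule nn_integral_lborel_translate[symmetric]) measurable
    also have "\<dots> = (\<integral>\<^sup>+y. ennreal (norm ((x - z) - y) powr - a * norm y powr - b) \<partial>lborel)"
      by (simp add: diff_diff_eq)
    also have "\<dots> = ennreal (\<kappa> * norm (x - z) powr (real CARD('n) - a - b))"
      by (rule \<kappa>(2)) fact
    finally show "(\<integral>\<^sup>+y. ennreal (norm (x - y) powr - a * norm (y - z) powr - b) \<partial>lborel) = ennreal (\<kappa> * norm (x - z) powr (real CARD('n) - a - b))" .
  qed
qed

text \<open>Far out both distances are at most 2|y|, so the product decays no faster than
  |y|^-(a+b). For a = d - 1 and b = k the condition a + b \<le> d reads k \<le> 1.\<close>

lemma riesz_composition_infinite:
  fixes x z :: "'a::euclidean_space"
  assumes a: "0 \<le> a" and b: "0 \<le> b" and ab: "a + b \<le> real DIM('a)"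
  shows "(\<integral>\<^sup>+y. ennreal (norm (x - y) powr - a * norm (y - z) powr - b) \<partial>lborel) = \<infinity>"
proof (rule nn_integral_infinite_if_slow_decay[OF _ ab])
  fix y :: 'a assume y: "norm x + norm z + 1 \<le> norm y"
  have "norm y - norm x \<le> norm (x - y)" by (metis norm_minus_commute norm_triangle_ineq2)
  then have 1: "0 < norm (x - y)" "norm (x - y) \<le> 2 * norm y"
    using y norm_triangle_ineq4[of x y] norm_ge_zero[of z] norm_ge_zero[of x] by linarith+
  have 2: "0 < norm (y - z)" "norm (y - z) \<le> 2 * norm y"
    using y norm_triangle_ineq2[of y z] norm_triangle_ineq4[of y z] norm_ge_zero[of z] norm_ge_zero[of x] by linarith+
  have "(2 powr - (a + b)) * norm y powr - (a + b) = (2 * norm y) powr - a * (2 * norm y) powr - b"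
    by (simp only: powr_mult minus_add_distrib powr_add) (simp add: mult_ac)
  also have "\<dots> \<le> norm (x - y) powr - a * norm (y - z) powr - b"
    using 1 2 a b by (intro mult_mono powr_mono2') auto
  finally show "ennreal ((2 powr - (a + b)) * norm y powr - (a + b)) \<le> ennreal (norm (x - y) powr - a * norm (y - z) powr - b)"
    by (rule ennreal_leI)
qed (auto intro: add_nonneg_pos)

lemma no_positive_solution_k_le_1:
  fixes u :: "(real^'n) \<times> real \<Rightarrow> real"
  assumes N: "CARD('n) \<ge> 2" and lam: "lam > 0" and k: "0 < k" "k \<le> 1"
  shows "\<not> pos_solution lam p k u"
proof
  assume sol: "pos_solution lam p k u"
  let ?d = "real CARD('n)"
  define c0 where "c0 = 2 * lam / ((?d - 1) * sphere_area (CARD('n) + 1))"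
  obtain v where v[measurable]: "v \<in> borel_measurable borel" and v0: "\<And>y. 0 \<le> v y"
    and "AE y in lborel. btrace u y = v y" and nt: "\<not> (AE y in lborel. v y = 0)"
    and veq: "AE y in lborel. ennreal (v y) = ennreal c0 * layer (?d - 1) (\<lambda>y. \<integral>\<^sup>+z. ennreal (v z powr p * norm (y - z) powr - k) \<partial>lborel) (y, 0)"
    and "AE X in lborel. X \<in> halfspace \<longrightarrow> ennreal (u X) = ennreal c0 * layer (?d - 1) (\<lambda>y. \<integral>\<^sup>+z. ennreal (v z powr p * norm (y - z) powr - k) \<partial>lborel) X"
    by (rule positive_solution_trace[OF N lam sol, folded c0_def]) (rule that)
  have c0: "c0 > 0" using N lam sphere_area_pos[of "CARD('n) + 1"] by (simp add: c0_def)
  have inf: "(\<integral>\<^sup>+y. ennreal (norm (x - y) powr - (?d - 1) * norm (y - z) powr - k) \<partial>lborel) = \<infinity>" for x z :: "real^'n"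
    by (rule riesz_composition_infinite) (use N k in auto)
  have "(\<integral>\<^sup>+z. ennreal (v z powr p) * \<infinity> \<partial>lborel) = \<infinity>"
  proof -
    have "(\<integral>\<^sup>+z. ennreal (v z powr p) \<partial>lborel) \<noteq> 0"
    proof
      assume "(\<integral>\<^sup>+z. ennreal (v z powr p) \<partial>lborel) = 0"
      then have "AE z in lborel. ennreal (v z powr p) = 0" by (subst (asm) nn_integral_0_iff_AE) auto
      then have "AE z in lborel. v z = 0" by eventually_elim (auto simp: ennreal_eq_0_iff powr_def split: if_splits)
      with nt show False by simp
    qed
    then show ?thesis by (subst nn_integral_multc) (auto simp: ennreal_mult_top)
  qed
  then have "layer (?d - 1) (\<lambda>y. \<integral>\<^sup>+z. ennreal (v z powr p * norm (y - z) powr - k) \<partial>lborel) (x, 0) = \<infinity>" for x :: "real^'n"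
    unfolding layer_boundary_composition[OF v] inf .
  then have "AE y in lborel. y \<notin> (UNIV :: (real^'n) set)"
    using veq c0 by (auto elim!: eventually_mono simp: ennreal_mult_top)
  then have "(UNIV :: (real^'n) set) = {}" by (rule emeasure_zero_imp_empty[OF open_UNIV])
  then show False by simp
qed

text \<open>The kernels of exponents d - 1 and k compose to exponent (d-1) + k - d = k - 1. The
  constant c is fixed before u and p, which later makes the constant of the bubbles the same for all
  solutions.\<close>

lemma positive_solution_riesz:
  fixes lam k :: real
  assumes N: "CARD('n::finite) \<ge> 2" and lam: "lam > 0" and k: "1 < k" "k < real CARD('n)"
  obtains c where "c > 0"
    "\<And>(u :: (real^'n) \<times> real \<Rightarrow> real) p. \<lbrakk>p > 0; pos_solution lam p k u\<rbrakk> \<Longrightarrow>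
      \<exists>v. riesz_solution (real CARD('n)) c (k - 1) p v \<and> (AE y in lborel. btrace u y = v y) \<and>
        (AE X in lborel. X \<in> halfspace \<longrightarrow> ennreal (u X) =
          ennreal (2 * lam / ((real CARD('n) - 1) * sphere_area (CARD('n) + 1))) *
          layer (real CARD('n) - 1) (\<lambda>y. \<integral>\<^sup>+z. ennreal (v z powr p * norm (y - z) powr - k) \<partial>lborel) X)"
proof -
  let ?d = "real CARD('n)"
  define c0 where "c0 = 2 * lam / ((?d - 1) * sphere_area (CARD('n) + 1))"
  have c0: "c0 > 0" using N lam sphere_area_pos[of "CARD('n) + 1"] by (simp add: c0_def)
  obtain \<kappa> where \<kappa>: "\<kappa> > 0" "\<And>x z :: real^'n. x \<noteq> z \<Longrightarrow>
      (\<integral>\<^sup>+y. ennreal (norm (x - y) powr - (?d - 1) * norm (y - z) powr - k) \<partial>lborel) = ennreal (\<kappa> * norm (x - z) powr (?d - (?d - 1) - k))"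
  proof (rule riesz_composition_points[where a="?d - 1" and b=k and 'n='n])
    show "0 < ?d - 1" using N by simp
    show "?d - 1 < ?d" "0 < k" "k < ?d" "?d < ?d - 1 + k" using k by auto
  qed (rule that)
  show thesis
  proof (rule that[of "c0 * \<kappa>"])
    fix u :: "(real^'n) \<times> real \<Rightarrow> real" and p :: real
    assume p: "p > 0" and sol: "pos_solution lam p k u"
    obtain v where v[measurable]: "v \<in> borel_measurable borel" and v0: "\<And>y. 0 \<le> v y" and bv: "AE y in lborel. btrace u y = v y"
      and nt: "\<not> (AE y in lborel. v y = 0)"
      and veq: "AE y in lborel. ennreal (v y) = ennreal c0 * layer (?d - 1) (\<lambda>y. \<integral>\<^sup>+z. ennreal (v z powr p * norm (y - z) powr - k) \<partial>lborel) (y, 0)"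
      and ueq: "AE X in lborel. X \<in> halfspace \<longrightarrow> ennreal (u X) = ennreal c0 * layer (?d - 1) (\<lambda>y. \<integral>\<^sup>+z. ennreal (v z powr p * norm (y - z) powr - k) \<partial>lborel) X"
      by (rule positive_solution_trace[OF N lam sol, folded c0_def]) (rule that)
    have "layer (?d - 1) (\<lambda>y. \<integral>\<^sup>+z. ennreal (v z powr p * norm (y - z) powr - k) \<partial>lborel) (x, 0) =
      ennreal \<kappa> * (\<integral>\<^sup>+z. ennreal (v z powr p * norm (x - z) powr - (k - 1)) \<partial>lborel)" for x
    proof -
      have "layer (?d - 1) (\<lambda>y. \<integral>\<^sup>+z. ennreal (v z powr p * norm (y - z) powr - k) \<partial>lborel) (x, 0) =
         (\<integral>\<^sup>+z. ennreal \<kappa> * ennreal (v z powr p * norm (x - z) powr - (k - 1)) \<partial>lborel)"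
        unfolding layer_boundary_composition[OF v]
      proof (rule nn_integral_cong_AE)
        have "AE z in lborel. z \<noteq> x" by (rule AE_lborel_singleton)
        then show "AE z in lborel. ennreal (v z powr p) * (\<integral>\<^sup>+y. ennreal (norm (x - y) powr - (?d - 1) * norm (y - z) powr - k) \<partial>lborel) =
            ennreal \<kappa> * ennreal (v z powr p * norm (x - z) powr - (k - 1))"
        proof eventually_elim
          fix z assume "z \<noteq> x"
          then have "(\<integral>\<^sup>+y. ennreal (norm (x - y) powr - (?d - 1) * norm (y - z) powr - k) \<partial>lborel) = ennreal (\<kappa> * norm (x - z) powr - (k - 1))"
            using \<kappa>(2)[of x z] by simp
          then show "ennreal (v z powr p) * (\<integral>\<^sup>+y. ennreal (norm (x - y) powr - (?d - 1) * norm (y - z) powr - k) \<partial>lborel) =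
            ennreal \<kappa> * ennreal (v z powr p * norm (x - z) powr - (k - 1))"
            using \<kappa>(1) by (simp add: ennreal_mult mult_ac)
        qed
      qed
      also have "\<dots> = ennreal \<kappa> * (\<integral>\<^sup>+z. ennreal (v z powr p * norm (x - z) powr - (k - 1)) \<partial>lborel)"
        by (rule nn_integral_cmult) measurable
      finally show ?thesis .
    qed
    then have "AE y in lborel. ennreal (v y) = potential (c0 * \<kappa>) (k - 1) p v y"
      using veq c0 \<kappa>(1) by (simp add: potential_def ennreal_mult mult.assoc)
    then have "riesz_solution ?d (c0 * \<kappa>) (k - 1) p v"
      using c0 \<kappa>(1) k p v v0 nt by unfold_locales auto
    with bv ueq show "\<exists>v. riesz_solution ?d (c0 * \<kappa>) (k - 1) p v \<and> (AE y in lborel. btrace u y = v y) \<and>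
        (AE X in lborel. X \<in> halfspace \<longrightarrow> ennreal (u X) =
          ennreal (2 * lam / ((?d - 1) * sphere_area (CARD('n) + 1))) *
          layer (?d - 1) (\<lambda>y. \<integral>\<^sup>+z. ennreal (v z powr p * norm (y - z) powr - k) \<partial>lborel) X)"
      unfolding c0_def by blast
  qed (use c0 \<kappa>(1) in simp)
qed

text \<open>Multiplied by k - 1, the upper bound on p says 2d - g - pg \<ge> 0 with g = k - 1; the
  local integrability passes from the trace to its Borel version v.\<close>

lemma regular_riesz_solution_if_regular:
  fixes u :: "(real^'n) \<times> real \<Rightarrow> real"
  assumes v: "riesz_solution (real CARD('n)) c (k - 1) p v" and bv: "AE y in lborel. btrace u y = v y"
    and reg: "regular k u" and p: "1 \<le> p" "p \<le> 2 * real CARD('n) / (k - 1) - 1"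
  shows "regular_riesz_solution (real CARD('n)) c (k - 1) p v"
proof -
  let ?d = "real CARD('n)" and ?q = "2 * real CARD('n) / (k - 1)"
  have k: "1 < k" using reg by (simp add: regular_def)
  have "(\<integral>\<^sup>+z. ennreal (v z powr ?q) * indicator {z. norm z < R} z \<partial>lborel) < \<infinity>" for R
  proof -
    have "(\<integral>\<^sup>+z. ennreal (v z powr ?q) * indicator {z. norm z < R} z \<partial>lborel) \<le>
      (\<integral>\<^sup>+z. ennreal (\<bar>btrace u z\<bar> powr ?q) * indicator (cball 0 R) z \<partial>lborel)"
    proof (rule nn_integral_mono_AE)
      show "AE z in lborel. ennreal (v z powr ?q) * indicator {z. norm z < R} z \<le> ennreal (\<bar>btrace u z\<bar> powr ?q) * indicator (cball 0 R) z"
        using bv by eventually_elim (use riesz_solution.v_nonneg[OF v] in \<open>auto simp: indicator_def\<close>)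
    qed
    also have "\<dots> < \<infinity>"
      using reg unfolding regular_def in_Lp_loc_def nn_integral_completion by (meson compact_cball)
    finally show ?thesis .
  qed
  moreover have "0 \<le> 2 * ?d - (k - 1) - p * (k - 1)"
  proof -
    have "(p + 1) * (k - 1) \<le> ?q * (k - 1)" using k p by (intro mult_right_mono) auto
    also have "?q * (k - 1) = 2 * ?d" using k by simp
    finally show ?thesis by (simp add: algebra_simps)
  qed
  ultimately show ?thesis
    using v p by (simp add: regular_riesz_solution_def regular_riesz_solution_axioms_def)
qed

section \<open>The explicit solution\<close>

text \<open>Sets aside the vertical line over the origin, where the boundary potential of the
  explicit density is infinite and gives no bound on the potential above it.\<close>

lemma AE_fst_neq_0: "AE X :: (real^'n) \<times> real in lborel. fst X \<noteq> 0"
proof -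
  have [measurable]: "{X :: (real^'n) \<times> real. fst X \<noteq> 0} \<in> sets borel"
    by (intro borel_open open_Collect_neq continuous_intros)
  have "AE X in lborel \<Otimes>\<^sub>M (lborel :: real measure). fst X \<noteq> (0 :: real^'n)"
  proof (rule lborel_pair.AE_pair_measure)
    have "{X \<in> space (lborel \<Otimes>\<^sub>M (lborel :: real measure)). fst X \<noteq> (0 :: real^'n)} = {X :: (real^'n) \<times> real. fst X \<noteq> 0}"
      by (simp add: space_pair_measure)
    then show "{X \<in> space (lborel \<Otimes>\<^sub>M (lborel :: real measure)). fst X \<noteq> (0 :: real^'n)} \<in> sets (lborel \<Otimes>\<^sub>M (lborel :: real measure))"
      unfolding lborel_prod by simp
    have "AE x in lborel. x \<noteq> (0 :: real^'n)" by (rule AE_lborel_singleton)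
    then show "AE x in lborel. AE y in (lborel :: real measure). fst (x, y) \<noteq> (0 :: real^'n)"
      by eventually_elim simp
  qed
  then show ?thesis unfolding lborel_prod .
qed

text \<open>From below the limit is controlled by Fatou's lemma. From above, the potential at X is
  at most its value at the foot point of X on the boundary, which is a continuous power near
  y0.\<close>

lemma layer_power_tendsto:
  fixes y0 :: "real^'n"
  assumes a: "a \<ge> 0" and b: "b \<ge> 0" and y0: "y0 \<noteq> 0"
    and bd: "\<And>x. x \<noteq> 0 \<Longrightarrow> layer a (\<lambda>y. ennreal (norm y powr - b)) (x :: real^'n, 0) = ennreal (\<kappa> * norm x powr s)"
  shows "(layer a (\<lambda>y. ennreal (norm y powr - b)) \<longlongrightarrow> ennreal (\<kappa> * norm y0 powr s)) (at (y0, 0) within halfspace)"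
  unfolding tendsto_at_iff_sequentially
proof (intro allI impI)
  fix X :: "nat \<Rightarrow> (real^'n) \<times> real"
  assume X: "\<forall>i. X i \<in> halfspace - {(y0, 0)}" "X \<longlonglongrightarrow> (y0, 0)"
  let ?F = "layer a (\<lambda>y. ennreal (norm y powr - b))"
  have fst: "(\<lambda>n. fst (X n)) \<longlonglongrightarrow> y0" using tendsto_fst[OF X(2)] by simp
  have lim: "(\<lambda>n. ennreal (\<kappa> * norm (fst (X n)) powr s)) \<longlonglongrightarrow> ennreal (\<kappa> * norm y0 powr s)"
    by (intro tendsto_ennrealI tendsto_mult tendsto_const tendsto_powr tendsto_norm fst) (use y0 in auto)
  show "(?F \<circ> X) \<longlonglongrightarrow> ennreal (\<kappa> * norm y0 powr s)"
    unfolding o_def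
  proof (rule order_tendstoI)
    fix e assume "e < ennreal (\<kappa> * norm y0 powr s)"
    also have "\<dots> = ?F (y0, 0)" using bd[OF y0] by simp
    also have "\<dots> \<le> liminf (\<lambda>n. ?F (X n))"
      by (rule layer_liminf[OF _ _ X(2)]) auto
    finally show "\<forall>\<^sub>F n in sequentially. e < ?F (X n)" by (rule less_LiminfD)
  next
    fix e assume "ennreal (\<kappa> * norm y0 powr s) < e"
    with lim have "\<forall>\<^sub>F n in sequentially. ennreal (\<kappa> * norm (fst (X n)) powr s) < e" by (rule order_tendstoD)
    moreover have "\<forall>\<^sub>F n in sequentially. fst (X n) \<noteq> 0"
      using fst y0 by (rule tendsto_imp_eventually_ne)
    ultimately show "\<forall>\<^sub>F n in sequentially. ?F (X n) < e"
    proof eventually_elim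
      fix n assume e: "ennreal (\<kappa> * norm (fst (X n)) powr s) < e" and nz: "fst (X n) \<noteq> 0"
      have "?F (X n) \<le> ?F (fst (X n), 0)"
        using layer_le_boundary[OF a, of _ "fst (X n)" "snd (X n)"] by simp
      also have "\<dots> < e" using e unfolding bd[OF nz] .
      finally show "?F (X n) < e" .
    qed
  qed
qed

text \<open>f is prescribed only off the origin, because nothing is known about the trace of the
  explicit solution there.\<close>

lemma power_in_Lp_loc_iff:
  fixes f :: "real^'n \<Rightarrow> real"
  assumes A: "A > 0" and q: "q > 0" and f: "\<And>y. y \<noteq> 0 \<Longrightarrow> f y = A * norm y powr - s" and s: "s \<ge> 0"
  shows "in_Lp_loc q f \<longleftrightarrow> s * q < real CARD('n)"
proof -
  have "f = (\<lambda>y. if y = 0 then f 0 else A * norm y powr - s)" using f by auto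
  also have "\<dots> \<in> borel_measurable borel" by measurable
  finally have fm: "f \<in> borel_measurable borel" .
  have int: "(\<integral>\<^sup>+y\<in>K. ennreal (\<bar>f y\<bar> powr q) \<partial>lebesgue) = ennreal (A powr q) * radial_power (s * q) K"
    if [measurable]: "K \<in> sets borel" for K
  proof -
    have "(\<integral>\<^sup>+y\<in>K. ennreal (\<bar>f y\<bar> powr q) \<partial>lebesgue) = (\<integral>\<^sup>+y. ennreal (A powr q) * (ennreal (norm y powr - (s * q)) * indicator K y) \<partial>lborel)"
      unfolding nn_integral_completion
    proof (rule nn_integral_cong_AE)
      have "AE y in lborel. y \<noteq> (0 :: real^'n)" by (rule AE_lborel_singleton)
      then show "AE y in lborel. ennreal (\<bar>f y\<bar> powr q) * indicator K y = ennreal (A powr q) * (ennreal (norm y powr - (s * q)) * indicator K y)"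
        by eventually_elim (use A in \<open>simp add: f powr_mult powr_powr ennreal_mult mult.assoc\<close>)
    qed
    also have "\<dots> = ennreal (A powr q) * radial_power (s * q) K"
      unfolding radial_power_def by (rule nn_integral_cmult) measurable
    finally show ?thesis .
  qed
  show ?thesis
  proof
    assume L: "in_Lp_loc q f"
    show "s * q < real CARD('n)"
    proof (rule ccontr)
      assume "\<not> ?thesis"
      then have "radial_power (s * q) {y::real^'n. norm y < 1} = \<infinity>" by (intro radial_power_inside_infinite) auto
      then have "radial_power (s * q) (cball (0::real^'n) 1) = \<infinity>"
        using radial_power_mono[of "{y::real^'n. norm y < 1}" "cball 0 1" "s * q"]
        by (simp add: top_unique subset_iff)
      then have "(\<integral>\<^sup>+y\<in>cball 0 1. ennreal (\<bar>f y\<bar> powr q) \<partial>lebesgue) = \<infinity>"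
        using A by (simp add: int ennreal_mult_top)
      moreover have "(\<integral>\<^sup>+y\<in>cball 0 1. ennreal (\<bar>f y\<bar> powr q) \<partial>lebesgue) < \<infinity>"
        using L unfolding in_Lp_loc_def by (meson compact_cball)
      ultimately show False by simp
    qed
  next
    assume sq: "s * q < real CARD('n)"
    have "(\<integral>\<^sup>+y\<in>K. ennreal (\<bar>f y\<bar> powr q) \<partial>lebesgue) < \<infinity>" if K: "compact K" for K
    proof -
      obtain R where R: "R > 0" "\<And>y. y \<in> K \<Longrightarrow> norm y < R"
        using compact_imp_bounded[OF K] by (auto simp: bounded_pos_less)
      have "radial_power (s * q) K \<le> radial_power (s * q) {y::real^'n. norm y < R}" using R(2) by (intro radial_power_mono) auto
      also have "\<dots> < \<infinity>" using sq R(1) by (intro radial_power_inside) auto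
      finally show ?thesis using compact_imp_closed[OF K] by (subst int) (auto simp: ennreal_mult_less_top)
    qed
    then show "in_Lp_loc q f" using fm by (simp add: in_Lp_loc_def measurable_completion)
  qed
qed

text \<open>The trace of the layer potential of |y|^-\<beta> is a multiple of |y|^-(\<beta>-1). Its
  p-th power, composed with the kernel of exponent k, is a multiple of |y|^-\<beta> again precisely
  when (\<beta>-1)p + k - d = \<beta>, which determines \<beta>. The remaining factor is absorbed in
  C since p \<noteq> 1. Both compositions converge because 1 < \<beta> < k, and \<beta> < k is
  equivalent to p(k-1) > d.\<close>

lemma explicit_solution:
  fixes lam p k :: real
  assumes N: "CARD('n::finite) \<ge> 2" and lam: "lam > 0" and k: "1 < k" "k < real CARD('n)"
    and p: "p > real CARD('n) / (k - 1)"
  obtains C where "C > 0"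
    "pos_solution lam p k (\<lambda>x :: (real^'n) \<times> real. C * enn2real (layer (real CARD('n) - 1) (\<lambda>y. ennreal (norm y powr - (1 + (real CARD('n) + 1 - k) / (p - 1)))) x))"
    "regular k (\<lambda>x :: (real^'n) \<times> real. C * enn2real (layer (real CARD('n) - 1) (\<lambda>y. ennreal (norm y powr - (1 + (real CARD('n) + 1 - k) / (p - 1)))) x))
       \<longleftrightarrow> p > 2 * real CARD('n) / (k - 1) - 1"
proof -
  define d where "d = real CARD('n)"
  define \<beta> where "\<beta> = 1 + (d + 1 - k) / (p - 1)"
  define c0 where "c0 = 2 * lam / ((d - 1) * sphere_area (CARD('n) + 1))"
  have c0: "c0 > 0" using N lam sphere_area_pos[of "CARD('n) + 1"] by (simp add: c0_def d_def)
  have d2: "d \<ge> 2" using N by (simp add: d_def)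
  have kd: "k < d" using k by (simp add: d_def)
  have pk: "p * (k - 1) > d" using p k by (simp add: d_def field_simps)
  have p1: "p > 1"
  proof (rule ccontr)
    assume "\<not> ?thesis"
    then have "p * (k - 1) \<le> 1 * (k - 1)" using k by (intro mult_right_mono) auto
    with pk kd show False by simp
  qed
  have \<beta>1: "\<beta> > 1" using p1 kd by (simp add: \<beta>_def)
  have \<beta>k: "\<beta> < k" using p1 pk by (simp add: \<beta>_def field_simps)
  define a1 where "a1 = (\<beta> - 1) * p"
  \<comment> \<open>The equation that determines \<beta>; here N - k is d + 1 - k.\<close>
  have a1_eq: "a1 + k - d = \<beta>" using p1 by (simp add: a1_def \<beta>_def field_simps)
  have a1: "0 < a1" "a1 < d" "k + a1 > d" using \<beta>1 p1 a1_eq \<beta>k by (auto simp: a1_def)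
  obtain \<kappa>1 where \<kappa>1: "\<kappa>1 > 0" "\<And>x :: real^'n. x \<noteq> 0 \<Longrightarrow>
      (\<integral>\<^sup>+y. ennreal (norm (x - y) powr - (d - 1) * norm y powr - \<beta>) \<partial>lborel) = ennreal (\<kappa>1 * norm x powr (d - (d - 1) - \<beta>))"
  proof (rule riesz_composition[where a="d - 1" and b=\<beta> and 'n='n, folded d_def])
    show "0 < d - 1" "d - 1 < d" "0 < \<beta>" "\<beta> < d" "d < d - 1 + \<beta>"
      using d2 \<beta>1 \<beta>k kd by auto
  qed (rule that)
  obtain \<kappa>2 where \<kappa>2: "\<kappa>2 > 0" "\<And>x :: real^'n. x \<noteq> 0 \<Longrightarrow>
      (\<integral>\<^sup>+y. ennreal (norm (x - y) powr - k * norm y powr - a1) \<partial>lborel) = ennreal (\<kappa>2 * norm x powr (d - k - a1))"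
  proof (rule riesz_composition[where a=k and b=a1 and 'n='n, folded d_def])
    show "0 < k" "k < d" "0 < a1" "a1 < d" "d < k + a1"
      using k kd a1 by auto
  qed (rule that)
  define F where "F = layer (d - 1) (\<lambda>y :: real^'n. ennreal (norm y powr - \<beta>))"
  have [measurable]: "F \<in> borel_measurable borel" unfolding F_def by measurable
  have F_bd: "F (x, 0) = ennreal (\<kappa>1 * norm x powr (1 - \<beta>))" if "x \<noteq> 0" for x
    using \<kappa>1(2)[OF that] by (simp add: F_def layer_def ennreal_mult)
  have F_fin: "F X < \<infinity>" if "fst X \<noteq> 0" for X
  proof -
    have "F X \<le> F (fst X, 0)" unfolding F_def using layer_le_boundary[of "d - 1" _ "fst X" "snd X"] d2 by simp
    also have "\<dots> < \<infinity>" unfolding F_bd[OF that] by simp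
    finally show ?thesis .
  qed
  have F_pos: "F X > 0" if "X \<in> halfspace" for X
    unfolding F_def layer_def
  proof (rule nn_integral_pos_if_AE_pos)
    define G where "G y = X - (y, 0)" for y :: "real^'n"
    have [measurable]: "G \<in> borel_measurable borel"
      unfolding G_def by (intro borel_measurable_continuous_onI continuous_intros)
    have "(\<lambda>y. ennreal (norm (G y) powr - (d - 1)) * ennreal (norm y powr - \<beta>)) \<in> borel_measurable borel" by measurable
    then show "(\<lambda>y. ennreal (norm (X - (y, 0)) powr - (d - 1)) * ennreal (norm y powr - \<beta>)) \<in> borel_measurable borel"
      unfolding G_def .
    have "AE y in lborel. y \<noteq> (0 :: real^'n)" by (rule AE_lborel_singleton)
    then show "AE y in lborel. 0 < ennreal (norm (X - (y, 0)) powr - (d - 1)) * ennreal (norm y powr - \<beta>)"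
    proof eventually_elim
      fix y :: "real^'n" assume "y \<noteq> 0"
      moreover have "X - (y, 0) \<noteq> 0" using that by (cases X) (auto simp: halfspace_def zero_prod_def)
      ultimately show "0 < ennreal (norm (X - (y, 0)) powr - (d - 1)) * ennreal (norm y powr - \<beta>)"
        by (simp add: ennreal_mult[symmetric])
    qed
  qed
  define D where "D = c0 * \<kappa>1 powr p * \<kappa>2"
  have D: "D > 0" using c0 \<kappa>1(1) \<kappa>2(1) by (simp add: D_def)
  \<comment> \<open>One passage through the equation multiplies the amplitude C into D C^p, so C
    must solve C^(p-1) D = 1.\<close>
  define C where "C = D powr (- 1 / (p - 1))"
  have C: "C > 0" using D by (simp add: C_def)
  have CD: "C powr p * D = C"
  proof -
    have "C powr (p - 1) = D powr - 1" using p1 by (simp add: C_def powr_powr)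
    then have "C powr (p - 1) * D = 1" using D by (simp add: powr_minus)
    moreover have "C powr p = C powr (p - 1) * C" using C by (simp add: powr_diff)
    ultimately show ?thesis by (metis mult.assoc mult.commute mult_1)
  qed
  define u where "u x = C * enn2real (F x)" for x
  define b where "b y = C * \<kappa>1 * norm y powr - (\<beta> - 1)" for y :: "real^'n"
  have u_lim: "(u \<longlongrightarrow> b y) (at (y, 0) within halfspace)" if y: "y \<noteq> 0" for y
  proof -
    have "(F \<longlongrightarrow> ennreal (\<kappa>1 * norm y powr (1 - \<beta>))) (at (y, 0) within halfspace)"
      unfolding F_def by (rule layer_power_tendsto[OF _ _ y]) (use d2 \<beta>1 F_bd in \<open>auto simp: F_def\<close>)
    then have "((\<lambda>x. enn2real (F x)) \<longlongrightarrow> \<kappa>1 * norm y powr (1 - \<beta>)) (at (y, 0) within halfspace)"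
      using \<kappa>1(1) by (intro tendsto_enn2real) auto
    then have "(u \<longlongrightarrow> C * (\<kappa>1 * norm y powr (1 - \<beta>))) (at (y, 0) within halfspace)"
      unfolding u_def by (intro tendsto_mult tendsto_const)
    then show ?thesis by (simp add: b_def mult.assoc)
  qed
  have bt: "btrace u y = b y" if "y \<noteq> 0" for y by (rule btrace_eq[OF u_lim[OF that]])
  have AE0: "AE y in lborel. y \<noteq> (0 :: real^'n)" by (rule AE_lborel_singleton)
  have b_int: "(\<integral>\<^sup>+z. ennreal (btrace u z powr p * norm (y - z) powr - k) \<partial>lborel) = ennreal ((C * \<kappa>1) powr p * \<kappa>2 * norm y powr - \<beta>)"
    if y: "y \<noteq> 0" for y
  proof -
    have "(\<integral>\<^sup>+z. ennreal (btrace u z powr p * norm (y - z) powr - k) \<partial>lborel) =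
      (\<integral>\<^sup>+z. ennreal ((C * \<kappa>1) powr p) * ennreal (norm (y - z) powr - k * norm z powr - a1) \<partial>lborel)"
    proof (rule nn_integral_cong_AE)
      show "AE z in lborel. ennreal (btrace u z powr p * norm (y - z) powr - k) =
          ennreal ((C * \<kappa>1) powr p) * ennreal (norm (y - z) powr - k * norm z powr - a1)"
        using AE0
      proof eventually_elim
        fix z :: "real^'n" assume z: "z \<noteq> 0"
        have "btrace u z powr p = (C * \<kappa>1 * norm z powr - (\<beta> - 1)) powr p" by (simp only: bt[OF z] b_def)
        also have "\<dots> = (C * \<kappa>1) powr p * norm z powr (- (\<beta> - 1) * p)" by (simp only: powr_mult powr_powr)
        also have "- (\<beta> - 1) * p = - a1" by (simp add: a1_def algebra_simps)
        finally show "ennreal (btrace u z powr p * norm (y - z) powr - k) =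
          ennreal ((C * \<kappa>1) powr p) * ennreal (norm (y - z) powr - k * norm z powr - a1)"
          by (simp only: ennreal_mult[symmetric] powr_ge_zero mult_nonneg_nonneg mult_ac)
      qed
    qed
    also have "\<dots> = ennreal ((C * \<kappa>1) powr p) * (\<integral>\<^sup>+z. ennreal (norm (y - z) powr - k * norm z powr - a1) \<partial>lborel)"
      by (rule nn_integral_cmult) measurable
    also have "\<dots> = ennreal ((C * \<kappa>1) powr p * \<kappa>2 * norm y powr (d - k - a1))"
      unfolding \<kappa>2(2)[OF y] using \<kappa>2(1) by (simp add: ennreal_mult mult.assoc)
    also have "d - k - a1 = - \<beta>" using a1_eq by simp
    finally show ?thesis .
  qed
  define E where "E = (C * \<kappa>1) powr p * \<kappa>2"
  have E0: "E \<ge> 0" using \<kappa>2(1) by (simp add: E_def)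
  have c0E: "c0 * E = C"
    using CD by (simp add: E_def D_def powr_mult mult_ac)
  have layer_b: "layer (d - 1) (\<lambda>y. \<integral>\<^sup>+z. ennreal (btrace u z powr p * norm (y - z) powr - k) \<partial>lborel) X = ennreal E * F X" for X
  proof -
    define G where "G y = X - (y, 0)" for y :: "real^'n"
    have [measurable]: "G \<in> borel_measurable borel"
      unfolding G_def by (intro borel_measurable_continuous_onI continuous_intros)
    have "layer (d - 1) (\<lambda>y. \<integral>\<^sup>+z. ennreal (btrace u z powr p * norm (y - z) powr - k) \<partial>lborel) X =
       (\<integral>\<^sup>+y. ennreal E * (ennreal (norm (G y) powr - (d - 1)) * ennreal (norm y powr - \<beta>)) \<partial>lborel)"
      unfolding layer_def G_def
    proof (rule nn_integral_cong_AE)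
      show "AE y in lborel. ennreal (norm (X - (y, 0)) powr - (d - 1)) * (\<integral>\<^sup>+z. ennreal (btrace u z powr p * norm (y - z) powr - k) \<partial>lborel) =
          ennreal E * (ennreal (norm (X - (y, 0)) powr - (d - 1)) * ennreal (norm y powr - \<beta>))"
        using AE0
      proof eventually_elim
        fix y :: "real^'n" assume y: "y \<noteq> 0"
        show "ennreal (norm (X - (y, 0)) powr - (d - 1)) * (\<integral>\<^sup>+z. ennreal (btrace u z powr p * norm (y - z) powr - k) \<partial>lborel) =
          ennreal E * (ennreal (norm (X - (y, 0)) powr - (d - 1)) * ennreal (norm y powr - \<beta>))"
          unfolding b_int[OF y] E_def[symmetric] ennreal_mult[OF E0 powr_ge_zero] by (simp only: mult_ac)
      qed
    qed
    also have "\<dots> = ennreal E * F X"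
      unfolding F_def layer_def G_def[symmetric] by (rule nn_integral_cmult) measurable
    finally show ?thesis .
  qed
  have Hu_eq: "Hu p k u y = (\<integral>\<^sup>+z. ennreal (btrace u z powr p * norm (y - z) powr - k) \<partial>lborel)" for y
    unfolding Hu_def nn_integral_completion by (simp add: powr_minus divide_inverse)
  have fin_AE: "AE X in lborel. F X < \<infinity>"
    using AE_fst_neq_0 by eventually_elim (rule F_fin)
  have sol: "pos_solution lam p k u"
    unfolding pos_solution_def AE_lebesgue_iff nn_integral_completion
  proof (intro conjI)
    have "u \<in> borel_measurable borel" unfolding u_def by measurable
    then show "u \<in> borel_measurable (restrict_space lebesgue halfspace)"
      by (intro measurable_restrict_space1 measurable_completion) simp
    show "AE x in lborel. x \<in> halfspace \<longrightarrow> 0 < u x"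
      using fin_AE by eventually_elim (use F_pos C in \<open>auto simp: u_def enn2real_positive_iff\<close>)
    show "AE y in lborel. \<exists>L. (u \<longlongrightarrow> L) (at (y, 0) within halfspace)"
      using AE0 by eventually_elim (use u_lim in blast)
    show "AE y in lborel. Hu p k u y < \<infinity>"
      unfolding Hu_eq using AE0 by eventually_elim (simp add: b_int)
    have Hu_layer: "(\<integral>\<^sup>+ y. Hu p k u y * ennreal (1 / norm (x - (y, 0)) powr (real CARD('n) - 1)) \<partial>lborel) = ennreal E * F x" for x
    proof -
      have "1 / A powr (real CARD('n) - 1) = A powr - (d - 1)" for A :: real
        by (simp only: d_def powr_minus divide_inverse mult_1)
      then show ?thesis unfolding Hu_eq layer_b[symmetric] layer_def by (simp only: mult.commute)
    qed
    show "AE x in lborel. x \<in> halfspace \<longrightarrow> (\<integral>\<^sup>+ y. Hu p k u y * ennreal (1 / norm (x - (y, 0)) powr (real CARD('n) - 1)) \<partial>lborel) < \<infinity>"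
      unfolding Hu_layer using fin_AE by eventually_elim (simp add: ennreal_mult_less_top)
    have inner: "(\<integral>\<^sup>+ z. ennreal (btrace u z powr p / (norm (x - (y, 0)) powr (real CARD('n) - 1) * norm (y - z) powr k)) \<partial>lborel) =
        ennreal (norm (x - (y, 0)) powr - (d - 1)) * (\<integral>\<^sup>+z. ennreal (btrace u z powr p * norm (y - z) powr - k) \<partial>lborel)" for x y
    proof -
      have "btrace u = (\<lambda>y. if y = 0 then btrace u 0 else b y)" using bt by auto
      also have "\<dots> \<in> borel_measurable borel" unfolding b_def by measurable
      finally have [measurable]: "btrace u \<in> borel_measurable borel" .
      have split: "P / (A powr (real CARD('n) - 1) * B powr k) = A powr - (d - 1) * (P * B powr - k)" for A B P :: real
        by (simp only: d_def powr_minus divide_inverse inverse_mult_distrib mult_ac)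
      have "(\<integral>\<^sup>+ z. ennreal (btrace u z powr p / (norm (x - (y, 0)) powr (real CARD('n) - 1) * norm (y - z) powr k)) \<partial>lborel) =
        (\<integral>\<^sup>+ z. ennreal (norm (x - (y, 0)) powr - (d - 1)) * ennreal (btrace u z powr p * norm (y - z) powr - k) \<partial>lborel)"
        by (intro nn_integral_cong) (simp only: split ennreal_mult[symmetric] powr_ge_zero mult_nonneg_nonneg)
      also have "\<dots> = ennreal (norm (x - (y, 0)) powr - (d - 1)) * (\<integral>\<^sup>+z. ennreal (btrace u z powr p * norm (y - z) powr - k) \<partial>lborel)"
        by (rule nn_integral_cmult) measurable
      finally show ?thesis .
    qed
    show "AE x in lborel. x \<in> halfspace \<longrightarrow> ennreal (u x) =
          ennreal (2 * lam / ((real CARD('n) - 1) * sphere_area (CARD('n) + 1))) *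
          (\<integral>\<^sup>+ y. \<integral>\<^sup>+ z. ennreal (btrace u z powr p /
               (norm (x - (y, 0)) powr (real CARD('n) - 1) * norm (y - z) powr k)) \<partial>lborel \<partial>lborel)"
      using fin_AE
    proof eventually_elim
      fix x assume fx: "F x < \<infinity>"
      have "ennreal c0 * (\<integral>\<^sup>+ y. \<integral>\<^sup>+ z. ennreal (btrace u z powr p /
               (norm (x - (y, 0)) powr (real CARD('n) - 1) * norm (y - z) powr k)) \<partial>lborel \<partial>lborel) = ennreal c0 * (ennreal E * F x)"
        unfolding inner layer_b[symmetric] layer_def ..
      also have "\<dots> = ennreal (c0 * E) * F x" using c0 E0 by (simp add: ennreal_mult mult.assoc)
      also have "\<dots> = ennreal C * ennreal (enn2real (F x))" using fx by (simp add: c0E)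
      also have "\<dots> = ennreal (u x)" using C by (simp add: u_def ennreal_mult)
      finally show "x \<in> halfspace \<longrightarrow> ennreal (u x) =
          ennreal (2 * lam / ((real CARD('n) - 1) * sphere_area (CARD('n) + 1))) *
          (\<integral>\<^sup>+ y. \<integral>\<^sup>+ z. ennreal (btrace u z powr p /
               (norm (x - (y, 0)) powr (real CARD('n) - 1) * norm (y - z) powr k)) \<partial>lborel \<partial>lborel)"
        by (simp add: c0_def d_def)
    qed
  qed
  have "in_Lp_loc (2 * d / (k - 1)) (btrace u) \<longleftrightarrow> (\<beta> - 1) * (2 * d / (k - 1)) < d"
    unfolding d_def using bt C \<kappa>1(1) \<beta>1 k d2
    by (intro power_in_Lp_loc_iff[where A="C * \<kappa>1"]) (auto simp: b_def d_def)
  also have "\<dots> \<longleftrightarrow> p > 2 * d / (k - 1) - 1"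
  proof -
    have pos: "(p - 1) * (k - 1) > 0" using p1 k by simp
    have "(\<beta> - 1) * (2 * d / (k - 1)) = d * (2 * (d + 1 - k) / ((p - 1) * (k - 1)))"
      by (simp add: \<beta>_def)
    also have "\<dots> < d * 1 \<longleftrightarrow> 2 * (d + 1 - k) < (p - 1) * (k - 1)"
      using d2 pos by (subst mult_less_cancel_left_pos) (simp_all add: divide_less_eq)
    also have "\<dots> \<longleftrightarrow> 2 * d < (p + 1) * (k - 1)" by (simp add: algebra_simps)
    also have "\<dots> \<longleftrightarrow> p > 2 * d / (k - 1) - 1" using k by (simp add: divide_less_eq diff_less_eq)
    finally show ?thesis by simp
  qed
  finally have reg: "regular k u \<longleftrightarrow> p > 2 * d / (k - 1) - 1"
    using k by (simp add: regular_def d_def)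
  have u_eq: "u = (\<lambda>x. C * enn2real (layer (real CARD('n) - 1) (\<lambda>y. ennreal (norm y powr - (1 + (real CARD('n) + 1 - k) / (p - 1)))) x))"
    by (simp add: fun_eq_iff u_def F_def \<beta>_def d_def)
  show thesis
    by (rule that[OF C sol[unfolded u_eq] reg[unfolded u_eq d_def]])
qed

section \<open>The amplitude of the bubbles and the four assertions\<close>

text \<open>As p \<noteq> 1, the equation at the centre can be solved for B, so all bubbles share
  one amplitude. Finiteness of J needs no estimate: an infinite J is incompatible with the finite
  left-hand side.\<close>

lemma bubble_amplitude_unique:
  fixes c p B :: real and J :: ennreal
  assumes "c > 0" "p > 1" "B > 0" and eq: "ennreal B = ennreal (c * B powr p) * J"
  shows "B = (1 / (c * enn2real J)) powr (1 / (p - 1))"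
proof -
  have cB: "c * B powr p > 0" using assms by simp
  have "J \<noteq> \<infinity>"
  proof
    assume "J = \<infinity>"
    then have "ennreal B = \<infinity>" using eq assms(1,3) by (simp add: ennreal_mult_top)
    then show False by simp
  qed
  then obtain j where j: "J = ennreal j" "j \<ge> 0" by (cases J) auto
  have "B = c * B powr p * j"
    using eq cB assms(3) unfolding j(1) by (simp add: ennreal_mult[symmetric] j(2))
  also have "B powr p = B powr (p - 1) * B" using assms(3) by (simp add: powr_diff)
  finally have "1 * B = (c * j * B powr (p - 1)) * B" by (simp only: mult_1 mult_ac)
  then have 1: "1 = c * j * B powr (p - 1)" using assms(3) by (metis less_irrefl mult_right_cancel)
  then have "c * j \<noteq> 0" by auto
  then have "B powr (p - 1) = 1 / (c * j)" using 1 by (simp add: field_simps)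
  then have "(B powr (p - 1)) powr (1 / (p - 1)) = (1 / (c * j)) powr (1 / (p - 1))" by simp
  then show ?thesis using assms j by (simp add: powr_powr)
qed

lemma layer_bubble:
  fixes v :: "real^'n \<Rightarrow> real" and \<zeta> :: "real^'n"
  assumes v: "AE z in lborel. v z = B * (t / (t\<^sup>2 + (norm (z - \<zeta>))\<^sup>2)) powr (g / 2)"
    and s: "p * g / 2 = s" and t: "t > 0" and B: "B > 0"
  shows "layer a (\<lambda>y. \<integral>\<^sup>+z. ennreal (v z powr p * norm (y - z) powr - k) \<partial>lborel) X =
    ennreal (B powr p) * (\<integral>\<^sup>+y. \<integral>\<^sup>+z. ennreal ((t / (t\<^sup>2 + (norm (z - \<zeta>))\<^sup>2)) powr s /
        (norm (X - (y, 0)) powr a * norm (y - z) powr k)) \<partial>lborel \<partial>lborel)"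
proof -
  define T where "T z = (t / (t\<^sup>2 + (norm (z - \<zeta>))\<^sup>2)) powr s" for z
  have [measurable]: "T \<in> borel_measurable borel" unfolding T_def by measurable
  define I where "I y = (\<integral>\<^sup>+z. ennreal (T z * norm (y - z) powr - k) \<partial>lborel)" for y
  have [measurable]: "I \<in> borel_measurable borel"
    unfolding I_def by (rule lborel.borel_measurable_nn_integral) (simp add: case_prod_unfold)
  define G where "G y = X - (y, 0)" for y :: "real^'n"
  have [measurable]: "G \<in> borel_measurable borel"
    unfolding G_def by (intro borel_measurable_continuous_onI continuous_intros)
  have "(\<integral>\<^sup>+z. ennreal (v z powr p * norm (y - z) powr - k) \<partial>lborel) = ennreal (B powr p) * I y" for y
  proof -
    have "(\<integral>\<^sup>+z. ennreal (v z powr p * norm (y - z) powr - k) \<partial>lborel) =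
        (\<integral>\<^sup>+z. ennreal (B powr p) * ennreal (T z * norm (y - z) powr - k) \<partial>lborel)"
    proof (rule nn_integral_cong_AE)
      show "AE z in lborel. ennreal (v z powr p * norm (y - z) powr - k) = ennreal (B powr p) * ennreal (T z * norm (y - z) powr - k)"
        using v
      proof eventually_elim
        fix z assume vz: "v z = B * (t / (t\<^sup>2 + (norm (z - \<zeta>))\<^sup>2)) powr (g / 2)"
        have "v z powr p = B powr p * T z"
          unfolding vz T_def s[symmetric] by (simp add: powr_mult powr_powr mult.commute)
        then show "ennreal (v z powr p * norm (y - z) powr - k) = ennreal (B powr p) * ennreal (T z * norm (y - z) powr - k)"
          by (simp add: ennreal_mult T_def mult.assoc)
      qed
    qed
    also have "\<dots> = ennreal (B powr p) * I y" unfolding I_def by (rule nn_integral_cmult) measurable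
    finally show ?thesis .
  qed
  then have "layer a (\<lambda>y. \<integral>\<^sup>+z. ennreal (v z powr p * norm (y - z) powr - k) \<partial>lborel) X =
      (\<integral>\<^sup>+y. ennreal (B powr p) * (ennreal (norm (G y) powr - a) * I y) \<partial>lborel)"
    unfolding layer_def by (simp add: G_def mult.left_commute)
  also have "\<dots> = ennreal (B powr p) * (\<integral>\<^sup>+y. ennreal (norm (G y) powr - a) * I y \<partial>lborel)"
    by (rule nn_integral_cmult) measurable
  also have "(\<integral>\<^sup>+y. ennreal (norm (G y) powr - a) * I y \<partial>lborel) =
      (\<integral>\<^sup>+y. \<integral>\<^sup>+z. ennreal (T z / (norm (G y) powr a * norm (y - z) powr k)) \<partial>lborel \<partial>lborel)"
  proof (rule nn_integral_cong)
    fix y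
    have "(\<integral>\<^sup>+z. ennreal (T z / (norm (G y) powr a * norm (y - z) powr k)) \<partial>lborel) =
        (\<integral>\<^sup>+z. ennreal (norm (G y) powr - a) * ennreal (T z * norm (y - z) powr - k) \<partial>lborel)"
      by (intro nn_integral_cong) (simp add: ennreal_mult'[symmetric] powr_minus divide_inverse mult_ac)
    also have "\<dots> = ennreal (norm (G y) powr - a) * I y" unfolding I_def by (rule nn_integral_cmult) measurable
    finally show "ennreal (norm (G y) powr - a) * I y = (\<integral>\<^sup>+z. ennreal (T z / (norm (G y) powr a * norm (y - z) powr k)) \<partial>lborel)" by simp
  qed
  finally show ?thesis unfolding T_def G_def .
qed

theorem theorem1p2:
  fixes lam p k :: real
  assumes N3: "CARD('n::finite) \<ge> 2"
    and k0: "0 < k" and kN: "k < real CARD('n)"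
    and p0: "p > 0" and lam0: "lam > 0"
  shows
   "(((k \<le> 1 \<or> (1 < k \<and> p < real CARD('n) / (k - 1))) \<longrightarrow>
        \<not> (\<exists>u :: (real^'n) \<times> real \<Rightarrow> real. pos_solution lam p k u)) \<and>
     ((1 < k \<and> p = real CARD('n) / (k - 1)) \<longrightarrow>
        \<not> (\<exists>u :: (real^'n) \<times> real \<Rightarrow> real. pos_solution lam p k u \<and> in_Lp p (btrace u))))
    \<and>
    ((1 < k \<and> p > real CARD('n) / (k - 1)) \<longrightarrow>
      (\<exists>C>0. let u = (\<lambda>x :: (real^'n) \<times> real. C * enn2real (\<integral>\<^sup>+ y.
                 ennreal (1 / (norm (x - (y, 0)) powr (real CARD('n) - 1) *
                               norm y powr (1 + (real CARD('n) + 1 - k) / (p - 1)))) \<partial>lebesgue))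
             in pos_solution lam p k u \<and>
                (regular k u \<longleftrightarrow> p > 2 * real CARD('n) / (k - 1) - 1)))
    \<and>
    ((1 < k \<and> p < 2 * real CARD('n) / (k - 1) - 1) \<longrightarrow>
      \<not> (\<exists>u :: (real^'n) \<times> real \<Rightarrow> real. pos_solution lam p k u \<and> regular k u))
    \<and>
    ((1 < k \<and> p = 2 * real CARD('n) / (k - 1) - 1) \<longrightarrow>
      (\<exists>C>0. \<forall>u :: (real^'n) \<times> real \<Rightarrow> real. pos_solution lam p k u \<and> regular k u \<longrightarrow>
         (\<exists>\<zeta> :: real^'n. \<exists>t>0. AE x in lebesgue. x \<in> halfspace \<longrightarrow>
            ennreal (u x) = ennreal C *
              (\<integral>\<^sup>+ y. \<integral>\<^sup>+ z. ennreal ((t / (t\<^sup>2 + (norm (z - \<zeta>))\<^sup>2)) powr (real CARD('n) + 1 - (k + 1) / 2) /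
                  (norm (x - (y, 0)) powr (real CARD('n) - 1) * norm (y - z) powr k)) \<partial>lebesgue \<partial>lebesgue))))"
proof -
  let ?d = "real CARD('n)"
  define c0 where "c0 = 2 * lam / ((?d - 1) * sphere_area (CARD('n) + 1))"
  have c0: "c0 > 0" using N3 lam0 sphere_area_pos[of "CARD('n) + 1"] by (simp add: c0_def)
  \<comment> \<open>For k > 1 this one inequality serves twice: it is the nonexistence assertion,
    and it forces p > 1 in the study of regular solutions.\<close>
  have supercritical_mass: "p * (k - 1) > ?d" if k1: "1 < k" and sol: "pos_solution lam p k u" for u :: "(real^'n) \<times> real \<Rightarrow> real"
  proof -
    obtain c where c: "c > 0" "\<And>(u :: (real^'n) \<times> real \<Rightarrow> real) p. \<lbrakk>p > 0; pos_solution lam p k u\<rbrakk> \<Longrightarrow>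
      \<exists>v. riesz_solution ?d c (k - 1) p v \<and> (AE y in lborel. btrace u y = v y) \<and>
        (AE X in lborel. X \<in> halfspace \<longrightarrow> ennreal (u X) = ennreal c0 *
          layer (?d - 1) (\<lambda>y. \<integral>\<^sup>+z. ennreal (v z powr p * norm (y - z) powr - k) \<partial>lborel) X)"
      by (rule positive_solution_riesz[OF N3 lam0 k1 kN, folded c0_def]) (rule that)
    from c(2)[OF p0 sol] obtain v :: "real^'n \<Rightarrow> real" where "riesz_solution ?d c (k - 1) p v" by blast
    then show ?thesis by (rule riesz_solution.no_solution_small_exponent)
  qed
  have i: "\<not> pos_solution lam p k u" if "k \<le> 1 \<or> (1 < k \<and> p \<le> ?d / (k - 1))" for u :: "(real^'n) \<times> real \<Rightarrow> real"
  proof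
    assume sol: "pos_solution lam p k u"
    then have k1: "1 < k" using no_positive_solution_k_le_1[OF N3 lam0 k0] by (meson not_le)
    with that have "p * (k - 1) \<le> ?d" by (simp add: field_simps)
    with supercritical_mass[OF k1 sol] show False by simp
  qed
  have ii: "\<exists>C>0. let u = (\<lambda>x :: (real^'n) \<times> real. C * enn2real (\<integral>\<^sup>+ y.
                 ennreal (1 / (norm (x - (y, 0)) powr (?d - 1) *
                               norm y powr (1 + (?d + 1 - k) / (p - 1)))) \<partial>lebesgue))
             in pos_solution lam p k u \<and> (regular k u \<longleftrightarrow> p > 2 * ?d / (k - 1) - 1)"
    if "1 < k" "p > ?d / (k - 1)"
  proof -
    have layer: "(\<integral>\<^sup>+ y. ennreal (1 / (norm (x - (y, 0)) powr (?d - 1) * norm y powr (1 + (?d + 1 - k) / (p - 1)))) \<partial>lebesgue) =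
      layer (?d - 1) (\<lambda>y. ennreal (norm y powr - (1 + (?d + 1 - k) / (p - 1)))) x" for x :: "(real^'n) \<times> real"
    proof -
      have "1 / (A powr a * B powr b) = A powr - a * B powr - b" for A a B b :: real
        by (simp add: powr_minus divide_inverse)
      then show ?thesis unfolding layer_def nn_integral_completion by (simp only: ennreal_mult[symmetric] powr_ge_zero)
    qed
    show ?thesis
      unfolding layer Let_def
      by (rule explicit_solution[OF N3 lam0 that(1) kN that(2)]) blast
  qed
  have regular: "p > 1 \<and> 1 < k \<and> regular_riesz_solution ?d c (k - 1) p v"
    if "p \<le> 2 * ?d / (k - 1) - 1" "pos_solution lam p k u" "regular k u"
      "riesz_solution ?d c (k - 1) p v" "AE y in lborel. btrace u y = v y" for u :: "(real^'n) \<times> real \<Rightarrow> real" and c v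
  proof -
    have k1: "1 < k" using that(3) by (simp add: regular_def)
    \<comment> \<open>p \<le> 1 would give p(k-1) \<le> k - 1 < d, against the inequality satisfied
      by every solution.\<close>
    have p1: "p > 1"
    proof (rule ccontr)
      assume "\<not> ?thesis"
      then have "p * (k - 1) \<le> 1 * (k - 1)" using k1 by (intro mult_right_mono) auto
      with supercritical_mass[OF k1 that(2)] kN show False by simp
    qed
    with k1 regular_riesz_solution_if_regular[OF that(4,5,3) _ that(1)] show ?thesis by simp
  qed
  have iii: "\<not> (pos_solution lam p k u \<and> regular k u)" if k1: "1 < k" and p: "p < 2 * ?d / (k - 1) - 1" for u :: "(real^'n) \<times> real \<Rightarrow> real"
  proof
    assume u: "pos_solution lam p k u \<and> regular k u"
    obtain c where "\<And>(u :: (real^'n) \<times> real \<Rightarrow> real) p. \<lbrakk>p > 0; pos_solution lam p k u\<rbrakk> \<Longrightarrow>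
      \<exists>v. riesz_solution ?d c (k - 1) p v \<and> (AE y in lborel. btrace u y = v y) \<and>
        (AE X in lborel. X \<in> halfspace \<longrightarrow> ennreal (u X) = ennreal c0 *
          layer (?d - 1) (\<lambda>y. \<integral>\<^sup>+z. ennreal (v z powr p * norm (y - z) powr - k) \<partial>lborel) X)"
      by (rule positive_solution_riesz[OF N3 lam0 k1 kN, folded c0_def]) (rule that)
    from this[OF p0 conjunct1[OF u]] obtain v where v: "riesz_solution ?d c (k - 1) p v" "AE y in lborel. btrace u y = v y"
      by blast
    have "p > 1" and R: "regular_riesz_solution ?d c (k - 1) p v"
      using regular[OF less_imp_le[OF p] _ _ v] u by auto
    then have "2 * ?d - (k - 1) - p * (k - 1) = 0"
      by (intro regular_riesz_solution.no_subcritical_solution)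
    with k1 p show False by (simp add: field_simps)
  qed
  have iv: "\<exists>C>0. \<forall>u :: (real^'n) \<times> real \<Rightarrow> real. pos_solution lam p k u \<and> regular k u \<longrightarrow>
         (\<exists>\<zeta> :: real^'n. \<exists>t>0. AE x in lebesgue. x \<in> halfspace \<longrightarrow>
            ennreal (u x) = ennreal C *
              (\<integral>\<^sup>+ y. \<integral>\<^sup>+ z. ennreal ((t / (t\<^sup>2 + (norm (z - \<zeta>))\<^sup>2)) powr (?d + 1 - (k + 1) / 2) /
                  (norm (x - (y, 0)) powr (?d - 1) * norm (y - z) powr k)) \<partial>lebesgue \<partial>lebesgue))"
    if k1: "1 < k" and p: "p = 2 * ?d / (k - 1) - 1"
  proof -
    obtain c where c: "c > 0" and red: "\<And>(u :: (real^'n) \<times> real \<Rightarrow> real) p. \<lbrakk>p > 0; pos_solution lam p k u\<rbrakk> \<Longrightarrow>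
      \<exists>v. riesz_solution ?d c (k - 1) p v \<and> (AE y in lborel. btrace u y = v y) \<and>
        (AE X in lborel. X \<in> halfspace \<longrightarrow> ennreal (u X) = ennreal c0 *
          layer (?d - 1) (\<lambda>y. \<integral>\<^sup>+z. ennreal (v z powr p * norm (y - z) powr - k) \<partial>lborel) X)"
      by (rule positive_solution_riesz[OF N3 lam0 k1 kN, folded c0_def]) (rule that)
    define J where "J = (\<integral>\<^sup>+z. ennreal ((1 / (1 + (norm (z::real^'n))\<^sup>2)) powr (?d - (k - 1) / 2) * norm z powr - (k - 1)) \<partial>lborel)"
    define B0 where "B0 = (1 / (c * enn2real J)) powr (1 / (p - 1))"
    \<comment> \<open>If there is a regular solution, its amplitude is \<open>B0\<close>, which is
      then positive. Positivity of \<open>B0\<close> is not proved in advance; if it fails, no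
      regular solution exists and any positive constant will do.\<close>
    define C where "C = (if B0 > 0 then c0 * B0 powr p else 1)"
    have "\<exists>\<zeta> :: real^'n. \<exists>t>0. AE x in lebesgue. x \<in> halfspace \<longrightarrow>
            ennreal (u x) = ennreal C *
              (\<integral>\<^sup>+ y. \<integral>\<^sup>+ z. ennreal ((t / (t\<^sup>2 + (norm (z - \<zeta>))\<^sup>2)) powr (?d + 1 - (k + 1) / 2) /
                  (norm (x - (y, 0)) powr (?d - 1) * norm (y - z) powr k)) \<partial>lebesgue \<partial>lebesgue)"
      if u: "pos_solution lam p k u" "regular k u" for u :: "(real^'n) \<times> real \<Rightarrow> real"
    proof -
      obtain v where v: "riesz_solution ?d c (k - 1) p v" "AE y in lborel. btrace u y = v y"
        and uv: "AE X in lborel. X \<in> halfspace \<longrightarrow> ennreal (u X) = ennreal c0 *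
          layer (?d - 1) (\<lambda>y. \<integral>\<^sup>+z. ennreal (v z powr p * norm (y - z) powr - k) \<partial>lborel) X"
        using red[OF p0 u(1)] by blast
      have p1: "p > 1" and R: "regular_riesz_solution ?d c (k - 1) p v"
        using regular[OF _ u v] p by auto
      obtain \<zeta> t B where t: "t > 0" and B: "B > 0"
        and form: "AE x in lborel. v x = B * (t / (t\<^sup>2 + (norm (x - \<zeta>))\<^sup>2)) powr ((k - 1) / 2)"
        and amp: "ennreal B = ennreal (c * B powr p) * J"
        by (rule regular_riesz_solution.critical_solution[OF R p1, folded J_def]) (rule that)
      have "B = B0" unfolding B0_def by (rule bubble_amplitude_unique[OF c p1 B amp])
      then have C: "C = c0 * B powr p" using B by (simp add: C_def)
      \<comment> \<open>At the critical exponent p(k-1) = 2d - (k-1), and d + 1 - (k+1)/2 is N -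
        (k+1)/2.\<close>
      have "p * (k - 1) / 2 = ?d + 1 - (k + 1) / 2" using k1 by (simp add: p field_simps)
      note layer = layer_bubble[OF form this t B, of "?d - 1" k]
      have "AE x in lborel. x \<in> halfspace \<longrightarrow>
            ennreal (u x) = ennreal C *
              (\<integral>\<^sup>+ y. \<integral>\<^sup>+ z. ennreal ((t / (t\<^sup>2 + (norm (z - \<zeta>))\<^sup>2)) powr (?d + 1 - (k + 1) / 2) /
                  (norm (x - (y, 0)) powr (?d - 1) * norm (y - z) powr k)) \<partial>lborel \<partial>lborel)"
        using uv unfolding layer C using c0 by (simp add: ennreal_mult mult.assoc)
      with t show ?thesis unfolding AE_lebesgue_iff nn_integral_completion by blast
    qed
    moreover have "C > 0" using c0 by (simp add: C_def)
    ultimately show ?thesis by blast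
  qed
  have i1: "\<not> pos_solution lam p k u" if "k \<le> 1 \<or> 1 < k \<and> p < ?d / (k - 1)" for u :: "(real^'n) \<times> real \<Rightarrow> real"
    using that by (intro i) linarith
  have i2: "\<not> (pos_solution lam p k u \<and> in_Lp p (btrace u))" if "1 < k \<and> p = ?d / (k - 1)" for u :: "(real^'n) \<times> real \<Rightarrow> real"
    using that i[of u] by simp
  show ?thesis
    apply (intro conjI impI)
    subgoal using i1 by blast
    subgoal using i2 by blast
    subgoal by (elim conjE) (rule ii)
    subgoal using iii by blast
    subgoal by (elim conjE) (rule iv)
    done
qed

end
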